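(* Let $1<p_0<\infty$, $\vec p=(p_1,\dots,p_n)$ with $1<p_i<\infty$, and $\frac n{p_0}<\sum_{i=1}^n\frac1{p_i}$. Then the Köthe dual (associate space) of $\mathcal M^{p_0}_{\vec p}(\mathbb{R}^n)$ is $\mathcal{B}^{p_0'}_{\vec p\,'}(\mathbb{R}^n)$: a measurable function $f$ satisfies $$\sup\left\{\int_{\mathbb{R}^n}|f(x)g(x)|\,dx: g\in\mathcal M^{p_0}_{\vec p}(\mathbb{R}^n),\ \|g\|_{\mathcal M^{p_0}_{\vec p}(\mathbb{R}^n)}\le1\right\}<\infty$$ if and only if $f\in\mathcal{B}^{p_0'}_{\vec p\,'}(\mathbb{R}^n)$, and in that case this supremum equals $\|f\|_{\mathcal{B}^{p_0'}_{\vec p\,'}(\mathbb{R}^n)}$.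
   Context: $L^{\vec q}(\mathbb{R}^n)$ denotes the mixed-norm Lebesgue space with norm $\|f\|_{L^{\vec q}}=\big(\int_{\mathbb{R}}\cdots(\int_{\mathbb{R}}|f|^{q_1}dx_1)^{q_2/q_1}\cdots dx_n\big)^{1/q_n}$; $\vec p\,'=(p_1',\dots,p_n')$ with $1/p_i+1/p_i'=1$, and $p_0'$ is the conjugate of $p_0$. Cubes have sides parallel to the axes. The mixed Morrey space $\mathcal M^{p_0}_{\vec p}(\mathbb{R}^n)$ (for $\frac n{p_0}\le\sum_i\frac1{p_i}$) is the set of measurable $f$ with $$\|f\|_{\mathcal M^{p_0}_{\vec p}(\mathbb{R}^n)}=\sup_{Q}|Q|^{\frac1{p_0}-\frac1n\sum_{j=1}^n\frac1{p_j}}\|f\chi_Q\|_{L^{\vec p}(\mathbb{R}^n)}<\infty,$$ supremum over all cubes $Q$. A measurable function $b$ is a $(p_0',\vec p\,')$-block if there is a cube $Q$ with $\operatorname{supp}b\subset Q$ and $\|b\|_{L^{\vec p\,'}(\mathbb{R}^n)}\le|Q|^{\frac1{p_0}-\frac1n\sum_{i=1}^n\frac1{p_i}}$. The block space $\mathcal{B}^{p_0'}_{\vec p\,'}(\mathbb{R}^n)$ consists of measurable functions $f=\sum_{i=1}^\infty\lambda_ib_i$ (series converging in $L^1_{\mathrm{loc}}$ and a.e.) with $\{\lambda_i\}\in\ell^1$ and each $b_i$ a $(p_0',\vec p\,')$-block, normed by $\|f\|_{\mathcal{B}^{p_0'}_{\vec p\,'}}=\inf\|\{\lambda_i\}\|_{\ell^1}$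 over all such decompositions. *)

theory Defs
  imports "HOL-Analysis.Analysis"
begin

text \<open>Points of R^n are functions nat => real, extensional on {..<n};
  coordinate x_i of the paper is x (i-1). Exponent vectors are P :: nat => real,
  with p_i = P (i-1).\<close>

definition Rn :: "nat \<Rightarrow> (nat \<Rightarrow> real) measure" where
  "Rn n = completion (PiM {..<n} (\<lambda>_. lborel))"

text \<open>Real power of an extended nonnegative real (used with positive exponents).\<close>
definition epow :: "ennreal \<Rightarrow> real \<Rightarrow> ennreal" where
  "epow x p = (if x = (\<infinity>::ennreal) then (\<infinity>::ennreal) else ennreal (enn2real x powr p))"

fun mixn :: "(nat \<Rightarrow> real) \<Rightarrow> nat \<Rightarrow> ((nat \<Rightarrow> real) \<Rightarrow> real) \<Rightarrow> (nat \<Rightarrow> real) \<Rightarrow> ennreal" where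
  "mixn P 0 f x = ennreal \<bar>f x\<bar>"
| "mixn P (Suc k) f x =
     epow (\<integral>\<^sup>+ t. epow (mixn P k f (x(k := t))) (P k) \<partial>lebesgue) (1 / P k)"

definition mixed_norm :: "nat \<Rightarrow> (nat \<Rightarrow> real) \<Rightarrow> ((nat \<Rightarrow> real) \<Rightarrow> real) \<Rightarrow> ennreal" where
  "mixed_norm n P f = mixn P n f (\<lambda>_. undefined)"

definition conj_exp :: "real \<Rightarrow> real" where
  "conj_exp p = p / (p - 1)"

definition cube :: "nat \<Rightarrow> (nat \<Rightarrow> real) \<Rightarrow> real \<Rightarrow> (nat \<Rightarrow> real) set" where
  "cube n a l = {x \<in> extensional {..<n}. \<forall>i<n. a i \<le> x i \<and> x i \<le> a i + l}"

definition cubes :: "nat \<Rightarrow> (nat \<Rightarrow> real) set set" where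
  "cubes n = {cube n a l | a l. l > 0}"

definition morrey_factor :: "nat \<Rightarrow> real \<Rightarrow> (nat \<Rightarrow> real) \<Rightarrow> real \<Rightarrow> real" where
  "morrey_factor n p0 P l = (l ^ n) powr (1 / p0 - (1 / real n) * (\<Sum>j<n. 1 / P j))"

definition morrey_norm :: "nat \<Rightarrow> real \<Rightarrow> (nat \<Rightarrow> real) \<Rightarrow> ((nat \<Rightarrow> real) \<Rightarrow> real) \<Rightarrow> ennreal" where
  "morrey_norm n p0 P f =
     (SUP (a, l) \<in> {(a, l). l > (0::real)}.
        ennreal (morrey_factor n p0 P l) * mixed_norm n P (\<lambda>x. f x * indicator (cube n a l) x))"

definition morrey_space :: "nat \<Rightarrow> real \<Rightarrow> (nat \<Rightarrow> real) \<Rightarrow> ((nat \<Rightarrow> real) \<Rightarrow> real) set" where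
  "morrey_space n p0 P = {f \<in> borel_measurable (Rn n). morrey_norm n p0 P f < (\<infinity>::ennreal)}"

text \<open>(p0', P')-block: supported in a cube Q and with L^{P'}-norm at most
  |Q|^(1/p0 - (1/n) sum 1/p_i).\<close>
definition is_block :: "nat \<Rightarrow> real \<Rightarrow> (nat \<Rightarrow> real) \<Rightarrow> ((nat \<Rightarrow> real) \<Rightarrow> real) \<Rightarrow> bool" where
  "is_block n p0 P b \<longleftrightarrow> b \<in> borel_measurable (Rn n) \<and>
     (\<exists>a l. l > 0 \<and> (\<forall>x \<in> space (Rn n). b x \<noteq> 0 \<longrightarrow> x \<in> cube n a l) \<and>
        mixed_norm n (\<lambda>i. conj_exp (P i)) b \<le> ennreal (morrey_factor n p0 P l))"

text \<open>f = sum lam_i b_i with lam in l^1, b_i blocks, convergence in L^1_loc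
  (on every cube, hence every compact set) and almost everywhere.\<close>
definition block_decomp :: "nat \<Rightarrow> real \<Rightarrow> (nat \<Rightarrow> real) \<Rightarrow> ((nat \<Rightarrow> real) \<Rightarrow> real)
    \<Rightarrow> (nat \<Rightarrow> real) \<Rightarrow> (nat \<Rightarrow> (nat \<Rightarrow> real) \<Rightarrow> real) \<Rightarrow> bool" where
  "block_decomp n p0 P f lam b \<longleftrightarrow>
     summable (\<lambda>i. \<bar>lam i\<bar>) \<and> (\<forall>i. is_block n p0 P (b i)) \<and>
     (\<forall>Q \<in> cubes n. (\<lambda>N. \<integral>\<^sup>+ x \<in> Q. ennreal \<bar>(\<Sum>i<N. lam i * b i x) - f x\<bar> \<partial>Rn n)
                        \<longlonglongrightarrow> 0) \<and>
     (AE x in Rn n. (\<lambda>N. \<Sum>i<N. lam i * b i x) \<longlonglongrightarrow> f x)"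

definition block_space :: "nat \<Rightarrow> real \<Rightarrow> (nat \<Rightarrow> real) \<Rightarrow> ((nat \<Rightarrow> real) \<Rightarrow> real) set" where
  "block_space n p0 P = {f \<in> borel_measurable (Rn n). \<exists>lam b. block_decomp n p0 P f lam b}"

definition block_norm :: "nat \<Rightarrow> real \<Rightarrow> (nat \<Rightarrow> real) \<Rightarrow> ((nat \<Rightarrow> real) \<Rightarrow> real) \<Rightarrow> ennreal" where
  "block_norm n p0 P f =
     (INF (lam, b) \<in> {(lam, b). block_decomp n p0 P f lam b}. ennreal (\<Sum>i. \<bar>lam i\<bar>))"

definition kothe_sup :: "nat \<Rightarrow> real \<Rightarrow> (nat \<Rightarrow> real) \<Rightarrow> ((nat \<Rightarrow> real) \<Rightarrow> real) \<Rightarrow> ennreal" where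
  "kothe_sup n p0 P f =
     (SUP g \<in> {g \<in> morrey_space n p0 P. morrey_norm n p0 P g \<le> 1}.
        \<integral>\<^sup>+ x. ennreal \<bar>f x * g x\<bar> \<partial>Rn n)"

end

theory Submission
  imports Defs "HOL-Library.Function_Algebras"
begin

text \<open>
  That the supremum is at most the block norm is Hoelder's inequality on each block. For the
  converse, fix \<open>q > 1\<close> and a countable family of cubes \<open>Q\<^sub>i\<close> that is locally finite at each scale and
  such that every cube lies in some \<open>Q\<^sub>i\<close> of comparable size (ratio at most \<open>q\<^sup>2\<close>). If \<open>g\<close> is bounded
  with bounded support, the weighted norms \<open>N\<^sub>i g\<close> of \<open>g\<close> on \<open>Q\<^sub>i\<close> tend to 0: small cubes because
  \<open>p\<^sub>0 < \<infinity>\<close>, large ones because \<open>n / p\<^sub>0 < \<Sum> 1 / p\<^sub>i\<close>. Hence \<open>g \<mapsto> (g \<chi>\<^sub>Q\<^sub>i)\<^sub>i\<close> maps into a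
  \<open>c\<^sub>0\<close>-sum, and extending \<open>g \<mapsto> \<integral> \<bar>f\<bar> g\<close> by Hahn-Banach, dominated by the positive part, splits it as
  \<open>\<Sum>\<^sub>i T\<^sub>i\<close> with positive \<open>T\<^sub>i \<le> w\<^sub>i N\<^sub>i\<close> and \<open>\<Sum> w\<^sub>i\<close> at most the constant. As \<open>T\<^sub>i g \<le> \<integral> \<bar>f\<bar> g\<close>, each
  \<open>T\<^sub>i\<close> is a countably additive measure with a density \<open>\<phi>\<^sub>i \<ge> 0\<close>, so that \<open>\<bar>f\<bar> = \<Sum> \<phi>\<^sub>i\<close>, and the
  converse of Hoelder's inequality makes \<open>\<phi>\<^sub>i / w\<^sub>i\<close> a block. Letting \<open>q \<longrightarrow> 1\<close> gives the exact norm.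
\<close>

section \<open>The Hahn-Banach theorem\<close>

text \<open>The obstacle is that a functional on bounded sequences may have a part that lives at
  infinity and belongs to no single cube. Test functions whose norms tend to 0 along the cubes
  exclude it: on the tail of such a sequence the dominating functional is small, so the restrictions
  to single coordinates recover the whole pairing. Domination by the norm of the positive part, in
  place of the norm itself, makes every restriction positive: a nonpositive argument has positive
  part 0, so the functional is at most 0 there. Positivity in turn puts each piece below the pairing
  with \<open>\<bar>f\<bar>\<close>, and this is what yields countable additivity and absolute
  continuity. A series requires countably many cubes, hence a comparison of an arbitrary cube with
  one of the grid. With \<open>\<delta>\<close> the difference of the sum of the
  \<open>1 / p\<^sub>i\<close> and \<open>n / p\<^sub>0\<close>, a cube of side \<open>l\<close> has
  weight \<open>l powr (- \<delta>)\<close>, so a ratio \<open>q\<^sup>2\<close> of sides costs the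
  factor \<open>q powr (2 * \<delta>)\<close>, which tends to 1. Since the block norm is an infimum,
  no optimal decomposition has to be found.\<close>

definition sublinear_on :: "'v::real_vector set \<Rightarrow> ('v \<Rightarrow> real) \<Rightarrow> bool" where
  "sublinear_on Y p \<longleftrightarrow> (\<forall>x\<in>Y. \<forall>y\<in>Y. p (x + y) \<le> p x + p y) \<and> (\<forall>x\<in>Y. \<forall>c\<ge>0. p (c *\<^sub>R x) = c * p x)"

lemma sublinear_onD:
  assumes "sublinear_on Y p"
  shows "x \<in> Y \<Longrightarrow> y \<in> Y \<Longrightarrow> p (x + y) \<le> p x + p y"
    and "x \<in> Y \<Longrightarrow> c \<ge> 0 \<Longrightarrow> p (c *\<^sub>R x) = c * p x"
  using assms by (auto simp: sublinear_on_def)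

lemma sublinear_on_lower:
  assumes "sublinear_on Y p" "subspace Y" "x \<in> Y"
  shows "- p (- x) \<le> p x"
proof -
  have "0 = p (0 *\<^sub>R x)"
    using sublinear_onD(2)[OF assms(1,3), of 0] by simp
  also have "\<dots> = p (x + - x)" by simp
  also have "\<dots> \<le> p x + p (- x)"
    using assms by (intro sublinear_onD(1)) (auto intro: subspace_neg)
  finally show ?thesis by simp
qed

text \<open>The infimum is finite because \<open>T d \<le> p d\<close> and subadditivity bound
  \<open>p (y + d) - T d\<close> below by \<open>- p (- y)\<close>. \<open>D\<close> is only a
  convex cone, so one construction serves for a ray, where it shows that a minimal functional is
  additive, and for a subspace, where it forces domination by \<open>T\<close> on \<open>D\<close>.
  Everything is relative to \<open>Y\<close> because the functional used later is a supremum that is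
  finite only on bounded families.\<close>

lemma sublinear_on_INF_shift:
  fixes p :: "'v::real_vector \<Rightarrow> real"
  assumes p: "sublinear_on Y p" and Y: "subspace Y"
    and D: "D \<subseteq> Y" "0 \<in> D" "\<And>d e. d \<in> D \<Longrightarrow> e \<in> D \<Longrightarrow> d + e \<in> D"
      "\<And>d c. d \<in> D \<Longrightarrow> c \<ge> 0 \<Longrightarrow> c *\<^sub>R d \<in> D"
    and T: "\<And>d e. d \<in> D \<Longrightarrow> e \<in> D \<Longrightarrow> T (d + e) = T d + T e"
      "\<And>d c. d \<in> D \<Longrightarrow> c \<ge> 0 \<Longrightarrow> T (c *\<^sub>R d) = c * T d"
      "\<And>d. d \<in> D \<Longrightarrow> T d \<le> p d"
  defines "r \<equiv> \<lambda>y. INF d\<in>D. p (y + d) - T d"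
  shows "sublinear_on Y r" and "\<And>y d. y \<in> Y \<Longrightarrow> d \<in> D \<Longrightarrow> r y \<le> p (y + d) - T d"
proof -
  have bdd: "- p (- y) \<le> p (y + d) - T d" if "y \<in> Y" "d \<in> D" for y d
  proof -
    have "d \<in> Y" using that D(1) by auto
    have "T d \<le> p ((y + d) + - y)" using T(3)[OF that(2)] by simp
    also have "\<dots> \<le> p (y + d) + p (- y)"
      using that \<open>d \<in> Y\<close> Y by (intro sublinear_onD(1)[OF p]) (auto intro: subspace_neg subspace_add)
    finally show ?thesis by simp
  qed
  show le: "r y \<le> p (y + d) - T d" if "y \<in> Y" "d \<in> D" for y d
    unfolding r_def using bdd that by (intro cINF_lower bdd_belowI2) auto
  have T0: "T 0 = 0"
    using T(2)[of 0 0] D(2) by simp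
  have p0: "p 0 = 0"
    using sublinear_onD(2)[OF p, of 0 0] D by (auto simp: subset_eq)
  have ge: "K \<le> r y" if "\<And>d. d \<in> D \<Longrightarrow> K \<le> p (y + d) - T d" for K y
    unfolding r_def using D(2) that by (intro cINF_greatest) auto
  have sub: "r (x + y) \<le> r x + r y" if xy: "x \<in> Y" "y \<in> Y" for x y
  proof -
    have *: "r (x + y) \<le> (p (x + d) - T d) + (p (y + e) - T e)" if de: "d \<in> D" "e \<in> D" for d e
    proof -
      have "r (x + y) \<le> p ((x + y) + (d + e)) - T (d + e)"
        using xy de D Y by (intro le) (auto intro: subspace_add)
      also have "(x + y) + (d + e) = (x + d) + (y + e)" by simp
      also have "p \<dots> \<le> p (x + d) + p (y + e)"
        using xy de D Y by (intro sublinear_onD(1)[OF p]) (auto intro!: subspace_add)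
      finally show ?thesis using T(1)[OF de] by simp
    qed
    have "r (x + y) - (p (x + d) - T d) \<le> r y" if "d \<in> D" for d
      using *[OF that] by (intro ge) (smt (verit))
    then have "r (x + y) - r y \<le> r x"
      by (intro ge) (smt (verit))
    then show ?thesis by simp
  qed
  \<comment> \<open>Rescaling \<open>d\<close> by \<open>1 / c\<close> inside the cone gives one
    inequality; the same one for \<open>1 / c\<close> and the scaled point gives the other.\<close>
  have hom: "c * r x \<le> r (c *\<^sub>R x)" if "c > 0" "x \<in> Y" for c x
  proof (rule ge)
    fix d assume d: "d \<in> D"
    have "r x \<le> p (x + (1/c) *\<^sub>R d) - T ((1/c) *\<^sub>R d)"
      using that d D by (intro le) auto
    then have "c * r x \<le> c * p (x + (1/c) *\<^sub>R d) - c * T ((1/c) *\<^sub>R d)"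
      using that by (metis less_eq_real_def mult_left_mono right_diff_distrib)
    also have "c * p (x + (1/c) *\<^sub>R d) = p (c *\<^sub>R (x + (1/c) *\<^sub>R d))"
      using that d D Y by (intro sublinear_onD(2)[OF p, symmetric]) (auto intro!: subspace_add)
    also have "c *\<^sub>R (x + (1/c) *\<^sub>R d) = c *\<^sub>R x + d"
      using that by (simp add: scaleR_add_right)
    also have "c * T ((1/c) *\<^sub>R d) = T d"
      using T(2)[OF d, of "1/c"] that by simp
    finally show "c * r x \<le> p (c *\<^sub>R x + d) - T d" .
  qed
  have r0: "r 0 = 0"
  proof (rule antisym)
    show "r 0 \<le> 0" using le[of 0 0] T0 p0 D Y by (auto simp: subspace_0)
    show "0 \<le> r 0" by (rule ge) (use T(3) in auto)
  qed
  have "r (c *\<^sub>R x) = c * r x" if c: "c \<ge> 0" "x \<in> Y" for c x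
  proof (cases "c = 0")
    case False
    with c have "c > 0" by simp
    from hom[of "1/c" "c *\<^sub>R x"] \<open>c > 0\<close> that Y have "(1/c) * r (c *\<^sub>R x) \<le> r x"
      by (auto intro: subspace_scale)
    then have "r (c *\<^sub>R x) \<le> c * r x"
      using \<open>c > 0\<close> by (simp add: field_simps)
    with hom[OF \<open>c > 0\<close> c(2)] show ?thesis by simp
  qed (use r0 in simp)
  with sub show "sublinear_on Y r"
    by (auto simp: sublinear_on_def)
qed

text \<open>Shifting \<open>p\<close> along the ray through \<open>y\<close> gives a smaller sublinear functional, hence \<open>p\<close> itself.\<close>
lemma minimal_sublinear_linear:
  fixes p :: "'v::real_vector \<Rightarrow> real"
  assumes p: "sublinear_on Y p" and Y: "subspace Y"
    and min: "\<And>r. sublinear_on Y r \<Longrightarrow> (\<And>y. y \<in> Y \<Longrightarrow> r y \<le> p y) \<Longrightarrow> (\<And>y. y \<in> Y \<Longrightarrow> r y = p y)"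
    and xy: "x \<in> Y" "y \<in> Y"
  shows "p (x + y) = p x + p y"
proof (rule antisym)
  show "p (x + y) \<le> p x + p y" using sublinear_onD(1)[OF p xy] .
  define D where "D = (\<lambda>t. t *\<^sub>R y) ` {0..}"
  define T where "T = p"
  define r where "r z = (INF d\<in>D. p (z + d) - T d)" for z
  have D: "D \<subseteq> Y" "0 \<in> D" "\<And>d e. d \<in> D \<Longrightarrow> e \<in> D \<Longrightarrow> d + e \<in> D"
      "\<And>d c. d \<in> D \<Longrightarrow> c \<ge> 0 \<Longrightarrow> c *\<^sub>R d \<in> D" "y \<in> D"
  proof -
    show "D \<subseteq> Y" using xy Y by (auto simp: D_def subspace_scale)
    show "0 \<in> D" by (auto simp: D_def intro!: image_eqI[of _ _ 0])
    show "y \<in> D" by (auto simp: D_def intro!: image_eqI[of _ _ 1])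
    fix d assume "d \<in> D"
    then obtain s where s: "s \<ge> 0" "d = s *\<^sub>R y" by (auto simp: D_def)
    show "c *\<^sub>R d \<in> D" if "c \<ge> 0" for c
      using s that by (auto simp: D_def intro!: image_eqI[of _ _ "c * s"])
    fix e assume "e \<in> D"
    then obtain t where "t \<ge> 0" "e = t *\<^sub>R y" by (auto simp: D_def)
    with s show "d + e \<in> D"
      by (auto simp: D_def scaleR_add_left intro!: image_eqI[of _ _ "s + t"])
  qed
  have T: "T (d + e) = T d + T e" if "d \<in> D" "e \<in> D" for d e
  proof -
    from that obtain s t where st: "s \<ge> 0" "d = s *\<^sub>R y" "t \<ge> 0" "e = t *\<^sub>R y"
      by (auto simp: D_def)
    have "T (d + e) = p ((s + t) *\<^sub>R y)" using st by (simp add: T_def scaleR_add_left)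
    also have "\<dots> = (s + t) * p y" using st by (intro sublinear_onD(2)[OF p xy(2)]) auto
    also have "\<dots> = p (s *\<^sub>R y) + p (t *\<^sub>R y)"
      using st by (simp add: sublinear_onD(2)[OF p xy(2)] algebra_simps)
    finally show ?thesis using st by (simp add: T_def)
  qed
  have T': "T (c *\<^sub>R d) = c * T d" if "d \<in> D" "c \<ge> 0" for c d
    using that D(1) sublinear_onD(2)[OF p] by (auto simp: T_def)
  have T'': "T d \<le> p d" for d by (simp add: T_def)
  note r = sublinear_on_INF_shift[where p = p and T = T, OF p Y D(1-4) T T' T'', folded r_def]
  have "r z \<le> p z" if "z \<in> Y" for z
  proof -
    have "r z \<le> p (z + 0) - T 0"
      using that D by (intro r(2)) (auto simp: T_def)
    also have "T 0 = 0" using T'[of 0 0] D by simp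
    finally show ?thesis by simp
  qed
  \<comment> \<open>Minimality turns \<open>r \<le> p\<close> into equality on \<open>Y\<close>, and
    the choice \<open>d = y\<close> in the infimum then gives superadditivity.\<close>
  with r(1) have "p x = r x"
    using xy by (intro min[symmetric]) (auto simp: T_def)
  also have "r x \<le> p (x + y) - T y"
    using xy D by (intro r(2)) (auto simp: T_def)
  finally show "p x + p y \<le> p (x + y)" by (simp add: T_def)
qed

text \<open>An infimum of sublinear functionals need not be subadditive; in a chain, the smaller of
  two members bounds both terms at once. The common upper bound \<open>q\<close> bounds every member
  below by \<open>- q (- y)\<close>.\<close>

lemma chain_INF_sublinear_on:
  fixes p :: "'v::real_vector \<Rightarrow> real"
  assumes C: "C \<noteq> {}" "\<And>r. r \<in> C \<Longrightarrow> sublinear_on Y r" "\<And>r y. r \<in> C \<Longrightarrow> y \<in> Y \<Longrightarrow> r y \<le> q y"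
    and chain: "\<And>r s. r \<in> C \<Longrightarrow> s \<in> C \<Longrightarrow> (\<forall>y\<in>Y. r y \<le> s y) \<or> (\<forall>y\<in>Y. s y \<le> r y)"
    and Y: "subspace Y"
  shows "sublinear_on Y (\<lambda>y. INF r\<in>C. r y)" and "\<And>r y. r \<in> C \<Longrightarrow> y \<in> Y \<Longrightarrow> (INF r\<in>C. r y) \<le> r y"
proof -
  have bdd: "- q (- y) \<le> r y" if "r \<in> C" "y \<in> Y" for r y
    using sublinear_on_lower[OF C(2)[OF that(1)] Y that(2)] C(3)[OF that(1), of "- y"] that Y
    by (auto simp: subspace_neg)
  show le: "(INF r\<in>C. r y) \<le> r y" if "r \<in> C" "y \<in> Y" for r y
    using that bdd by (intro cINF_lower bdd_belowI2) auto
  have ge: "K \<le> (INF r\<in>C. r y)" if "\<And>r. r \<in> C \<Longrightarrow> K \<le> r y" for K y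
    using that C(1) by (intro cINF_greatest) auto
  let ?m = "\<lambda>y. INF r\<in>C. r y"
  have sub: "?m (x + y) \<le> ?m x + ?m y" if xy: "x \<in> Y" "y \<in> Y" for x y
  proof -
    have *: "?m (x + y) \<le> r x + s y" if rs: "r \<in> C" "s \<in> C" for r s
    proof -
      obtain t where t: "t \<in> C" "t x \<le> r x" "t y \<le> s y"
        using chain[OF rs] rs xy by auto
      have "?m (x + y) \<le> t (x + y)"
        using t xy Y by (intro le) (auto simp: subspace_add)
      also have "\<dots> \<le> t x + t y"
        using sublinear_onD(1)[OF C(2)[OF t(1)] xy] .
      finally show ?thesis using t by simp
    qed
    have "?m (x + y) - r x \<le> ?m y" if "r \<in> C" for r
      using *[OF that] by (intro ge) (smt (verit))
    then have "?m (x + y) - ?m y \<le> ?m x"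
      by (intro ge) (smt (verit))
    then show ?thesis by simp
  qed
  have hom: "c * ?m x \<le> ?m (c *\<^sub>R x)" if "c \<ge> 0" "x \<in> Y" for c x
    using that sublinear_onD(2)[OF C(2)] le
    by (intro ge) (metis mult_left_mono)
  have "?m (c *\<^sub>R x) = c * ?m x" if c: "c \<ge> 0" "x \<in> Y" for c x
  proof (cases "c = 0")
    case True
    have "r 0 = 0" if "r \<in> C" for r
      using sublinear_onD(2)[OF C(2)[OF that], of x 0] c by simp
    then have "?m 0 = (INF r\<in>C. 0)" by (intro INF_cong) auto
    then show ?thesis using True C(1) by simp
  next
    case False
    with c have "c > 0" by simp
    from hom[of "1/c" "c *\<^sub>R x"] \<open>c > 0\<close> that Y have "(1/c) * ?m (c *\<^sub>R x) \<le> ?m x"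
      by (auto intro: subspace_scale)
    then have "?m (c *\<^sub>R x) \<le> c * ?m x"
      using \<open>c > 0\<close> by (simp add: field_simps)
    with hom[OF c] show ?thesis by simp
  qed
  with sub show "sublinear_on Y ?m"
    by (auto simp: sublinear_on_def)
qed

lemma minimal_sublinear_exists:
  fixes q :: "'v::real_vector \<Rightarrow> real"
  assumes q: "sublinear_on Y q" and Y: "subspace Y"
  obtains p where "sublinear_on Y p" "\<And>y. y \<in> Y \<Longrightarrow> p y \<le> q y"
    "\<And>r y. sublinear_on Y r \<Longrightarrow> (\<And>y. y \<in> Y \<Longrightarrow> r y \<le> p y) \<Longrightarrow> y \<in> Y \<Longrightarrow> r y = p y"
proof -
  \<comment> \<open>Members vanish off \<open>Y\<close>, which makes the pointwise order on the
    whole type antisymmetric. In \<open>P p r\<close> the smaller functional comes second, so a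
    maximal element in Zorn's sense is minimal.\<close>
  define S where "S = {p. sublinear_on Y p \<and> (\<forall>y\<in>Y. p y \<le> q y) \<and> (\<forall>y. y \<notin> Y \<longrightarrow> p y = 0)}"
  define P where "P = (\<lambda>p r :: 'v \<Rightarrow> real. \<forall>y. r y \<le> p y)"
  define cut where "cut = (\<lambda>r y. if y \<in> Y then r y else (0::real))"
  have cut: "cut r \<in> S" if "sublinear_on Y r" "\<And>y. y \<in> Y \<Longrightarrow> r y \<le> q y" for r
    using that Y by (auto simp: S_def cut_def sublinear_on_def subspace_add subspace_scale)
  have "\<exists>m\<in>S. \<forall>a\<in>S. P m a \<longrightarrow> a = m"
  proof (rule predicate_Zorn)
    show "partial_order_on S (relation_of P S)"
    proof (rule partial_order_on_relation_ofI)
      show "P a c" if "P a b" "P b c" for a b c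
        using that unfolding P_def by (meson order_trans)
      show "a = b" if "P a b" "P b a" for a b
        using that unfolding P_def by (intro ext antisym) auto
    qed (simp add: P_def)
    fix C assume C: "C \<in> Chains (relation_of P S)"
    then have sub: "C \<subseteq> S" and ch: "\<And>r s. r \<in> C \<Longrightarrow> s \<in> C \<Longrightarrow> P r s \<or> P s r"
      by (auto simp: Chains_def relation_of_def)
    show "\<exists>u\<in>S. \<forall>a\<in>C. P a u"
    proof (cases "C = {}")
      case True
      then show ?thesis using cut[OF q] by auto
    next
      case False
      have C': "\<And>r. r \<in> C \<Longrightarrow> sublinear_on Y r" "\<And>r y. r \<in> C \<Longrightarrow> y \<in> Y \<Longrightarrow> r y \<le> q y"
        using sub by (auto simp: S_def)
      have ch': "(\<forall>y\<in>Y. r y \<le> s y) \<or> (\<forall>y\<in>Y. s y \<le> r y)" if "r \<in> C" "s \<in> C" for r s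
        using ch[OF that] by (auto simp: P_def)
      have m: "sublinear_on Y (\<lambda>y. INF r\<in>C. r y)"
        by (rule chain_INF_sublinear_on(1)[where q = q, OF False _ _ _ Y]) (use C' ch' in auto)
      have m': "(INF r\<in>C. r y) \<le> r y" if "r \<in> C" "y \<in> Y" for r y
        by (rule chain_INF_sublinear_on(2)[where q = q and Y = Y, OF False _ _ _ Y]) (use C' ch' that in auto)
      from False obtain r where "r \<in> C" by auto
      then have "cut (\<lambda>y. INF r\<in>C. r y) \<in> S"
        using m m'[of r] C'(2)[of r] by (intro cut) (auto intro: order_trans)
      moreover have "P a (cut (\<lambda>y. INF r\<in>C. r y))" if "a \<in> C" for a
        using m'[OF that] sub that by (auto simp: P_def cut_def S_def)
      ultimately show ?thesis by auto
    qed
  qed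
  then obtain m where m: "m \<in> S" "\<And>a. a \<in> S \<Longrightarrow> P m a \<Longrightarrow> a = m" by auto
  show thesis
  proof
    show "sublinear_on Y m" "\<And>y. y \<in> Y \<Longrightarrow> m y \<le> q y" using m(1) by (auto simp: S_def)
    fix r y assume r: "sublinear_on Y r" "\<And>y. y \<in> Y \<Longrightarrow> r y \<le> m y" and "y \<in> Y"
    have "cut r = m"
      using m(1) r by (intro m(2) cut) (auto simp: S_def P_def cut_def intro: order_trans)
    then show "r y = m y" using \<open>y \<in> Y\<close> by (auto simp: cut_def fun_eq_iff split: if_splits)
  qed
qed

text \<open>A minimal sublinear functional \<open>p\<close> below \<open>r\<close> is linear, and
  \<open>d = 0\<close> in the infimum puts it below \<open>q\<close>. On \<open>D\<close> the shift
  by \<open>- d\<close> gives \<open>p d \<le> T d\<close>; the same for \<open>- d\<close> gives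
  equality.\<close>

theorem hahn_banach_sublinear:
  fixes q :: "'v::real_vector \<Rightarrow> real"
  assumes q: "sublinear_on Y q" and Y: "subspace Y" and D: "subspace D" "D \<subseteq> Y"
    and T: "\<And>d e. d \<in> D \<Longrightarrow> e \<in> D \<Longrightarrow> T (d + e) = T d + T e"
      "\<And>d c. d \<in> D \<Longrightarrow> T (c *\<^sub>R d) = c * T d"
      "\<And>d. d \<in> D \<Longrightarrow> T d \<le> q d"
  obtains L where "\<And>x y. x \<in> Y \<Longrightarrow> y \<in> Y \<Longrightarrow> L (x + y) = L x + L y"
    "\<And>x c. x \<in> Y \<Longrightarrow> L (c *\<^sub>R x) = c * L x" "\<And>x. x \<in> Y \<Longrightarrow> L x \<le> q x" "\<And>d. d \<in> D \<Longrightarrow> L d = T d"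
proof -
  define r where "r y = (INF d\<in>D. q (y + d) - T d)" for y
  have D': "0 \<in> D" "\<And>d e. d \<in> D \<Longrightarrow> e \<in> D \<Longrightarrow> d + e \<in> D"
      "\<And>d c. d \<in> D \<Longrightarrow> c \<ge> 0 \<Longrightarrow> c *\<^sub>R d \<in> D"
    using D(1) by (auto simp: subspace_0 subspace_add subspace_scale)
  note r = sublinear_on_INF_shift[where p = q and T = T, OF q Y D(2) D' T(1) T(2) T(3), folded r_def]
  obtain p where p: "sublinear_on Y p" "\<And>y. y \<in> Y \<Longrightarrow> p y \<le> r y"
    "\<And>s y. sublinear_on Y s \<Longrightarrow> (\<And>y. y \<in> Y \<Longrightarrow> s y \<le> p y) \<Longrightarrow> y \<in> Y \<Longrightarrow> s y = p y"
    using minimal_sublinear_exists[OF r(1) Y] by blast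
  have add: "p (x + y) = p x + p y" if "x \<in> Y" "y \<in> Y" for x y
    by (rule minimal_sublinear_linear[OF p(1) Y _ that]) (use p(3) in blast)
  have p0: "p 0 = 0"
    using sublinear_onD(2)[OF p(1), of 0 0] Y by (auto simp: subspace_0)
  have neg: "p (- x) = - p x" if "x \<in> Y" for x
    using add[OF that subspace_neg[OF Y that]] p0 by simp
  have scale: "p (c *\<^sub>R x) = c * p x" if "x \<in> Y" for c x
  proof (cases "c \<ge> 0")
    case True
    then show ?thesis using sublinear_onD(2)[OF p(1) that] by simp
  next
    case False
    have "p (c *\<^sub>R x) = p (- ((- c) *\<^sub>R x))" by simp
    also have "\<dots> = - p ((- c) *\<^sub>R x)" 
      by (intro neg subspace_scale that Y)
    also have "\<dots> = - (- c * p x)" using sublinear_onD(2)[OF p(1) that, of "- c"] False by simp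
    finally show ?thesis by simp
  qed
  have T0: "T 0 = 0" using T(2)[of 0 0] D' by simp
  have q0: "q 0 = 0"
    using sublinear_onD(2)[OF q, of 0 0] Y by (auto simp: subspace_0)
  have le: "p d \<le> T d" if "d \<in> D" for d
  proof -
    have "d \<in> Y" using that D by auto
    then have "p d \<le> r d" by (rule p(2))
    also have "\<dots> \<le> q (d + - d) - T (- d)"
      using \<open>d \<in> Y\<close> that D by (intro r(2)) (auto simp: subspace_neg)
    also have "\<dots> = T d" using T(2)[OF that, of "-1"] q0 by simp
    finally show ?thesis .
  qed
  show thesis
  proof
    fix x assume x: "x \<in> Y"
    have "p x \<le> r x" using x by (rule p(2))
    also have "\<dots> \<le> q (x + 0) - T 0" using x D' by (intro r(2)) auto
    finally show "p x \<le> q x" using T0 by simp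
  next
    fix d assume d: "d \<in> D"
    then have "- d \<in> D" "d \<in> Y" using D by (auto simp: subspace_neg)
    from le[OF this(1)] le[OF d] neg[OF this(2)] T(2)[OF d, of "-1"] show "p d = T d" by simp
  qed (use add scale in auto)
qed

section \<open>Functionals on a sum of type \<open>c\<^sub>0\<close>\<close>

text \<open>Two levels use this pointwise structure: functions on R^n, and sequences of such
  functions, in which the extension takes place.\<close>

instantiation "fun" :: (type, real_vector) real_vector
begin

definition scaleR_fun :: "real \<Rightarrow> ('a \<Rightarrow> 'b) \<Rightarrow> 'a \<Rightarrow> 'b" where
  "scaleR_fun c f = (\<lambda>x. c *\<^sub>R f x)"

instance
  by standard (auto simp: scaleR_fun_def fun_eq_iff scaleR_add_right scaleR_add_left)

end

lemma scaleR_fun_apply [simp]: "(c *\<^sub>R f) x = c *\<^sub>R f x"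
  by (simp add: scaleR_fun_def)

definition pos_part :: "('b \<Rightarrow> real) \<Rightarrow> 'b \<Rightarrow> real" where
  "pos_part g = (\<lambda>x. max 0 (g x))"

lemma SUP_mult_left_real:
  fixes f :: "'a \<Rightarrow> real"
  assumes "bdd_above (range f)" "c \<ge> 0"
  shows "(SUP i. c * f i) = c * (SUP i. f i)"
proof (cases "c = 0")
  case False
  with assms have c: "c > 0" by simp
  show ?thesis
  proof (rule cSup_eq_non_empty)
    fix x assume "x \<in> range (\<lambda>i. c * f i)"
    then show "x \<le> c * (SUP i. f i)"
      using c assms by (auto intro!: mult_left_mono cSUP_upper)
  next
    fix y assume y: "\<And>x. x \<in> range (\<lambda>i. c * f i) \<Longrightarrow> x \<le> y"
    then have "f i \<le> y / c" for i using c by (auto simp: field_simps)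
    then have "(SUP i. f i) \<le> y / c" by (intro cSUP_least) auto
    then show "c * (SUP i. f i) \<le> y" using c by (simp add: field_simps)
  qed auto
qed simp

text \<open>The same \<open>V\<close> is placed in every coordinate: the restriction to the i-th
  cube is hidden in \<open>N i\<close>, so the constant sequence of \<open>g\<close> stands for the
  sequence of its cuts. \<open>L\<close> extends \<open>T\<close> from constant sequences to all
  bounded ones, and \<open>S i\<close> is \<open>L\<close> on sequences supported at
  \<open>i\<close>.\<close>

lemma c0_sum_dual:
  fixes V :: "('b \<Rightarrow> real) set" and N :: "nat \<Rightarrow> ('b \<Rightarrow> real) \<Rightarrow> real" and T :: "('b \<Rightarrow> real) \<Rightarrow> real"
  assumes V: "subspace V" "\<And>g. g \<in> V \<Longrightarrow> pos_part g \<in> V"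
    and N_nonneg: "\<And>i g. g \<in> V \<Longrightarrow> 0 \<le> g \<Longrightarrow> 0 \<le> N i g"
    and N_add: "\<And>i g h. g \<in> V \<Longrightarrow> h \<in> V \<Longrightarrow> 0 \<le> g \<Longrightarrow> 0 \<le> h \<Longrightarrow> N i (g + h) \<le> N i g + N i h"
    and N_scale: "\<And>i g c. g \<in> V \<Longrightarrow> 0 \<le> g \<Longrightarrow> 0 \<le> c \<Longrightarrow> N i (c *\<^sub>R g) = c * N i g"
    and N_mono: "\<And>i g h. g \<in> V \<Longrightarrow> h \<in> V \<Longrightarrow> 0 \<le> g \<Longrightarrow> g \<le> h \<Longrightarrow> N i g \<le> N i h"
    and N_c0: "\<And>g e. g \<in> V \<Longrightarrow> 0 \<le> g \<Longrightarrow> 0 < e \<Longrightarrow> finite {i. e < N i g}"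
    and T_add: "\<And>g h. g \<in> V \<Longrightarrow> h \<in> V \<Longrightarrow> T (g + h) = T g + T h"
    and T_scale: "\<And>g c. g \<in> V \<Longrightarrow> T (c *\<^sub>R g) = c * T g"
    and T_pos: "\<And>g. g \<in> V \<Longrightarrow> 0 \<le> g \<Longrightarrow> 0 \<le> T g"
    and T_le: "\<And>g K. g \<in> V \<Longrightarrow> 0 \<le> g \<Longrightarrow> (\<And>i. N i g \<le> K) \<Longrightarrow> T g \<le> C * K"
    and C: "0 \<le> C"
  obtains S :: "nat \<Rightarrow> ('b \<Rightarrow> real) \<Rightarrow> real" and l :: "nat \<Rightarrow> real"
  where "\<And>i g h. g \<in> V \<Longrightarrow> h \<in> V \<Longrightarrow> S i (g + h) = S i g + S i h"
    "\<And>i g c. g \<in> V \<Longrightarrow> S i (c *\<^sub>R g) = c * S i g"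
    "\<And>i g. g \<in> V \<Longrightarrow> 0 \<le> g \<Longrightarrow> 0 \<le> S i g"
    "\<And>i g. g \<in> V \<Longrightarrow> 0 \<le> g \<Longrightarrow> S i g \<le> l i * N i g"
    "\<And>i. 0 \<le> l i" "summable l" "suminf l \<le> C"
    "\<And>g. g \<in> V \<Longrightarrow> 0 \<le> g \<Longrightarrow> (\<lambda>i. S i g) sums T g"
proof -
  have Vc: "0 \<in> V" "\<And>g h. g \<in> V \<Longrightarrow> h \<in> V \<Longrightarrow> g + h \<in> V" "\<And>g c. g \<in> V \<Longrightarrow> c *\<^sub>R g \<in> V"
    "\<And>g. g \<in> V \<Longrightarrow> - g \<in> V" "\<And>g h. g \<in> V \<Longrightarrow> h \<in> V \<Longrightarrow> g - h \<in> V"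
    using V(1) by (auto simp: subspace_0 subspace_add subspace_scale subspace_neg subspace_diff)
  have N0: "N i 0 = 0" for i using N_scale[of 0 0 i] Vc by simp
  have pp: "0 \<le> pos_part g" for g :: "'b \<Rightarrow> real" by (simp add: pos_part_def le_fun_def)
  have pp_id: "pos_part g = g" if "0 \<le> g" for g :: "'b \<Rightarrow> real"
    using that by (auto simp: pos_part_def le_fun_def fun_eq_iff)
  have pp_neg: "pos_part (- g) = 0" if "0 \<le> g" for g :: "'b \<Rightarrow> real"
    using that by (auto simp: pos_part_def le_fun_def fun_eq_iff)
  \<comment> \<open>Sublinear but not symmetric: it vanishes on nonpositive functions, which will
    make the coordinate functionals positive.\<close>
  define M where "M = (\<lambda>i g. N i (pos_part g))"
  have M_nonneg: "0 \<le> M i g" if "g \<in> V" for i g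
    using that V(2) pp by (simp add: M_def N_nonneg)
  have M_add: "M i (g + h) \<le> M i g + M i h" if "g \<in> V" "h \<in> V" for i g h
  proof -
    have "N i (pos_part (g + h)) \<le> N i (pos_part g + pos_part h)"
      by (intro N_mono V Vc that pp) (auto simp: pos_part_def le_fun_def)
    also have "\<dots> \<le> N i (pos_part g) + N i (pos_part h)"
      using that V Vc pp by (intro N_add) auto
    finally show ?thesis by (simp add: M_def)
  qed
  have M_scale: "M i (c *\<^sub>R g) = c * M i g" if "g \<in> V" "0 \<le> c" for i g c
  proof -
    have "pos_part (c *\<^sub>R g) = c *\<^sub>R pos_part g"
      using that by (auto simp: pos_part_def fun_eq_iff max_mult_distrib_left)
    then show ?thesis using that V pp by (simp add: M_def N_scale)
  qed
  have M0: "M i 0 = 0" for i by (simp add: M_def pp_id N0)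
  have bound: "\<exists>K. \<forall>i. M i g \<le> K" if g: "g \<in> V" for g
  proof -
    have f: "finite {i. 1 < M i g}" using that V pp N_c0[of "pos_part g" 1] by (simp add: M_def)
    define K where "K = Max (insert 1 ((\<lambda>i. M i g) ` {i. 1 < M i g}))"
    have "M i g \<le> K" for i
    proof (cases "1 < M i g")
      case True
      then show ?thesis unfolding K_def using f by (intro Max_ge) auto
    next
      case False
      have "1 \<le> K" unfolding K_def using f by (intro Max_ge) auto
      with False show ?thesis by simp
    qed
    then show ?thesis by blast
  qed
  define Y where "Y = {h. (\<forall>i. h i \<in> V) \<and> (\<exists>K. \<forall>i. M i (h i) \<le> K \<and> M i (- h i) \<le> K)}"
  have YV: "h i \<in> V" if "h \<in> Y" for h i using that by (simp add: Y_def)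
  have bdd: "bdd_above (range (\<lambda>i. M i (h i)))" if "h \<in> Y" for h
    using that by (auto simp: Y_def bdd_above_def)
  have Y: "subspace Y"
    unfolding subspace_def
  proof (intro conjI ballI allI)
    show "0 \<in> Y" using Vc M0 by (auto simp: Y_def)
    fix x assume x: "x \<in> Y"
    then obtain K where K: "\<And>i. M i (x i) \<le> K" "\<And>i. M i (- x i) \<le> K" by (auto simp: Y_def)
    { fix y assume y: "y \<in> Y"
      then obtain K' where K': "\<And>i. M i (y i) \<le> K'" "\<And>i. M i (- y i) \<le> K'" by (auto simp: Y_def)
      have "M i (x i + y i) \<le> K + K'" for i
        using M_add[of "x i" "y i" i] K(1)[of i] K'(1)[of i] YV x y by fastforce
      moreover have "M i (- (x i + y i)) \<le> K + K'" for i
        using M_add[of "- x i" "- y i" i] K(2)[of i] K'(2)[of i] Vc(4) YV x y by fastforce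
      ultimately show "x + y \<in> Y" using x y Vc by (auto simp: Y_def) }
    fix c :: real
    have b: "M i (c *\<^sub>R z) \<le> \<bar>c\<bar> * K" if "z \<in> V" "M i z \<le> K" "M i (- z) \<le> K" for i z
    proof (cases "c \<ge> 0")
      case True
      then show ?thesis using that M_scale[of z c i] by (simp add: mult_left_mono)
    next
      case False
      then have "M i (c *\<^sub>R z) = - c * M i (- z)"
        using M_scale[of "- z" "- c" i] that Vc(4) by simp
      then show ?thesis using False that by (simp add: mult_left_mono)
    qed
    have "M i (c *\<^sub>R x i) \<le> \<bar>c\<bar> * K \<and> M i (- (c *\<^sub>R x i)) \<le> \<bar>c\<bar> * K" for i
      using b[of "x i" i] b[of "- x i" i] K YV[OF x] Vc(4) by auto
    then show "c *\<^sub>R x \<in> Y" using x Vc by (auto simp: Y_def)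
  qed
  define q where "q = (\<lambda>h. C * (SUP i. M i (h i)))"
  have q_le: "q h \<le> C * K" if "\<And>i. M i (h i) \<le> K" for h K
    unfolding q_def using C that by (intro mult_left_mono cSUP_least) auto
  have q: "sublinear_on Y q"
    unfolding sublinear_on_def
  proof (intro conjI ballI allI impI)
    fix x y assume xy: "x \<in> Y" "y \<in> Y"
    have "M i (x i + y i) \<le> (SUP i. M i (x i)) + (SUP i. M i (y i))" for i
      using M_add[OF YV[OF xy(1)] YV[OF xy(2)], of i i i]
        cSUP_upper[OF _ bdd[OF xy(1)], of i] cSUP_upper[OF _ bdd[OF xy(2)], of i] by simp
    then show "q (x + y) \<le> q x + q y"
      using q_le[of "x + y" "(SUP i. M i (x i)) + (SUP i. M i (y i))"] by (simp add: q_def algebra_simps)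
  next
    fix x c assume x: "x \<in> Y" and c: "0 \<le> (c::real)"
    have "(SUP i. M i (c *\<^sub>R x i)) = (SUP i. c * M i (x i))"
      using M_scale[OF YV[OF x] c] by simp
    also have "\<dots> = c * (SUP i. M i (x i))"
      by (rule SUP_mult_left_real[OF bdd[OF x] c])
    finally show "q (c *\<^sub>R x) = c * q x" by (simp add: q_def)
  qed
  define D where "D = (\<lambda>g i::nat. g) ` V"
  have D: "subspace D"
    unfolding subspace_def
  proof (intro conjI ballI allI)
    show "0 \<in> D" using Vc by (auto simp: D_def zero_fun_def intro!: image_eqI[of _ _ 0])
    fix x assume "x \<in> D"
    then obtain g where g: "g \<in> V" "x = (\<lambda>i. g)" by (auto simp: D_def)
    { fix y assume "y \<in> D"
      then obtain h where "h \<in> V" "y = (\<lambda>i. h)" by (auto simp: D_def)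
      with g show "x + y \<in> D" using Vc by (auto simp: D_def plus_fun_def intro!: image_eqI[of _ _ "g + h"]) }
    show "c *\<^sub>R x \<in> D" for c
      using g Vc by (auto simp: D_def scaleR_fun_def intro!: image_eqI[of _ _ "c *\<^sub>R g"])
  qed
  have diagY: "(\<lambda>i. g) \<in> Y" if g: "g \<in> V" for g
  proof -
    obtain K K' where "\<And>i. M i g \<le> K" "\<And>i. M i (- g) \<le> K'"
      using bound[OF g] bound[OF Vc(4)[OF g]] by auto
    then show ?thesis using g
      by (auto simp: Y_def intro!: exI[of _ "max K K'"] simp: le_max_iff_disj)
  qed
  then have DY: "D \<subseteq> Y" by (auto simp: D_def)
  define T' where "T' = (\<lambda>h::nat \<Rightarrow> 'b \<Rightarrow> real. T (h 0))"
  have T'_le: "T' d \<le> q d" if "d \<in> D" for d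
  proof -
    obtain g where g: "g \<in> V" "d = (\<lambda>i. g)" using \<open>d \<in> D\<close> by (auto simp: D_def)
    \<comment> \<open>Positivity of \<open>T\<close> reduces the bound to a nonnegative argument,
      for which \<open>T_le\<close> is available.\<close>
    have "T g \<le> T (pos_part g)"
    proof -
      have "0 \<le> T (pos_part g - g)"
        using g V Vc by (intro T_pos) (auto simp: pos_part_def le_fun_def)
      moreover have "T (pos_part g) = T (pos_part g - g) + T g"
        using T_add[of "pos_part g - g" g] g V Vc by simp
      ultimately show ?thesis by simp
    qed
    also have "\<dots> \<le> C * (SUP i. M i g)"
    proof (rule T_le)
      show "N i (pos_part g) \<le> (SUP i. M i g)" for i
        using cSUP_upper[OF _ bdd[OF diagY[OF g(1)]], of i] by (simp add: M_def)
    qed (use g V pp in auto)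
    finally show ?thesis using g by (simp add: T'_def q_def)
  qed
  have T'_add: "T' (d + e) = T' d + T' e" if "d \<in> D" "e \<in> D" for d e
    using that by (auto simp: D_def T'_def T_add)
  have T'_scale: "T' (c *\<^sub>R d) = c * T' d" if "d \<in> D" for d c
    using that by (auto simp: D_def T'_def T_scale)
  obtain L where L: "\<And>x y. x \<in> Y \<Longrightarrow> y \<in> Y \<Longrightarrow> L (x + y) = L x + L y"
    "\<And>x c. x \<in> Y \<Longrightarrow> L (c *\<^sub>R x) = c * L x" "\<And>x. x \<in> Y \<Longrightarrow> L x \<le> q x" "\<And>d. d \<in> D \<Longrightarrow> L d = T' d"
    using hahn_banach_sublinear[where T = T', OF q Y D DY T'_add T'_scale T'_le] by blast
  have L_diag: "L (\<lambda>i. g) = T g" if "g \<in> V" for g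
    using L(4)[of "\<lambda>i. g"] that by (simp add: D_def T'_def)
  have L_neg: "L (- x) = - L x" if "x \<in> Y" for x
    using L(2)[OF that, of "-1"] by simp
  have L_diff: "L (x - y) = L x - L y" if "x \<in> Y" "y \<in> Y" for x y
    using L(1)[of x "- y"] that L_neg Y by (simp add: subspace_neg)
  define sg where "sg = (\<lambda>(i::nat) g j. if j = i then g else (0 :: 'b \<Rightarrow> real))"
  have sgY: "sg (i::nat) g \<in> Y" if "g \<in> V" for i g
    using that Vc M0 M_nonneg
    by (auto simp: Y_def sg_def intro!: exI[of _ "max (M i g) (M i (- g))"] simp: le_max_iff_disj)
  define S where "S = (\<lambda>i g. L (sg i g))"
  have S_add: "S i (g + h) = S i g + S i h" if "g \<in> V" "h \<in> V" for i g h
  proof -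
    have "sg i (g + h) = sg i g + sg i h" by (auto simp: sg_def fun_eq_iff)
    then show ?thesis using L(1)[OF sgY sgY] that by (simp add: S_def)
  qed
  have S_scale: "S i (c *\<^sub>R g) = c * S i g" if "g \<in> V" for i g c
  proof -
    have "sg i (c *\<^sub>R g) = c *\<^sub>R sg i g" by (auto simp: sg_def fun_eq_iff)
    then show ?thesis using L(2)[OF sgY] that by (simp add: S_def)
  qed
  have S_le: "S i g \<le> C * M i g" if "g \<in> V" for i g
  proof -
    have "S i g \<le> q (sg i g)" using L(3)[OF sgY] that by (simp add: S_def)
    also have "\<dots> \<le> C * M i g"
      using that M0 M_nonneg by (intro q_le) (auto simp: sg_def)
    finally show ?thesis .
  qed
  have S_pos: "0 \<le> S i g" if "g \<in> V" "0 \<le> g" for i g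
  proof -
    have "S i (- g) = - S i g" using S_scale[OF that(1), of i "-1"] by simp
    moreover have "S i (- g) \<le> 0"
      using S_le[OF Vc(4)[OF that(1)], of i] pp_neg[OF that(2)] by (simp add: M_def N0)
    ultimately show ?thesis by simp
  qed
  have S_sum: "(\<Sum>i\<in>F. S i (g i)) = L (\<lambda>j. if j \<in> F then g j else 0)"
    if "finite F" "\<And>i. i \<in> F \<Longrightarrow> g i \<in> V" for F g
  proof -
    have "(\<lambda>j. if j \<in> F then g j else 0) \<in> Y \<and> L (\<lambda>j. if j \<in> F then g j else 0) = (\<Sum>i\<in>F. S i (g i))"
      using that
    proof (induction F rule: finite_induct)
      case empty
      have "(\<lambda>j. if j \<in> {} then g j else 0) = (0 :: nat \<Rightarrow> 'b \<Rightarrow> real)" by (simp add: fun_eq_iff)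
      moreover have "L 0 = 0" using L(2)[of 0 0] subspace_0[OF Y] by simp
      ultimately show ?case using subspace_0[OF Y] by (metis sum.empty)
    next
      case (insert i F)
      have "(\<lambda>j. if j \<in> insert i F then g j else 0) = sg i (g i) + (\<lambda>j. if j \<in> F then g j else 0)"
        using insert.hyps by (auto simp: sg_def fun_eq_iff)
      then show ?case
        using insert L(1)[of "sg i (g i)" "\<lambda>j. if j \<in> F then g j else 0"] sgY[of "g i" i] Y
        by (auto simp: S_def subspace_add)
    qed
    then show ?thesis by simp
  qed
  have inY: "(\<lambda>j. if j \<in> F then g j else 0) \<in> Y" if "\<And>i. i \<in> F \<Longrightarrow> g i \<in> V" "finite F" for F g
  proof -
    have "(\<lambda>j. if j \<in> F then g j else 0) = (\<Sum>i\<in>F. sg i (g i))"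
    proof (rule ext)
      fix j
      have "(\<Sum>i\<in>F. sg i (g i)) j = (\<Sum>i\<in>F. sg i (g i) j)"
        using \<open>finite F\<close> by (induction F rule: finite_induct) auto
      also have "\<dots> = (if j \<in> F then g j else 0)"
        using \<open>finite F\<close> by (simp add: sg_def)
      finally show "(if j \<in> F then g j else 0) = (\<Sum>i\<in>F. sg i (g i)) j" by simp
    qed
    then show ?thesis using that sgY by (auto intro!: subspace_sum[OF Y])
  qed
  define U where "U = (\<lambda>i. {g \<in> V. 0 \<le> g \<and> N i g \<le> 1})"
  \<comment> \<open>The norm of \<open>S i\<close> on the nonnegative unit ball; \<open>S_le\<close>
    bounds it by \<open>C\<close>, so the supremum is a genuine one.\<close>
  define l where "l = (\<lambda>i. SUP g\<in>U i. S i g)"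
  have MN: "M i g = N i g" if "0 \<le> g" for i g using that by (simp add: M_def pp_id)
  have U0: "0 \<in> U i" for i using Vc N0 by (auto simp: U_def)
  have bddU: "bdd_above (S i ` U i)" for i
  proof (rule bdd_aboveI2)
    fix g assume "g \<in> U i"
    then have "S i g \<le> C * N i g" using S_le[of g i] by (simp add: U_def MN)
    also have "\<dots> \<le> C * 1" using C \<open>g \<in> U i\<close> by (intro mult_left_mono) (auto simp: U_def)
    finally show "S i g \<le> C * 1" .
  qed
  have Sl: "S i g \<le> l i" if "g \<in> U i" for i g
    unfolding l_def using bddU that by (rule cSUP_upper2) auto
  have l0: "0 \<le> l i" for i
    using Sl[OF U0, of i] S_pos[of 0 i] Vc by simp
  have lN: "S i g \<le> l i * N i g" if g: "g \<in> V" "0 \<le> g" for i g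
  proof (cases "N i g = 0")
    case True
    then show ?thesis using S_le[OF g(1), of i] by (simp add: MN[OF g(2)])
  next
    case False
    then have n: "N i g > 0" using N_nonneg[OF g, of i] by simp
    have "(1 / N i g) *\<^sub>R g \<in> U i"
      using g n Vc by (auto simp: U_def N_scale le_fun_def)
    from Sl[OF this] show ?thesis
      using n by (simp add: S_scale[OF g(1)] field_simps)
  qed
  \<comment> \<open>Near-extremal elements of the unit balls, placed side by side, form a single
    sequence of norm at most 1, so one application of \<open>L \<le> q\<close> bounds the sum of all
    the norms. The \<open>1 +\<close> in the definition of \<open>d\<close> covers the empty
    \<open>F\<close>.\<close>
  have sum_l: "sum l F \<le> C" if F: "finite F" for F
  proof (rule field_le_epsilon)
    fix e :: real assume e: "e > 0"
    define d where "d = e / (1 + card F)"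
    have "d > 0" using e by (simp add: d_def add_pos_nonneg)
    have "\<exists>g\<in>U i. l i - d < S i g" for i
    proof -
      have "l i - d < (SUP g\<in>U i. S i g)" using \<open>d > 0\<close> by (simp add: l_def)
      then show ?thesis using less_cSUP_iff[OF _ bddU, of i "l i - d"] U0 by blast
    qed
    then obtain g where g: "\<And>i. g i \<in> U i" "\<And>i. l i - d < S i (g i)" by metis
    have gV: "\<And>i. g i \<in> V" using g by (auto simp: U_def)
    have "sum l F \<le> (\<Sum>i\<in>F. S i (g i) + d)"
      by (intro sum_mono) (metis g(2) add.commute diff_less_eq less_eq_real_def)
    also have "\<dots> = (\<Sum>i\<in>F. S i (g i)) + card F * d" by (simp add: sum.distrib)
    also have "(\<Sum>i\<in>F. S i (g i)) \<le> q (\<lambda>j. if j \<in> F then g j else 0)"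
      using S_sum[OF F, of g] gV L(3) inY[OF _ F, of g] by simp
    also have "q (\<lambda>j. if j \<in> F then g j else 0) \<le> C * 1"
    proof (rule q_le)
      fix i show "M i (if i \<in> F then g i else 0) \<le> 1"
        using g(1)[of i] M0 by (auto simp: U_def MN)
    qed
    also have "card F * d \<le> e"
    proof -
      have "card F * d \<le> (1 + card F) * d" using \<open>d > 0\<close> by (simp add: distrib_right)
      also have "\<dots> = e" by (simp add: d_def add_pos_nonneg)
      finally show ?thesis .
    qed
    finally show "sum l F \<le> C + e" by simp
  qed
  have "summable l"
    using l0 sum_l by (intro summableI_nonneg_bounded[of l C]) auto
  moreover have "suminf l \<le> C"
    using sum_l \<open>summable l\<close> by (intro suminf_le_const) auto
  moreover have "(\<lambda>i. S i g) sums T g" if g: "g \<in> V" "0 \<le> g" for g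
    unfolding sums_def
  proof (rule LIMSEQ_I)
    fix r :: real assume r: "r > 0"
    \<comment> \<open>The \<open>+ 1\<close> covers \<open>C = 0\<close>. Beyond \<open>n0\<close>
      the norms of \<open>g\<close> are at most \<open>e\<close>, so \<open>L\<close> is small on
      the tail of the constant sequence; on the negative of the tail \<open>M\<close> vanishes,
      which gives the lower bound.\<close>
    define e where "e = r / (2 * (C + 1))"
    have e: "e > 0" using r C by (simp add: e_def)
    have "C * e \<le> (C + 1) * e" using e by (simp add: distrib_right)
    also have "\<dots> = r / 2" using C by (simp add: e_def divide_simps)
    finally have Ce: "C * e < r" using r by simp
    obtain n0 where n0: "{i. e < N i g} \<subseteq> {..<n0}"
      using N_c0[OF g e] finite_nat_iff_bounded by blast
    show "\<exists>no. \<forall>n\<ge>no. norm ((\<Sum>i<n. S i g) - T g) < r"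
    proof (intro exI allI impI)
      fix n assume n: "n0 \<le> n"
      let ?a = "\<lambda>j. if j \<in> {..<n} then g else 0"
      have aY: "?a \<in> Y" using inY[of "{..<n}" "\<lambda>_. g"] g by simp
      have bY: "(\<lambda>i. g) - ?a \<in> Y" using aY diagY[OF g(1)] Y by (simp add: subspace_diff)
      have eq: "L ((\<lambda>i. g) - ?a) = T g - (\<Sum>i<n. S i g)"
        using L_diff[OF diagY[OF g(1)] aY] L_diag[OF g(1)] S_sum[of "{..<n}" "\<lambda>_. g"] g by simp
      have "L ((\<lambda>i. g) - ?a) \<le> q ((\<lambda>i. g) - ?a)" by (rule L(3)[OF bY])
      also have "\<dots> \<le> C * e"
      proof (rule q_le)
        fix i
        show "M i (((\<lambda>i. g) - ?a) i) \<le> e"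
          using n0 n e M0 MN[OF g(2)] by (auto simp: subset_eq not_less)
      qed
      finally have 1: "L ((\<lambda>i. g) - ?a) \<le> C * e" .
      have "L (- ((\<lambda>i. g) - ?a)) \<le> q (- ((\<lambda>i. g) - ?a))"
        by (intro L(3) subspace_neg Y bY)
      also have "\<dots> \<le> C * 0"
      proof (rule q_le)
        fix i
        have "(- ((\<lambda>i. g) - ?a)) i = (if i < n then 0 else - g)" by (auto simp: fun_eq_iff)
        then show "M i ((- ((\<lambda>i. g) - ?a)) i) \<le> 0"
          using pp_neg[OF g(2)] M0 by (simp add: M_def N0)
      qed
      finally have "0 \<le> L ((\<lambda>i. g) - ?a)" using L_neg[OF bY] by simp
      with 1 eq Ce show "norm ((\<Sum>i<n. S i g) - T g) < r" by simp
    qed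
  qed
  ultimately show thesis
    using S_add S_scale S_pos lN l0 by (intro that[of S l]) auto
qed

section \<open>Mixed norms\<close>

lemma epow_0 [simp]: "epow 0 p = 0"
  by (simp add: epow_def)

lemma epow_top [simp]: "epow top p = top"
  by (simp add: epow_def)

lemma epow_ennreal: "0 \<le> r \<Longrightarrow> epow (ennreal r) p = ennreal (r powr p)"
  by (simp add: epow_def)

lemma epow_1 [simp]: "epow x 1 = x"
  by (cases x) (auto simp: epow_ennreal)

lemma epow_one_base [simp]: "epow 1 p = 1"
  using epow_ennreal[of 1 p] by simp

lemma epow_mono: "x \<le> y \<Longrightarrow> 0 \<le> p \<Longrightarrow> epow x p \<le> epow y p"
  by (cases x; cases y) (auto simp: epow_ennreal powr_mono2 top_unique)

lemma epow_eq_0_iff [simp]: "epow x p = 0 \<longleftrightarrow> x = 0"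
  by (cases x) (auto simp: epow_ennreal)

text \<open>Holds for every real \<open>p\<close>, since \<open>epow 0 p = 0\<close> and
  \<open>epow top p = top\<close> agree with the convention \<open>0 * top = 0\<close>.\<close>

lemma epow_mult: "epow (x * y) p = epow x p * epow y p"
proof -
  have top: "epow (top * y) p = top * epow y p" for y
    by (cases "y = 0") (auto simp: ennreal_top_mult)
  show ?thesis
  proof (cases "x = top \<or> y = top")
    case True
    then show ?thesis using top[of x] top[of y] by (auto simp: mult.commute)
  next
    case False
    then obtain r s where "0 \<le> r" "x = ennreal r" "0 \<le> s" "y = ennreal s"
      by (metis ennreal_cases)
    then show ?thesis by (simp add: epow_ennreal powr_mult flip: ennreal_mult)
  qed
qed

lemma epow_epow: "epow (epow x p) q = epow x (p * q)"
  by (cases x) (auto simp: epow_ennreal powr_powr)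

lemma epow_inverse_exponent [simp]:
  "p \<noteq> 0 \<Longrightarrow> epow (epow x p) (1 / p) = x" "p \<noteq> 0 \<Longrightarrow> epow (epow x (1 / p)) p = x"
  by (auto simp: epow_epow)

lemma epow_eq_top_iff [simp]: "epow x p = top \<longleftrightarrow> x = top"
  by (cases x) (auto simp: epow_ennreal)

lemma epow_le_iff: "0 < p \<Longrightarrow> epow x p \<le> y \<longleftrightarrow> x \<le> epow y (1 / p)"
  using epow_mono[of "epow x p" y "1 / p"] epow_mono[of x "epow y (1 / p)" p] by auto

lemma epow_SUP:
  assumes "0 < p"
  shows "epow (SUP i\<in>I. F i) p = (SUP i\<in>I. epow (F i) p)"
proof (rule antisym)
  show "epow (SUP i\<in>I. F i) p \<le> (SUP i\<in>I. epow (F i) p)"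
    unfolding epow_le_iff[OF assms]
    by (intro SUP_least iffD1[OF epow_le_iff[OF assms]] SUP_upper)
  show "(SUP i\<in>I. epow (F i) p) \<le> epow (SUP i\<in>I. F i) p"
    using assms by (intro SUP_least epow_mono SUP_upper) auto
qed

lemma measurable_epow [measurable]:
  assumes [measurable]: "F \<in> borel_measurable M"
  shows "(\<lambda>x. epow (F x) p) \<in> borel_measurable M"
  unfolding epow_def by measurable

lemma epow_Young:
  assumes "1 < p" "1 < q" "1 / p + 1 / q = 1"
  shows "x * y \<le> ennreal (1 / p) * epow x p + ennreal (1 / q) * epow y q"
proof -
  have t: "ennreal (1 / p) * top = top" "ennreal (1 / q) * top = top"
    using assms by (auto simp: ennreal_mult_top)
  show ?thesis
  proof (cases "x = top \<or> y = top")
    case True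
    then show ?thesis using t by auto
  next
    case False
    then obtain r s where rs: "0 \<le> r" "x = ennreal r" "0 \<le> s" "y = ennreal s"
      by (metis ennreal_cases)
    have "r * s \<le> 1 / p * r powr p + 1 / q * s powr q"
      using Youngs_inequality[OF assms rs(1,3)] by simp
    then show ?thesis
      using rs assms by (simp add: epow_ennreal flip: ennreal_mult ennreal_plus)
  qed
qed

text \<open>Young's inequality for \<open>F\<close> and \<open>G\<close> divided by their norms. A
  zero norm makes the product vanish almost everywhere; if neither is zero, an infinite one makes
  the right-hand side infinite.\<close>

lemma nn_integral_Holder:
  assumes pq: "1 < p" "1 < q" "1 / p + 1 / q = 1"
    and [measurable]: "F \<in> borel_measurable M" "G \<in> borel_measurable M"
  shows "(\<integral>\<^sup>+x. F x * G x \<partial>M) \<le> epow (\<integral>\<^sup>+x. epow (F x) p \<partial>M) (1 / p) * epow (\<integral>\<^sup>+x. epow (G x) q \<partial>M) (1 / q)"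
proof -
  define a where "a = epow (\<integral>\<^sup>+x. epow (F x) p \<partial>M) (1 / p)"
  define b where "b = epow (\<integral>\<^sup>+x. epow (G x) q \<partial>M) (1 / q)"
  have ap: "epow a p = (\<integral>\<^sup>+x. epow (F x) p \<partial>M)" and bq: "epow b q = (\<integral>\<^sup>+x. epow (G x) q \<partial>M)"
    using pq by (auto simp: a_def b_def)
  consider "a = 0" | "b = 0" | "a \<noteq> 0" "b \<noteq> 0" "a = top \<or> b = top"
    | r s where "0 < r" "a = ennreal r" "0 < s" "b = ennreal s"
    by (cases a; cases b) (auto simp: order_less_le)
  then show ?thesis
  proof cases
    case 1
    then have "(\<integral>\<^sup>+x. epow (F x) p \<partial>M) = 0" using ap by simp
    then have "AE x in M. F x = 0" by (subst (asm) nn_integral_0_iff_AE) auto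
    then have "(\<integral>\<^sup>+x. F x * G x \<partial>M) = 0" by (subst nn_integral_0_iff_AE) auto
    then show ?thesis by simp
  next
    case 2
    then have "(\<integral>\<^sup>+x. epow (G x) q \<partial>M) = 0" using bq by simp
    then have "AE x in M. G x = 0" by (subst (asm) nn_integral_0_iff_AE) auto
    then have "(\<integral>\<^sup>+x. F x * G x \<partial>M) = 0" by (subst nn_integral_0_iff_AE) auto
    then show ?thesis by simp
  next
    case 3
    then show ?thesis by (auto simp: a_def[symmetric] b_def[symmetric] ennreal_top_mult ennreal_mult_top)
  next
    case 4
    let ?r = "ennreal (1 / r)" and ?s = "ennreal (1 / s)"
    have r: "ennreal r * ?r = 1" "ennreal s * ?s = 1"
      using 4 by (auto simp flip: ennreal_mult)
    have "(\<integral>\<^sup>+x. F x * G x \<partial>M) = (\<integral>\<^sup>+x. (ennreal r * ennreal s) * ((F x * ?r) * (G x * ?s)) \<partial>M)"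
    proof (rule nn_integral_cong)
      fix x
      have "(ennreal r * ennreal s) * ((F x * ?r) * (G x * ?s)) = (ennreal r * ?r) * (ennreal s * ?s) * (F x * G x)"
        by (simp only: mult_ac)
      then show "F x * G x = (ennreal r * ennreal s) * ((F x * ?r) * (G x * ?s))" by (simp add: r)
    qed
    also have "\<dots> = (ennreal r * ennreal s) * (\<integral>\<^sup>+x. (F x * ?r) * (G x * ?s) \<partial>M)"
      by (rule nn_integral_cmult) measurable
    also have "(\<integral>\<^sup>+x. (F x * ?r) * (G x * ?s) \<partial>M)
        \<le> (\<integral>\<^sup>+x. ennreal (1 / p) * epow (F x * ?r) p + ennreal (1 / q) * epow (G x * ?s) q \<partial>M)"
      by (intro nn_integral_mono epow_Young pq)
    also have "\<dots> = ennreal (1 / p) * ((\<integral>\<^sup>+x. epow (F x) p \<partial>M) * epow ?r p)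
        + ennreal (1 / q) * ((\<integral>\<^sup>+x. epow (G x) q \<partial>M) * epow ?s q)"
      by (simp add: nn_integral_add nn_integral_cmult nn_integral_multc epow_mult)
    also have "\<dots> = ennreal (1 / p) * epow (ennreal r * ?r) p + ennreal (1 / q) * epow (ennreal s * ?s) q"
      by (simp add: ap[symmetric] bq[symmetric] 4 epow_mult)
    also have "\<dots> = 1" using pq by (simp add: r flip: ennreal_plus)
    finally show ?thesis
      using 4 by (simp add: a_def[symmetric] b_def[symmetric] mult_left_mono)
  qed
qed

section \<open>Iterated norms of functions with values in \<open>ennreal\<close>\<close>

fun mixE :: "(nat \<Rightarrow> real) \<Rightarrow> nat \<Rightarrow> ((nat \<Rightarrow> real) \<Rightarrow> ennreal) \<Rightarrow> (nat \<Rightarrow> real) \<Rightarrow> ennreal" where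
  "mixE P 0 F x = F x"
| "mixE P (Suc k) F x = epow (\<integral>\<^sup>+t. epow (mixE P k F (x(k := t))) (P k) \<partial>lborel) (1 / P k)"

text \<open>\<open>mixE\<close> keeps values in \<open>ennreal\<close> and integrates over
  \<open>lborel\<close>, so that partial norms can be iterated and have Borel sections. The
  integrals over \<open>lebesgue\<close> and \<open>lborel\<close> agree for every integrand,
  measurable or not.\<close>

lemma mixn_eq_mixE: "mixn P k f x = mixE P k (\<lambda>x. ennreal \<bar>f x\<bar>) x"
  by (induction k arbitrary: x) (simp_all add: nn_integral_completion)

abbreviation Lb :: "nat set \<Rightarrow> (nat \<Rightarrow> real) measure" where
  "Lb J \<equiv> PiM J (\<lambda>_. lborel)"

interpretation Lb: product_sigma_finite "\<lambda>_::nat. lborel :: real measure"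
  by standard

lemma space_Lb: "space (Lb J) = extensional J"
  by (auto simp: space_PiM PiE_def)

text \<open>After \<open>k\<close> steps only the coordinates in \<open>{k..<n}\<close> are live,
  and undoing a step fills in coordinate \<open>k\<close>. The inductions on \<open>k\<close> below
  run over such points; for \<open>k = n\<close> the only one is the constant
  \<open>undefined\<close>.\<close>

lemma fun_upd_Lb: "x \<in> extensional {Suc k..<n} \<Longrightarrow> k < n \<Longrightarrow> x(k := t) \<in> extensional {k..<n}"
  by (auto simp: extensional_def)

lemma measurable_slice:
  assumes "x \<in> extensional {Suc k..<n}" "k < n"
  shows "(\<lambda>t. x(k := t)) \<in> lborel \<rightarrow>\<^sub>M Lb {k..<n}"
  by (rule measurable_fun_upd[where J = "{Suc k..<n}"]) (use assms in \<open>auto simp: space_Lb\<close>)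

text \<open>The index set \<open>J\<close> is flexible because partial norms occur both on the
  remaining coordinates, for Tonelli, and on all of \<open>{..<n}\<close>, as ingredients of the
  extremal function.\<close>

lemma measurable_mixE:
  assumes F: "F \<in> borel_measurable (Lb {..<n})"
    and "{k..<n} \<subseteq> J" "J \<subseteq> {..<n}" "k \<le> n"
  shows "mixE P k F \<in> borel_measurable (Lb J)"
  using assms(2-)
proof (induction k arbitrary: J)
  case 0
  then have "J = {..<n}" by auto
  moreover have "mixE P 0 F = F" by (simp add: fun_eq_iff)
  ultimately show ?case using F by simp
next
  case (Suc k)
  have [measurable]: "mixE P k F \<in> borel_measurable (Lb (insert k J))"
    using Suc.prems by (intro Suc.IH) (auto simp: subset_eq not_less_eq_eq le_less_Suc_eq Suc_le_eq)
  have [measurable]: "(\<lambda>(x, t). x(k := t)) \<in> Lb J \<Otimes>\<^sub>M lborel \<rightarrow>\<^sub>M Lb (insert k J)"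
    unfolding split_beta' by (rule measurable_fun_upd[where J = J]) auto
  show ?case by simp
qed

lemma measurable_mixE_slice:
  assumes "F \<in> borel_measurable (Lb {..<n})" "x \<in> extensional {Suc k..<n}" "k < n"
  shows "(\<lambda>t. mixE P k F (x(k := t))) \<in> borel_measurable lborel"
  by (rule measurable_compose[OF measurable_slice measurable_mixE]) (use assms in auto)

text \<open>Tonelli, one coordinate at a time. With all exponents 1, \<open>mixE\<close> is the
  iterated integral, so null sets and pairings can be treated by the same inductions as
  norms.\<close>

lemma nn_integral_Lb_mixE_step:
  assumes F: "F \<in> borel_measurable (Lb {..<n})" and "k \<le> n"
  shows "(\<integral>\<^sup>+x. F x \<partial>Lb {..<n}) = (\<integral>\<^sup>+x. mixE (\<lambda>_. 1) k F x \<partial>Lb {k..<n})"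
  using assms(2)
proof (induction k)
  case 0
  then show ?case by (simp add: lessThan_atLeast0)
next
  case (Suc k)
  have i: "{k..<n} = insert k {Suc k..<n}" using Suc.prems by auto
  have "(\<integral>\<^sup>+x. F x \<partial>Lb {..<n}) = (\<integral>\<^sup>+x. mixE (\<lambda>_. 1) k F x \<partial>Lb {k..<n})"
    using Suc by simp
  also have "\<dots> = (\<integral>\<^sup>+x. (\<integral>\<^sup>+t. mixE (\<lambda>_. 1) k F (x(k := t)) \<partial>lborel) \<partial>Lb {Suc k..<n})"
    unfolding i
    by (rule Lb.product_nn_integral_insert) (use Suc.prems in \<open>auto simp flip: i intro!: measurable_mixE F\<close>)
  finally show ?case by simp
qed

lemma nn_integral_Lb_mixE:
  assumes "F \<in> borel_measurable (Lb {..<n})"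
  shows "(\<integral>\<^sup>+x. F x \<partial>Lb {..<n}) = mixE (\<lambda>_. 1) n F (\<lambda>_. undefined)"
  using nn_integral_Lb_mixE_step[OF assms, of n] Lb.nn_integral_empty by simp

lemma mixE_mono:
  assumes "\<And>x. x \<in> extensional {..<n} \<Longrightarrow> F x \<le> G x" "\<And>i. i < n \<Longrightarrow> 0 < P i"
    and "k \<le> n" "x \<in> extensional {k..<n}"
  shows "mixE P k F x \<le> mixE P k G x"
  using assms(3,4)
proof (induction k arbitrary: x)
  case 0
  then show ?case using assms(1) by (simp add: lessThan_atLeast0)
next
  case (Suc k)
  have "0 < P k" using assms(2)[of k] Suc.prems by simp
  then show ?case
    unfolding mixE.simps using Suc.prems
    by (intro epow_mono nn_integral_mono Suc.IH fun_upd_Lb) auto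
qed

text \<open>If the iterated integral of a nonnegative function is 0, then so are the inner ones for
  almost every value of the outer coordinate. Carrying this condition along with the point lets the
  induction close.\<close>

lemma mixE_cong_null:
  assumes N: "N \<in> sets (Lb {..<n})" and FG: "\<And>x. x \<in> extensional {..<n} \<Longrightarrow> x \<notin> N \<Longrightarrow> F x = G x"
    and "k \<le> n" "x \<in> extensional {k..<n}" "mixE (\<lambda>_. 1) k (indicator N) x = 0"
  shows "mixE P k F x = mixE P k G x"
  using assms(3-)
proof (induction k arbitrary: x)
  case 0
  then show ?case using FG by (auto simp: lessThan_atLeast0 indicator_def split: if_splits)
next
  case (Suc k)
  have "(\<lambda>t. mixE (\<lambda>_. 1) k (indicator N) (x(k := t))) \<in> borel_measurable lborel"
    using N Suc.prems by (intro measurable_mixE_slice) auto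
  moreover have "(\<integral>\<^sup>+t. mixE (\<lambda>_. 1) k (indicator N) (x(k := t)) \<partial>lborel) = 0"
    using Suc.prems by simp
  ultimately have "AE t in lborel. mixE (\<lambda>_. 1) k (indicator N) (x(k := t)) = 0"
    by (subst (asm) nn_integral_0_iff_AE) auto
  then have "AE t in lborel. epow (mixE P k F (x(k := t))) (P k) = epow (mixE P k G (x(k := t))) (P k)"
  proof eventually_elim
    case (elim t)
    have "mixE P k F (x(k := t)) = mixE P k G (x(k := t))"
      by (rule Suc.IH[OF _ fun_upd_Lb elim]) (use Suc.prems in auto)
    then show ?case by simp
  qed
  then show ?case by (simp cong: nn_integral_cong_AE)
qed

lemma mixE_cong_AE:
  assumes "AE x in Lb {..<n}. F x = G x"
  shows "mixE P n F (\<lambda>_. undefined) = mixE P n G (\<lambda>_. undefined)"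
proof -
  from assms obtain N where N: "{x \<in> space (Lb {..<n}). F x \<noteq> G x} \<subseteq> N" "N \<in> null_sets (Lb {..<n})"
    by (auto simp: eventually_ae_filter)
  have "mixE (\<lambda>_. 1) n (indicator N) (\<lambda>_. undefined) = (\<integral>\<^sup>+x. indicator N x \<partial>Lb {..<n})"
    using N by (intro nn_integral_Lb_mixE[symmetric]) auto
  also have "\<dots> = 0" using N by (simp add: null_setsD1 null_setsD2)
  finally have z: "mixE (\<lambda>_. 1) n (indicator N) (\<lambda>_. undefined) = 0" .
  show ?thesis
  proof (rule mixE_cong_null[OF _ _ _ _ z])
    show "N \<in> sets (Lb {..<n})" using N by auto
  qed (use N in \<open>auto simp: space_Lb\<close>)
qed

lemma mixE_Holder_step:
  assumes [measurable]: "F \<in> borel_measurable (Lb {..<n})" "G \<in> borel_measurable (Lb {..<n})"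
    and PQ: "\<And>i. i < n \<Longrightarrow> 1 < P i" "\<And>i. i < n \<Longrightarrow> 1 < Q i" "\<And>i. i < n \<Longrightarrow> 1 / P i + 1 / Q i = 1"
    and "k \<le> n" "x \<in> extensional {k..<n}"
  shows "mixE (\<lambda>_. 1) k (\<lambda>x. F x * G x) x \<le> mixE P k F x * mixE Q k G x"
  using assms(6,7)
proof (induction k arbitrary: x)
  case (Suc k)
  have "mixE (\<lambda>_. 1) (Suc k) (\<lambda>x. F x * G x) x \<le> (\<integral>\<^sup>+t. mixE P k F (x(k := t)) * mixE Q k G (x(k := t)) \<partial>lborel)"
    using Suc.prems by (auto intro!: nn_integral_mono Suc.IH fun_upd_Lb)
  also have "\<dots> \<le> mixE P (Suc k) F x * mixE Q (Suc k) G x"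
    unfolding mixE.simps using Suc.prems PQ[of k]
    by (intro nn_integral_Holder measurable_mixE_slice[where n = n]) auto
  finally show ?case .
qed simp

lemma mixE_Holder:
  assumes "F \<in> borel_measurable (Lb {..<n})" "G \<in> borel_measurable (Lb {..<n})"
    and "\<And>i. i < n \<Longrightarrow> 1 < P i" "\<And>i. i < n \<Longrightarrow> 1 < Q i" "\<And>i. i < n \<Longrightarrow> 1 / P i + 1 / Q i = 1"
  shows "(\<integral>\<^sup>+x. F x * G x \<partial>Lb {..<n}) \<le> mixE P n F (\<lambda>_. undefined) * mixE Q n G (\<lambda>_. undefined)"
  using mixE_Holder_step[where F = F and G = G and P = P and Q = Q and n = n and k = n and x = "\<lambda>_. undefined"] assms nn_integral_Lb_mixE[of "\<lambda>x. F x * G x" n]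
  by simp

text \<open>The factor may depend on coordinates not yet integrated. The extremal function requires
  this, each of its factors being a function of the coordinates from some \<open>k\<close>
  on.\<close>

lemma mixE_cmult:
  assumes F: "F \<in> borel_measurable (Lb {..<n})"
    and c: "\<And>i y t. i < k \<Longrightarrow> c (y(i := t)) = c y"
    and P: "\<And>i. i < n \<Longrightarrow> 0 < P i"
    and "k \<le> n" "x \<in> extensional {k..<n}"
  shows "mixE P k (\<lambda>y. c y * F y) x = c x * mixE P k F x"
  using assms(2,4,5)
proof (induction k arbitrary: x)
  case (Suc k)
  have Pk: "P k \<noteq> 0" using P[of k] Suc.prems by simp
  have "mixE P k (\<lambda>y. c y * F y) (x(k := t)) = c x * mixE P k F (x(k := t))" for t
  proof -
    have "mixE P k (\<lambda>y. c y * F y) (x(k := t)) = c (x(k := t)) * mixE P k F (x(k := t))"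
    proof (rule Suc.IH[OF _ _ fun_upd_Lb[OF Suc.prems(3)]])
      show "c (y(i := s)) = c y" if "i < k" for i y s
        by (rule Suc.prems(1)) (use that in simp)
    qed (use Suc.prems(2) in auto)
    also have "c (x(k := t)) = c x" by (rule Suc.prems(1)) simp
    finally show ?thesis .
  qed
  then have "mixE P (Suc k) (\<lambda>y. c y * F y) x
      = epow (\<integral>\<^sup>+t. epow (c x) (P k) * epow (mixE P k F (x(k := t))) (P k) \<partial>lborel) (1 / P k)"
    by (simp add: epow_mult)
  also have "\<dots> = epow (epow (c x) (P k) * (\<integral>\<^sup>+t. epow (mixE P k F (x(k := t))) (P k) \<partial>lborel)) (1 / P k)"
    using measurable_mixE_slice[OF F Suc.prems(3)] Suc.prems(2)
    by (subst nn_integral_cmult) auto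
  also have "\<dots> = c x * mixE P (Suc k) F x"
    using Pk by (simp add: epow_mult)
  finally show ?case .
qed simp

lemma mixE_SUP:
  assumes F: "\<And>i. F i \<in> borel_measurable (Lb {..<n})" and inc: "incseq F"
    and P: "\<And>i. i < n \<Longrightarrow> 0 < P i"
    and "k \<le> n" "x \<in> extensional {k..<n}"
  shows "mixE P k (\<lambda>y. SUP i. F i y) x = (SUP i. mixE P k (F i) x)"
  using assms(4-)
proof (induction k arbitrary: x)
  case (Suc k)
  have Pk: "0 < P k" using P[of k] Suc.prems by simp
  have "mixE P (Suc k) (\<lambda>y. SUP i. F i y) x
      = epow (\<integral>\<^sup>+t. (SUP i. epow (mixE P k (F i) (x(k := t))) (P k)) \<partial>lborel) (1 / P k)"
    using Suc Pk by (simp add: epow_SUP fun_upd_Lb)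
  also have "(\<integral>\<^sup>+t. (SUP i. epow (mixE P k (F i) (x(k := t))) (P k)) \<partial>lborel)
      = (SUP i. \<integral>\<^sup>+t. epow (mixE P k (F i) (x(k := t))) (P k) \<partial>lborel)"
  proof (rule nn_integral_monotone_convergence_SUP)
    show "(\<lambda>t. epow (mixE P k (F i) (x(k := t))) (P k)) \<in> borel_measurable lborel" for i
      by (intro measurable_epow measurable_mixE_slice[OF F]) (use Suc.prems in auto)
    show "incseq (\<lambda>i t. epow (mixE P k (F i) (x(k := t))) (P k))"
    proof (intro incseq_SucI le_funI epow_mono)
      fix i t
      show "mixE P k (F i) (x(k := t)) \<le> mixE P k (F (Suc i)) (x(k := t))"
        using inc Suc.prems by (intro mixE_mono[where n = n]) (auto intro: P fun_upd_Lb simp: incseq_Suc_iff le_fun_def)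
    qed (use Pk in simp)
  qed
  finally show ?case using Pk by (simp add: epow_SUP)
qed simp

text \<open>Each integrated coordinate ranges over an interval of length \<open>l\<close> and
  contributes \<open>l powr (1 / P j)\<close>. The indicator of the remaining conditions is carried
  along since it confines the next integration.\<close>

lemma mixE_indicator_cube_le_step:
  assumes P: "\<And>i. i < n \<Longrightarrow> 0 < P i" and l: "0 \<le> l"
    and "k \<le> n" "x \<in> extensional {k..<n}"
  shows "mixE P k (indicator (cube n a l)) x
    \<le> ennreal (\<Prod>j<k. l powr (1 / P j)) * indicator {x. \<forall>j\<in>{k..<n}. a j \<le> x j \<and> x j \<le> a j + l} x"
  using assms(3,4)
proof (induction k arbitrary: x)
  case 0
  then show ?case by (auto simp: cube_def indicator_def)
next
  case (Suc k)
  define c where "c = (\<Prod>j<k. l powr (1 / P j))"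
  define B where "B = {x. \<forall>j\<in>{Suc k..<n}. a j \<le> x j \<and> x j \<le> a j + l}"
  have c0: "0 \<le> c" unfolding c_def by (intro prod_nonneg) auto
  have Pk: "0 < P k" using P[of k] Suc.prems by simp
  have "epow (mixE P k (indicator (cube n a l)) (x(k := t))) (P k)
      \<le> epow (ennreal c * indicator B x) (P k) * indicator {a k..a k + l} t" for t
  proof -
    have "mixE P k (indicator (cube n a l)) (x(k := t))
      \<le> ennreal c * indicator {x. \<forall>j\<in>{k..<n}. a j \<le> x j \<and> x j \<le> a j + l} (x(k := t))"
      unfolding c_def using Suc.prems by (intro Suc.IH fun_upd_Lb) auto
    also have "\<dots> \<le> (ennreal c * indicator B x) * indicator {a k..a k + l} t"
    proof (cases "\<forall>j\<in>{k..<n}. a j \<le> (x(k := t)) j \<and> (x(k := t)) j \<le> a j + l")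
      case True
      have "t \<in> {a k..a k + l}" using bspec[OF True, of k] Suc.prems by simp
      moreover have "a j \<le> x j \<and> x j \<le> a j + l" if "j \<in> {Suc k..<n}" for j
        using bspec[OF True, of j] that by simp
      ultimately show ?thesis by (simp add: indicator_def B_def)
    qed simp
    finally have "epow (mixE P k (indicator (cube n a l)) (x(k := t))) (P k)
      \<le> epow ((ennreal c * indicator B x) * indicator {a k..a k + l} t) (P k)"
      using Pk by (intro epow_mono) auto
    also have "\<dots> = epow (ennreal c * indicator B x) (P k) * indicator {a k..a k + l} t"
      by (auto simp: indicator_def)
    finally show ?thesis .
  qed
  then have "(\<integral>\<^sup>+t. epow (mixE P k (indicator (cube n a l)) (x(k := t))) (P k) \<partial>lborel)
      \<le> (\<integral>\<^sup>+t. epow (ennreal c * indicator B x) (P k) * indicator {a k..a k + l} t \<partial>lborel)"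
    by (intro nn_integral_mono)
  also have "\<dots> = epow (ennreal c * indicator B x) (P k) * ennreal l"
    using l by (simp add: nn_integral_cmult)
  finally have "mixE P (Suc k) (indicator (cube n a l)) x
      \<le> epow (epow (ennreal c * indicator B x) (P k) * ennreal l) (1 / P k)"
    unfolding mixE.simps using Pk by (intro epow_mono) auto
  also have "\<dots> = ennreal (c * l powr (1 / P k)) * indicator B x"
    using Pk l c0 by (simp add: epow_mult epow_ennreal ennreal_mult powr_powr mult_ac)
  finally show ?case by (simp add: c_def B_def)
qed

lemma mixE_indicator_cube_le:
  assumes "\<And>i. i < n \<Longrightarrow> 0 < P i" and "0 < l"
  shows "mixE P n (indicator (cube n a l)) (\<lambda>_. undefined) \<le> ennreal (l powr (\<Sum>j<n. 1 / P j))"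
  using mixE_indicator_cube_le_step[where n = n and k = n and P = P and l = l and a = a and x = "\<lambda>_. undefined"] assms
  by (simp add: powr_sum)

section \<open>The extremal function in Hoelder's inequality, and duality\<close>

lemma mixE_fun_upd: "i < k \<Longrightarrow> mixE P k F (x(i := t)) = mixE P k F x"
proof (induction k arbitrary: x)
  case (Suc k)
  have "mixE P k F ((x(i := t))(k := s)) = mixE P k F (x(k := s))" for s
  proof (cases "i = k")
    case True
    show ?thesis unfolding True fun_upd_upd ..
  next
    case False
    have "mixE P k F ((x(k := s))(i := t)) = mixE P k F (x(k := s))"
      by (rule Suc.IH) (use False Suc.prems in linarith)
    then show ?thesis by (subst fun_upd_twist[OF False])
  qed
  then show ?case by (simp only: mixE.simps)
qed simp

lemma epow_minus_1_mult:
  assumes "1 < q"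
  shows "epow x (q - 1) * x = epow x q"
  by (cases x) (auto simp: epow_ennreal ennreal_top_mult powr_mult_base mult.commute simp flip: ennreal_mult)

text \<open>For finite mixed norms, \<open>mixE_dual Q n F\<close> is the extremal function in Hoelder's inequality: it has norm
  at most 1 and its pairing with \<open>F\<close> is the mixed norm of \<open>F\<close>. The factor is set to 0 where the
  denominator vanishes.\<close>
definition mixE_ratio :: "(nat \<Rightarrow> real) \<Rightarrow> nat \<Rightarrow> ((nat \<Rightarrow> real) \<Rightarrow> ennreal) \<Rightarrow> (nat \<Rightarrow> real) \<Rightarrow> ennreal" where
  "mixE_ratio Q k F y =
     (if mixE Q (Suc k) F y = 0 then 0 else epow (mixE Q k F y / mixE Q (Suc k) F y) (Q k - 1))"

fun mixE_dual :: "(nat \<Rightarrow> real) \<Rightarrow> nat \<Rightarrow> ((nat \<Rightarrow> real) \<Rightarrow> ennreal) \<Rightarrow> (nat \<Rightarrow> real) \<Rightarrow> ennreal" where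
  "mixE_dual Q 0 F y = 1"
| "mixE_dual Q (Suc k) F y = mixE_ratio Q k F y * mixE_dual Q k F y"

lemma measurable_mixE_ratio:
  assumes "F \<in> borel_measurable (Lb {..<n})" "k < n"
  shows "mixE_ratio Q k F \<in> borel_measurable (Lb {..<n})"
proof -
  have [measurable]: "mixE Q (Suc k) F \<in> borel_measurable (Lb {..<n})" "mixE Q k F \<in> borel_measurable (Lb {..<n})"
    using assms by (auto intro!: measurable_mixE[where n = n] simp del: mixE.simps)
  show ?thesis
    unfolding mixE_ratio_def[abs_def] by measurable
qed

lemma measurable_mixE_dual:
  assumes F: "F \<in> borel_measurable (Lb {..<n})" and "k \<le> n"
  shows "mixE_dual Q k F \<in> borel_measurable (Lb {..<n})"
  using assms(2)
proof (induction k)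
  case 0
  have "mixE_dual Q 0 F = (\<lambda>_. 1)" by (rule ext) simp
  then show ?case by simp
next
  case (Suc k)
  then have [measurable]: "mixE_dual Q k F \<in> borel_measurable (Lb {..<n})" by simp
  have [measurable]: "mixE_ratio Q k F \<in> borel_measurable (Lb {..<n})"
    using Suc.prems by (intro measurable_mixE_ratio[OF F]) simp
  show ?case by simp
qed

lemma mixE_ratio_fun_upd: "i < k \<Longrightarrow> mixE_ratio Q k F (y(i := t)) = mixE_ratio Q k F y"
  unfolding mixE_ratio_def using mixE_fun_upd[of i k Q F y t] mixE_fun_upd[of i "Suc k" Q F y t]
  by (simp del: mixE.simps)

text \<open>The factor added at step \<open>k\<close> does not depend on earlier coordinates, so it
  comes out of the inner norms. What remains is one-dimensional: with \<open>a\<close> the norm of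
  \<open>A\<close>, the function \<open>t \<mapsto> epow (A t / a) (Q k - 1)\<close> has norm at
  most 1 and its pairing with \<open>A\<close> is \<open>a\<close>.\<close>

lemma mixE_dual_step:
  assumes F: "F \<in> borel_measurable (Lb {..<n})"
    and fin: "\<And>k x. k \<le> n \<Longrightarrow> x \<in> extensional {k..<n} \<Longrightarrow> mixE Q k F x < top"
    and PQ: "\<And>i. i < n \<Longrightarrow> 1 < P i" "\<And>i. i < n \<Longrightarrow> 1 < Q i" "\<And>i. i < n \<Longrightarrow> 1 / P i + 1 / Q i = 1"
    and "k \<le> n" "x \<in> extensional {k..<n}"
  shows "mixE P k (mixE_dual Q k F) x \<le> 1 \<and> mixE (\<lambda>_. 1) k (\<lambda>y. F y * mixE_dual Q k F y) x = mixE Q k F x"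
  using assms(6,7)
proof (induction k arbitrary: x)
  case 0
  then show ?case by simp
next
  case (Suc k)
  have k: "k < n" "k \<le> n" using Suc.prems by auto
  note x = Suc.prems(2)
  note xt = fun_upd_Lb[OF x k(1)]
  have Pk: "1 < P k" "1 < Q k" and PQk: "1 / P k + 1 / Q k = 1" using PQ k by auto
  \<comment> \<open>Conjugacy in the form used here: the \<open>P k\<close>-th power of the factor
    is the \<open>Q k\<close>-th power of \<open>A t / a\<close>.\<close>
  have PQ': "(Q k - 1) * P k = Q k"
    using Pk PQk by (simp add: field_simps)
  have mD: "mixE_dual Q k F \<in> borel_measurable (Lb {..<n})"
    by (rule measurable_mixE_dual[OF F k(2)])
  have mFD: "(\<lambda>y. F y * mixE_dual Q k F y) \<in> borel_measurable (Lb {..<n})"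
    using F mD by simp
  note [measurable] = measurable_mixE_slice[OF F x k(1), of Q]
  define A where "A = (\<lambda>t. mixE Q k F (x(k := t)))"
  define a where "a = mixE Q (Suc k) F x"
  have mA [measurable]: "A \<in> borel_measurable lborel" unfolding A_def by measurable
  have a: "epow a (Q k) = (\<integral>\<^sup>+t. epow (A t) (Q k) \<partial>lborel)"
    using Pk by (simp add: a_def A_def)
  have R: "mixE_ratio Q k F (x(k := t)) = (if a = 0 then 0 else epow (A t / a) (Q k - 1))" for t
    unfolding mixE_ratio_def mixE_fun_upd[OF lessI] by (simp add: A_def a_def del: mixE.simps)
  have e1: "mixE P k (mixE_dual Q (Suc k) F) (x(k := t)) \<le> mixE_ratio Q k F (x(k := t))" for t
  proof -
    have "mixE P k (\<lambda>y. mixE_ratio Q k F y * mixE_dual Q k F y) (x(k := t))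
        = mixE_ratio Q k F (x(k := t)) * mixE P k (mixE_dual Q k F) (x(k := t))"
    proof (rule mixE_cmult[OF mD mixE_ratio_fun_upd _ k(2) xt])
      show "0 < P i" if "i < n" for i using PQ(1)[OF that] by simp
    qed
    also have "\<dots> \<le> mixE_ratio Q k F (x(k := t)) * 1"
      by (rule mult_left_mono[OF conjunct1[OF Suc.IH[OF k(2) xt]]]) simp
    finally show ?thesis
      unfolding mixE_dual.simps(2)[abs_def] by (simp only: mult_1_right)
  qed
  have e2: "mixE (\<lambda>_. 1) k (\<lambda>y. F y * mixE_dual Q (Suc k) F y) (x(k := t))
      = mixE_ratio Q k F (x(k := t)) * A t" for t
  proof -
    have "mixE (\<lambda>_. 1) k (\<lambda>y. mixE_ratio Q k F y * (F y * mixE_dual Q k F y)) (x(k := t))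
        = mixE_ratio Q k F (x(k := t)) * mixE (\<lambda>_. 1) k (\<lambda>y. F y * mixE_dual Q k F y) (x(k := t))"
      by (rule mixE_cmult[OF mFD mixE_ratio_fun_upd _ k(2) xt]) auto
    also have "mixE (\<lambda>_. 1) k (\<lambda>y. F y * mixE_dual Q k F y) (x(k := t)) = A t"
      unfolding A_def by (rule conjunct2[OF Suc.IH[OF k(2) xt]])
    finally show ?thesis
      unfolding mixE_dual.simps(2) mult.left_commute[of "F _"] .
  qed
  have g1: "(\<integral>\<^sup>+t. epow (mixE P k (mixE_dual Q (Suc k) F) (x(k := t))) (P k) \<partial>lborel) \<le> 1 \<and>
     (\<integral>\<^sup>+t. mixE_ratio Q k F (x(k := t)) * A t \<partial>lborel) = a"
  proof (cases "a = 0")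
    case True
    then have "mixE P k (mixE_dual Q (Suc k) F) (x(k := t)) = 0" for t
      using e1[of t] by (simp add: R)
    then show ?thesis using True by (simp add: R)
  next
    case False
    have "a < top" unfolding a_def using fin Suc.prems by blast
    with False obtain r where r: "0 < r" "a = ennreal r"
      by (cases a) (auto simp: order_less_le)
    \<comment> \<open>As \<open>a\<close> is finite and nonzero, division by it becomes
      multiplication by a finite \<open>b\<close> with \<open>b * a = 1\<close>.\<close>
    define b where "b = ennreal (1 / r)"
    have ba: "b * a = 1" using r by (simp add: b_def flip: ennreal_mult)
    have div: "A t / a = b * A t" for t
      using r by (simp add: b_def divide_ennreal_def inverse_ennreal inverse_eq_divide mult.commute)
    have "(\<integral>\<^sup>+t. epow (mixE P k (mixE_dual Q (Suc k) F) (x(k := t))) (P k) \<partial>lborel)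
        \<le> (\<integral>\<^sup>+t. epow (mixE_ratio Q k F (x(k := t))) (P k) \<partial>lborel)"
      using Pk by (intro nn_integral_mono epow_mono e1) auto
    also have "\<dots> = (\<integral>\<^sup>+t. epow b (Q k) * epow (A t) (Q k) \<partial>lborel)"
      using False by (simp add: R epow_epow PQ' div epow_mult)
    also have "\<dots> = epow (b * a) (Q k)"
      by (simp add: nn_integral_cmult a epow_mult)
    finally have 1: "(\<integral>\<^sup>+t. epow (mixE P k (mixE_dual Q (Suc k) F) (x(k := t))) (P k) \<partial>lborel) \<le> 1"
      by (simp add: ba)
    have "(\<integral>\<^sup>+t. mixE_ratio Q k F (x(k := t)) * A t \<partial>lborel)
        = (\<integral>\<^sup>+t. epow b (Q k - 1) * (epow (A t) (Q k - 1) * A t) \<partial>lborel)"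
      using False by (simp add: R div epow_mult mult_ac)
    also have "\<dots> = epow b (Q k - 1) * epow a (Q k)"
      by (simp add: epow_minus_1_mult[OF Pk(2)] nn_integral_cmult a)
    also have "\<dots> = epow (b * a) (Q k - 1) * a"
      by (simp add: epow_mult mult.assoc flip: epow_minus_1_mult[OF Pk(2)])
    finally show ?thesis using 1 by (simp add: ba)
  qed
  have "mixE P (Suc k) (mixE_dual Q (Suc k) F) x \<le> epow 1 (1 / P k)"
    unfolding mixE.simps using g1 Pk by (intro epow_mono) auto
  moreover have "mixE (\<lambda>_. 1) (Suc k) (\<lambda>y. F y * mixE_dual Q (Suc k) F y) x = a"
    using g1 by (simp only: mixE.simps e2 epow_1 div_by_1)
  ultimately show ?case by (simp only: a_def epow_one_base)
qed

lemma mixE_bounded_finite: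
  assumes F: "\<And>x. F x \<le> ennreal c * indicator (cube n a l) x" and l: "0 \<le> l"
    and P: "\<And>i. i < n \<Longrightarrow> 0 < P i" and k: "k \<le> n" "x \<in> extensional {k..<n}"
    and cube: "cube n a l \<in> sets (Lb {..<n})"
  shows "mixE P k F x < top"
proof -
  have "mixE P k F x \<le> mixE P k (\<lambda>x. ennreal c * indicator (cube n a l) x) x"
    by (rule mixE_mono[OF F P k])
  also have "\<dots> = ennreal c * mixE P k (indicator (cube n a l)) x"
    by (rule mixE_cmult[OF _ refl P k]) (use cube in auto)
  also have "\<dots> \<le> ennreal c * (ennreal (\<Prod>j<k. l powr (1 / P j))
      * indicator {x. \<forall>j\<in>{k..<n}. a j \<le> x j \<and> x j \<le> a j + l} x)"
    by (intro mult_left_mono mixE_indicator_cube_le_step[OF P l k]) auto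
  also have "\<dots> < top"
    by (auto simp: ennreal_mult_less_top indicator_def)
  finally show ?thesis .
qed

lemma cube_sets [measurable]: "cube n a l \<in> sets (Lb {..<n})"
proof -
  have "cube n a l = {x \<in> space (Lb {..<n}). \<forall>i\<in>{..<n}. a i \<le> x i \<and> x i \<le> a i + l}"
    by (auto simp: cube_def space_Lb)
  also have "\<dots> \<in> sets (Lb {..<n})"
    by measurable
  finally show ?thesis .
qed

text \<open>Boundedness and bounded support make the partial norms finite at every point and every
  stage, not only at the last; the normalisations in the extremal function rely on this.\<close>

lemma mixE_norming:
  assumes F: "F \<in> borel_measurable (Lb {..<n})"
    and le: "\<And>x. F x \<le> ennreal c * indicator (cube n a l) x" and l: "0 \<le> l"
    and PQ: "\<And>i. i < n \<Longrightarrow> 1 < P i" "\<And>i. i < n \<Longrightarrow> 1 < Q i" "\<And>i. i < n \<Longrightarrow> 1 / P i + 1 / Q i = 1"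
  obtains G where "G \<in> borel_measurable (Lb {..<n})" "mixE P n G (\<lambda>_. undefined) \<le> 1"
    "(\<integral>\<^sup>+x. F x * G x \<partial>Lb {..<n}) = mixE Q n F (\<lambda>_. undefined)"
proof
  show m: "mixE_dual Q n F \<in> borel_measurable (Lb {..<n})"
    by (rule measurable_mixE_dual[OF F order.refl])
  have fin: "mixE Q k F x < top" if "k \<le> n" "x \<in> extensional {k..<n}" for k x
  proof (rule mixE_bounded_finite[OF le l _ that cube_sets])
    show "0 < Q i" if "i < n" for i using PQ(2)[OF that] by simp
  qed
  have s: "mixE P n (mixE_dual Q n F) (\<lambda>_. undefined) \<le> 1 \<and>
    mixE (\<lambda>_. 1) n (\<lambda>y. F y * mixE_dual Q n F y) (\<lambda>_. undefined) = mixE Q n F (\<lambda>_. undefined)"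
    by (rule mixE_dual_step[OF F fin PQ order.refl]) auto
  then show "mixE P n (mixE_dual Q n F) (\<lambda>_. undefined) \<le> 1" by simp
  show "(\<integral>\<^sup>+x. F x * mixE_dual Q n F x \<partial>Lb {..<n}) = mixE Q n F (\<lambda>_. undefined)"
    using s F m by (subst nn_integral_Lb_mixE) auto
qed

text \<open>By duality: pair \<open>F + G\<close> with its extremal function and apply Hoelder's
  inequality to each summand. Domination by indicators of a common cube makes that extremal function
  available.\<close>

lemma mixE_triangle:
  assumes [measurable]: "F \<in> borel_measurable (Lb {..<n})" "G \<in> borel_measurable (Lb {..<n})"
    and le: "\<And>x. F x \<le> ennreal c * indicator (cube n a l) x" "\<And>x. G x \<le> ennreal d * indicator (cube n a l) x"
    and l: "0 \<le> l" and cd: "0 \<le> c" "0 \<le> d"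
    and PQ: "\<And>i. i < n \<Longrightarrow> 1 < P i" "\<And>i. i < n \<Longrightarrow> 1 < Q i" "\<And>i. i < n \<Longrightarrow> 1 / P i + 1 / Q i = 1"
  shows "mixE Q n (\<lambda>x. F x + G x) (\<lambda>_. undefined) \<le> mixE Q n F (\<lambda>_. undefined) + mixE Q n G (\<lambda>_. undefined)"
proof -
  have le': "F x + G x \<le> ennreal (c + d) * indicator (cube n a l) x" for x
    using add_mono[OF le(1)[of x] le(2)[of x]] cd by (simp add: distrib_right)
  have m: "(\<lambda>x. F x + G x) \<in> borel_measurable (Lb {..<n})" by measurable
  obtain H where H [measurable]: "H \<in> borel_measurable (Lb {..<n})" and H1: "mixE P n H (\<lambda>_. undefined) \<le> 1"
    and HI: "(\<integral>\<^sup>+x. (F x + G x) * H x \<partial>Lb {..<n}) = mixE Q n (\<lambda>x. F x + G x) (\<lambda>_. undefined)"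
    by (rule mixE_norming[OF m le' l PQ])
  have *: "(\<integral>\<^sup>+x. K x * H x \<partial>Lb {..<n}) \<le> mixE Q n K (\<lambda>_. undefined)"
    if [measurable]: "K \<in> borel_measurable (Lb {..<n})" for K
  proof -
    have "(\<integral>\<^sup>+x. H x * K x \<partial>Lb {..<n}) \<le> mixE P n H (\<lambda>_. undefined) * mixE Q n K (\<lambda>_. undefined)"
      by (rule mixE_Holder[OF H that PQ])
    also have "\<dots> \<le> 1 * mixE Q n K (\<lambda>_. undefined)"
      using H1 by (intro mult_right_mono) auto
    finally show ?thesis by (simp add: mult.commute)
  qed
  have "mixE Q n (\<lambda>x. F x + G x) (\<lambda>_. undefined) = (\<integral>\<^sup>+x. F x * H x + G x * H x \<partial>Lb {..<n})"
    unfolding HI[symmetric] by (simp add: distrib_right)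
  also have "\<dots> = (\<integral>\<^sup>+x. F x * H x \<partial>Lb {..<n}) + (\<integral>\<^sup>+x. G x * H x \<partial>Lb {..<n})"
    by (rule nn_integral_add) measurable
  also have "\<dots> \<le> mixE Q n F (\<lambda>_. undefined) + mixE Q n G (\<lambda>_. undefined)"
    by (intro add_mono *) measurable
  finally show ?thesis .
qed

text \<open>The tests are simple functions because a functional known through the measures of sets
  is represented on those by linearity alone. Two approximations from below do the rest: simple
  functions increasing to \<open>G\<close> on the cube extend the test to every \<open>G\<close> of
  norm at most 1, and the truncations \<open>T k\<close> of \<open>F\<close> have extremal
  functions.\<close>

lemma mixE_converse_Holder:
  assumes F [measurable]: "F \<in> borel_measurable (Lb {..<n})" and F0: "\<And>x. x \<notin> cube n a l \<Longrightarrow> F x = 0"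
    and l: "0 \<le> l"
    and PQ: "\<And>i. i < n \<Longrightarrow> 1 < P i" "\<And>i. i < n \<Longrightarrow> 1 < Q i" "\<And>i. i < n \<Longrightarrow> 1 / P i + 1 / Q i = 1"
    and test: "\<And>s. simple_function (Lb {..<n}) s \<Longrightarrow> (\<And>x. s x < top) \<Longrightarrow> (\<And>x. x \<notin> cube n a l \<Longrightarrow> s x = 0)
      \<Longrightarrow> (\<integral>\<^sup>+x. F x * s x \<partial>Lb {..<n}) \<le> C * mixE P n s (\<lambda>_. undefined)"
  shows "mixE Q n F (\<lambda>_. undefined) \<le> C"
proof -
  have pos: "\<And>i. i < n \<Longrightarrow> 0 < P i" "\<And>i. i < n \<Longrightarrow> 0 < Q i" using PQ(1,2) by force+
  have FG: "(\<integral>\<^sup>+x. F x * G x \<partial>Lb {..<n}) \<le> C"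
    if G [measurable]: "G \<in> borel_measurable (Lb {..<n})" and G1: "mixE P n G (\<lambda>_. undefined) \<le> 1" for G
  proof -
    define G' where "G' = (\<lambda>x. G x * indicator (cube n a l) x)"
    have G' [measurable]: "G' \<in> borel_measurable (Lb {..<n})" unfolding G'_def by measurable
    obtain s where s: "\<And>i. simple_function (Lb {..<n}) (s i)" "incseq s" "\<And>i x. s i x < top" "\<And>x. (SUP i. s i x) = G' x"
      using borel_measurable_implies_simple_function_sequence'[OF G'] by blast
    have sG: "s i x \<le> G' x" for i x unfolding s(4)[symmetric] by (rule SUP_upper) simp
    have "(\<integral>\<^sup>+x. F x * G x \<partial>Lb {..<n}) = (\<integral>\<^sup>+x. F x * G' x \<partial>Lb {..<n})"
      by (intro nn_integral_cong) (auto simp: G'_def indicator_def F0)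
    also have "\<dots> = (\<integral>\<^sup>+x. (SUP i. F x * s i x) \<partial>Lb {..<n})"
      by (simp add: SUP_mult_left_ennreal flip: s(4))
    also have "\<dots> = (SUP i. \<integral>\<^sup>+x. F x * s i x \<partial>Lb {..<n})"
    proof (rule nn_integral_monotone_convergence_SUP)
      show "incseq (\<lambda>i x. F x * s i x)"
        using s(2) by (auto simp: incseq_def le_fun_def intro!: mult_left_mono)
      show "(\<lambda>x. F x * s i x) \<in> borel_measurable (Lb {..<n})" for i
        using borel_measurable_simple_function[OF s(1)] by measurable
    qed
    also have "\<dots> \<le> C"
    proof (rule SUP_least)
      fix i
      have "(\<integral>\<^sup>+x. F x * s i x \<partial>Lb {..<n}) \<le> C * mixE P n (s i) (\<lambda>_. undefined)"
      proof (rule test[OF s(1,3)])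
        show "s i x = 0" if "x \<notin> cube n a l" for x
          using sG[of i x] that by (simp add: G'_def)
      qed
      also have "mixE P n (s i) (\<lambda>_. undefined) \<le> mixE P n G (\<lambda>_. undefined)"
      proof (rule mixE_mono[OF _ pos(1) order.refl])
        show "s i x \<le> G x" for x
          using sG[of i x] by (cases "x \<in> cube n a l") (auto simp: G'_def)
      qed auto
      also have "\<dots> \<le> 1" by (rule G1)
      finally show "(\<integral>\<^sup>+x. F x * s i x \<partial>Lb {..<n}) \<le> C" by (simp add: mult_left_mono)
    qed
    finally show ?thesis .
  qed
  define T where "T = (\<lambda>(k::nat) x. min (F x) (of_nat k))"
  have T [measurable]: "T k \<in> borel_measurable (Lb {..<n})" for k
    unfolding T_def by measurable
  have "mixE Q n (T k) (\<lambda>_. undefined) \<le> C" for k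
  proof -
    have le: "T k x \<le> ennreal (real k) * indicator (cube n a l) x" for x
      by (auto simp: T_def indicator_def F0 ennreal_of_nat_eq_real_of_nat)
    obtain G where G: "G \<in> borel_measurable (Lb {..<n})" "mixE P n G (\<lambda>_. undefined) \<le> 1"
      "(\<integral>\<^sup>+x. T k x * G x \<partial>Lb {..<n}) = mixE Q n (T k) (\<lambda>_. undefined)"
      by (rule mixE_norming[OF T le l PQ])
    have "mixE Q n (T k) (\<lambda>_. undefined) \<le> (\<integral>\<^sup>+x. F x * G x \<partial>Lb {..<n})"
      unfolding G(3)[symmetric] by (intro nn_integral_mono mult_right_mono) (auto simp: T_def)
    also have "\<dots> \<le> C" by (rule FG[OF G(1,2)])
    finally show ?thesis .
  qed
  moreover have "(SUP k. T k x) = F x" for x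
  proof -
    have "(SUP k. T k x) = inf (F x) (SUP k. of_nat k)"
      by (simp add: T_def inf_SUP flip: inf_min)
    then show ?thesis by (simp add: ennreal_SUP_of_nat_eq_top)
  qed
  moreover have "mixE Q n (\<lambda>x. SUP k. T k x) (\<lambda>_. undefined) = (SUP k. mixE Q n (T k) (\<lambda>_. undefined))"
    by (rule mixE_SUP[OF T _ pos(2) order.refl])
       (auto simp: incseq_def le_fun_def T_def intro: min.coboundedI2 of_nat_mono)
  ultimately show ?thesis by (simp add: SUP_least)
qed

section \<open>Borel representatives, and the bound of the supremum by the block norm\<close>

lemma mixed_norm_eq_mixE: "mixed_norm n P f = mixE P n (\<lambda>x. ennreal \<bar>f x\<bar>) (\<lambda>_. undefined)"
  by (simp add: mixed_norm_def mixn_eq_mixE)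

lemma conj_exp_props:
  assumes "1 < p"
  shows "1 < conj_exp p" "1 / p + 1 / conj_exp p = 1"
  using assms by (auto simp: conj_exp_def field_simps)

lemma mixed_norm_cong_AE:
  assumes "AE x in Lb {..<n}. \<bar>f x\<bar> = \<bar>g x\<bar>"
  shows "mixed_norm n P f = mixed_norm n P g"
  unfolding mixed_norm_eq_mixE by (rule mixE_cong_AE) (use assms in auto)

lemma nn_integral_Rn: "(\<integral>\<^sup>+x. F x \<partial>Rn n) = (\<integral>\<^sup>+x. F x \<partial>Lb {..<n})"
  by (simp add: Rn_def nn_integral_completion)

lemma AE_Rn: "(AE x in Rn n. A x) \<longleftrightarrow> (AE x in Lb {..<n}. A x)"
  unfolding Rn_def AE_completion_iff ..

lemma space_Rn: "space (Rn n) = extensional {..<n}"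
  by (simp add: Rn_def space_Lb)

lemma Rn_ex_borel:
  assumes "f \<in> borel_measurable (Rn n)"
  obtains f' :: "(nat \<Rightarrow> real) \<Rightarrow> real" where "f' \<in> borel_measurable (Lb {..<n})" "AE x in Lb {..<n}. f x = f' x"
  using completion_ex_borel_measurable_real assms unfolding Rn_def by blast

lemma borel_measurable_Rn: "f \<in> borel_measurable (Lb {..<n}) \<Longrightarrow> f \<in> borel_measurable (Rn n)"
  unfolding Rn_def by (rule measurable_completion)

lemma morrey_norm_upper:
  "0 < l \<Longrightarrow> ennreal (morrey_factor n p0 P l) * mixed_norm n P (\<lambda>x. f x * indicator (cube n a l) x)
     \<le> morrey_norm n p0 P f"
  unfolding morrey_norm_def by (rule SUP_upper2[of "(a, l)"]) auto

text \<open>Hoelder's inequality on the cube of the block, whose norm bound is exactly the weight of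
  that cube in the Morrey norm. Both functions are first replaced by Borel representatives, which
  have measurable sections.\<close>

lemma block_pairing:
  assumes b: "is_block n p0 P b" and g: "g \<in> borel_measurable (Rn n)" and P: "\<And>i. i < n \<Longrightarrow> 1 < P i"
  shows "(\<integral>\<^sup>+x. ennreal \<bar>b x * g x\<bar> \<partial>Rn n) \<le> morrey_norm n p0 P g"
proof -
  from b obtain a l where l: "0 < l" and supp: "\<And>x. x \<in> space (Rn n) \<Longrightarrow> b x \<noteq> 0 \<Longrightarrow> x \<in> cube n a l"
    and nb: "mixed_norm n (\<lambda>i. conj_exp (P i)) b \<le> ennreal (morrey_factor n p0 P l)"
    and "b \<in> borel_measurable (Rn n)"
    by (auto simp: is_block_def)
  then obtain b' where b' [measurable]: "b' \<in> borel_measurable (Lb {..<n})" "AE x in Lb {..<n}. b x = b' x"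
    using Rn_ex_borel by blast
  obtain g' where g' [measurable]: "g' \<in> borel_measurable (Lb {..<n})" "AE x in Lb {..<n}. g x = g' x"
    using Rn_ex_borel[OF g] by blast
  let ?C = "cube n a l"
  have "(\<integral>\<^sup>+x. ennreal \<bar>b x * g x\<bar> \<partial>Rn n)
      = (\<integral>\<^sup>+x. ennreal \<bar>g' x * indicator ?C x\<bar> * ennreal \<bar>b' x\<bar> \<partial>Lb {..<n})"
    unfolding nn_integral_Rn
  proof (rule nn_integral_cong_AE)
    show "AE x in Lb {..<n}. ennreal \<bar>b x * g x\<bar> = ennreal \<bar>g' x * indicator ?C x\<bar> * ennreal \<bar>b' x\<bar>"
      using b'(2) g'(2) AE_space
    proof eventually_elim
      case (elim x)
      then show ?case using supp[of x]
        by (cases "b x = 0") (auto simp: abs_mult mult.commute space_Rn space_Lb simp flip: ennreal_mult)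
    qed
  qed
  also have "\<dots> \<le> mixE P n (\<lambda>x. ennreal \<bar>g' x * indicator ?C x\<bar>) (\<lambda>_. undefined)
      * mixE (\<lambda>i. conj_exp (P i)) n (\<lambda>x. ennreal \<bar>b' x\<bar>) (\<lambda>_. undefined)"
    using P conj_exp_props[OF P] by (intro mixE_Holder) auto
  also have "\<dots> = mixed_norm n P (\<lambda>x. g x * indicator ?C x) * mixed_norm n (\<lambda>i. conj_exp (P i)) b"
    unfolding mixed_norm_eq_mixE[symmetric]
    using b'(2) g'(2) by (intro arg_cong2[where f = "(*)"] mixed_norm_cong_AE) auto
  also have "\<dots> \<le> mixed_norm n P (\<lambda>x. g x * indicator ?C x) * ennreal (morrey_factor n p0 P l)"
    by (intro mult_left_mono nb) auto
  also have "\<dots> \<le> morrey_norm n p0 P g"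
    using morrey_norm_upper[OF l, of n p0 P g a] by (simp add: mult.commute)
  finally show ?thesis .
qed

text \<open>Almost everywhere \<open>f x * g x\<close> is the limit of the partial sums, so its
  modulus is at most the series of the \<open>\<bar>lam i\<bar> * \<bar>b i x * g x\<bar>\<close>,
  which is integrated term by term.\<close>

lemma kothe_sup_le_decomp:
  assumes d: "block_decomp n p0 P f lam b" and P: "\<And>i. i < n \<Longrightarrow> 1 < P i"
  shows "kothe_sup n p0 P f \<le> ennreal (\<Sum>i. \<bar>lam i\<bar>)"
  unfolding kothe_sup_def
proof (rule SUP_least)
  fix g assume "g \<in> {g \<in> morrey_space n p0 P. morrey_norm n p0 P g \<le> 1}"
  then have g [measurable]: "g \<in> borel_measurable (Rn n)" and g1: "morrey_norm n p0 P g \<le> 1"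
    by (auto simp: morrey_space_def)
  have sm: "summable (\<lambda>i. \<bar>lam i\<bar>)" and b: "\<And>i. is_block n p0 P (b i)"
    and ae: "AE x in Rn n. (\<lambda>N. \<Sum>i<N. lam i * b i x) \<longlonglongrightarrow> f x"
    using d by (auto simp: block_decomp_def)
  have [measurable]: "b i \<in> borel_measurable (Rn n)" for i using b[of i] by (simp add: is_block_def)
  have "(\<integral>\<^sup>+x. ennreal \<bar>f x * g x\<bar> \<partial>Rn n) \<le> (\<integral>\<^sup>+x. (\<Sum>i. ennreal \<bar>lam i\<bar> * ennreal \<bar>b i x * g x\<bar>) \<partial>Rn n)"
  proof (rule nn_integral_mono_AE, use ae in eventually_elim)
    fix x assume lim: "(\<lambda>N. \<Sum>i<N. lam i * b i x) \<longlonglongrightarrow> f x"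
    then have "(\<lambda>N. ennreal \<bar>(\<Sum>i<N. lam i * b i x) * g x\<bar>) \<longlonglongrightarrow> ennreal \<bar>f x * g x\<bar>"
      by (intro tendsto_ennrealI tendsto_rabs tendsto_mult_right)
    then show "ennreal \<bar>f x * g x\<bar> \<le> (\<Sum>i. ennreal \<bar>lam i\<bar> * ennreal \<bar>b i x * g x\<bar>)"
    proof (rule LIMSEQ_le_const2, intro exI allI impI)
      fix N
      have "\<bar>(\<Sum>i<N. lam i * b i x) * g x\<bar> \<le> (\<Sum>i<N. \<bar>lam i\<bar> * \<bar>b i x * g x\<bar>)"
        using sum_abs[of "\<lambda>i. lam i * b i x * g x" "{..<N}"]
        by (simp add: sum_distrib_right abs_mult mult.assoc)
      then have "ennreal \<bar>(\<Sum>i<N. lam i * b i x) * g x\<bar> \<le> (\<Sum>i<N. ennreal (\<bar>lam i\<bar> * \<bar>b i x * g x\<bar>))"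
        by (subst sum_ennreal) (auto intro!: ennreal_leI)
      also have "\<dots> \<le> (\<Sum>i. ennreal (\<bar>lam i\<bar> * \<bar>b i x * g x\<bar>))"
        by (rule sum_le_suminf) auto
      finally show "ennreal \<bar>(\<Sum>i<N. lam i * b i x) * g x\<bar> \<le> (\<Sum>i. ennreal \<bar>lam i\<bar> * ennreal \<bar>b i x * g x\<bar>)"
        by (simp add: ennreal_mult)
    qed
  qed
  also have "\<dots> = (\<Sum>i. ennreal \<bar>lam i\<bar> * (\<integral>\<^sup>+x. ennreal \<bar>b i x * g x\<bar> \<partial>Rn n))"
    by (simp add: nn_integral_suminf nn_integral_cmult)
  also have "\<dots> \<le> (\<Sum>i. ennreal \<bar>lam i\<bar> * 1)"
    using order_trans[OF block_pairing[OF b g P] g1]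
    by (intro suminf_le mult_left_mono) auto
  also have "\<dots> = ennreal (\<Sum>i. \<bar>lam i\<bar>)"
    using sm by (simp add: suminf_ennreal2)
  finally show "(\<integral>\<^sup>+x. ennreal \<bar>f x * g x\<bar> \<partial>Rn n) \<le> ennreal (\<Sum>i. \<bar>lam i\<bar>)" .
qed

section \<open>Morrey norms over a grid of cubes\<close>

text \<open>The index \<open>(k, z)\<close> stands for the cube of side
  \<open>q powr (k + 1)\<close> with corner \<open>z\<close> times \<open>step k\<close>. A cube of
  side at most \<open>q powr k\<close> still fits after its corner is rounded down to the grid, as
  \<open>step k + q powr k = q powr (k + 1)\<close>. Rounding \<open>log q l\<close> up loses one
  factor \<open>q\<close>, this enlargement the other.\<close>

lemma cube_grid:
  fixes q :: real
  assumes q: "1 < q"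
  obtains c :: "nat \<Rightarrow> nat \<Rightarrow> real" and L :: "nat \<Rightarrow> real"
  where "\<And>i. 0 < L i"
    "\<And>a l. 0 < l \<Longrightarrow> \<exists>i. cube n a l \<subseteq> cube n (c i) (L i) \<and> L i \<le> q\<^sup>2 * l"
    "\<And>r e. 0 < e \<Longrightarrow> finite {i. e \<le> L i \<and> L i \<le> 1 / e \<and> cube n (c i) (L i) \<inter> cube n (\<lambda>_. - r) (2 * r) \<noteq> {}}"
proof -
  define I where "I = (UNIV :: int set) \<times> (PiE {..<n} (\<lambda>_. UNIV :: int set))"
  define step where "step = (\<lambda>k::int. (q - 1) * q powr k)"
  define c' where "c' = (\<lambda>(k, z::nat \<Rightarrow> int) j. z j * step k)"
  define L' where "L' = (\<lambda>(k::int, z::nat \<Rightarrow> int). q powr (k + 1))"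
  have "countable I" unfolding I_def by (intro countable_SIGMA countable_PiE) auto
  moreover have "infinite I"
  proof -
    have "PiE {..<n} (\<lambda>_. UNIV :: int set) \<noteq> {}" by (simp add: PiE_eq_empty_iff)
    then show ?thesis unfolding I_def by (auto simp: finite_cartesian_product_iff infinite_UNIV_int)
  qed
  ultimately obtain \<phi> :: "nat \<Rightarrow> int \<times> (nat \<Rightarrow> int)" where \<phi>: "bij_betw \<phi> UNIV I"
    using bij_betw_from_nat_into by blast
  have \<phi>_range: "range \<phi> = I" and \<phi>_inj: "inj \<phi>"
    using \<phi> unfolding bij_betw_def by simp_all
  have step_pos: "0 < step k" for k using q by (simp add: step_def)
  show thesis
  proof (rule that[of "\<lambda>i. L' (\<phi> i)" "\<lambda>i. c' (\<phi> i)"])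
    show "0 < L' (\<phi> i)" for i using q by (simp add: L'_def split: prod.split)
  next
    fix a :: "nat \<Rightarrow> real" and l :: real
    assume l: "0 < l"
    define k where "k = \<lceil>log q l\<rceil>"
    define z where "z = restrict (\<lambda>j. \<lfloor>a j / step k\<rfloor>) {..<n}"
    have "(k, z) \<in> I" by (auto simp: I_def z_def)
    then obtain i where i: "\<phi> i = (k, z)" unfolding \<phi>_range[symmetric] by (metis rangeE)
    have "l = q powr (log q l)" using q l by simp
    also have "\<dots> \<le> q powr k" using q by (intro powr_mono) (auto simp: k_def)
    finally have l1: "l \<le> q powr k" .
    have "q powr (k + 1) \<le> q powr (log q l + 2)"
      using q by (intro powr_mono) (auto simp: k_def, linarith)
    also have "\<dots> = q\<^sup>2 * l" using q l by (simp add: powr_add)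
    finally have l2: "L' (\<phi> i) \<le> q\<^sup>2 * l" by (simp add: i L'_def)
    have sum: "step k + q powr k = q powr (k + 1)"
      using q by (simp add: step_def powr_add algebra_simps)
    have "cube n a l \<subseteq> cube n (c' (\<phi> i)) (L' (\<phi> i))"
    proof
      fix x assume x: "x \<in> cube n a l"
      have "c' (\<phi> i) j \<le> x j \<and> x j \<le> c' (\<phi> i) j + L' (\<phi> i)" if j: "j < n" for j
      proof -
        have xj: "a j \<le> x j" "x j \<le> a j + l" using x j by (auto simp: cube_def)
        have cj: "c' (\<phi> i) j = \<lfloor>a j / step k\<rfloor> * step k" using j by (simp add: i c'_def z_def)
        have "\<lfloor>a j / step k\<rfloor> * step k \<le> a j / step k * step k"
          using step_pos[of k] by (intro mult_right_mono) auto
        then have 1: "c' (\<phi> i) j \<le> a j" using step_pos[of k] by (simp add: cj)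
        have "a j / step k * step k \<le> (\<lfloor>a j / step k\<rfloor> + 1) * step k"
          using step_pos[of k] by (intro mult_right_mono) (linarith, simp)
        then have "a j \<le> c' (\<phi> i) j + step k" using step_pos[of k] by (simp add: cj distrib_right)
        with 1 xj l1 sum show ?thesis by (simp add: i L'_def)
      qed
      then show "x \<in> cube n (c' (\<phi> i)) (L' (\<phi> i))" using x by (auto simp: cube_def)
    qed
    with l2 show "\<exists>i. cube n a l \<subseteq> cube n (c' (\<phi> i)) (L' (\<phi> i)) \<and> L' (\<phi> i) \<le> q\<^sup>2 * l" by blast
  next
    fix r e :: real
    assume e: "0 < e"
    let ?A = "{i. e \<le> L' (\<phi> i) \<and> L' (\<phi> i) \<le> 1 / e \<and> cube n (c' (\<phi> i)) (L' (\<phi> i)) \<inter> cube n (\<lambda>_. - r) (2 * r) \<noteq> {}}"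
    \<comment> \<open>A lower bound for the step when the side is at least \<open>e\<close>. A grid
      cube of side at most \<open>1 / e\<close> that meets the centred cube has corner coordinates
      at most \<open>\<bar>r\<bar> + 1 / e\<close> in modulus, so \<open>M\<close> bounds its
      integer coordinates.\<close>
    define s where "s = (q - 1) * (e / q)"
    define M where "M = \<lceil>(\<bar>r\<bar> + 1 / e) / s\<rceil>"
    define B where "B = {\<lfloor>log q e\<rfloor> - 1..\<lceil>log q (1 / e)\<rceil>} \<times> PiE {..<n} (\<lambda>_. {- M..M})"
    have s: "0 < s" using q e by (simp add: s_def)
    have "\<phi> ` ?A \<subseteq> B"
    proof
      fix w assume "w \<in> \<phi> ` ?A"
      then obtain i where i: "w = \<phi> i" "i \<in> ?A" by auto
      obtain k z where kz: "\<phi> i = (k, z)" by (cases "\<phi> i")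
      have "\<phi> i \<in> I" unfolding \<phi>_range[symmetric] by (rule rangeI)
      then have zI: "z \<in> PiE {..<n} (\<lambda>_. UNIV)" unfolding kz I_def by simp
      have L: "e \<le> q powr (k + 1)" "q powr (k + 1) \<le> 1 / e" using i by (auto simp: kz L'_def)
      have "log q e \<le> k + 1" using L(1) q e by (simp add: log_le_iff)
      moreover have "k + 1 \<le> log q (1 / e)" using L(2) q e by (simp add: le_log_iff)
      ultimately have k: "k \<in> {\<lfloor>log q e\<rfloor> - 1..\<lceil>log q (1 / e)\<rceil>}" by (simp, linarith)
      have "e / q \<le> q powr k" using L(1) q by (simp add: powr_add field_simps)
      then have sk: "s \<le> step k" unfolding s_def step_def using q by (intro mult_left_mono) auto
      obtain x where x: "x \<in> cube n (c' (\<phi> i)) (L' (\<phi> i))" "x \<in> cube n (\<lambda>_. - r) (2 * r)"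
        using i by auto
      have "z j \<in> {- M..M}" if j: "j < n" for j
      proof -
        have xj: "z j * step k \<le> x j" "x j \<le> z j * step k + q powr (k + 1)" "- r \<le> x j" "x j \<le> - r + 2 * r"
          using x j by (auto simp: cube_def kz c'_def L'_def)
        with L(2) have "\<bar>z j * step k\<bar> \<le> \<bar>r\<bar> + 1 / e" using e by (simp add: abs_le_iff)
        then have "\<bar>real_of_int (z j)\<bar> * step k \<le> \<bar>r\<bar> + 1 / e" using step_pos[of k] by (simp add: abs_mult)
        moreover have "\<bar>real_of_int (z j)\<bar> * s \<le> \<bar>real_of_int (z j)\<bar> * step k" using sk by (intro mult_left_mono) auto
        ultimately have "\<bar>real_of_int (z j)\<bar> \<le> (\<bar>r\<bar> + 1 / e) / s" using s by (simp add: field_simps)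
        then show ?thesis unfolding M_def by (simp add: abs_le_iff) linarith
      qed
      then have "z \<in> PiE {..<n} (\<lambda>_. {- M..M})" using zI by (auto simp: PiE_def)
      then show "w \<in> B" using k by (simp add: i kz B_def)
    qed
    moreover have "finite B" unfolding B_def by (intro finite_cartesian_product finite_PiE) auto
    ultimately have "finite (\<phi> ` ?A)" by (rule finite_subset)
    then show "finite ?A" by (rule finite_imageD) (rule inj_on_subset[OF \<phi>_inj subset_UNIV])
  qed
qed

text \<open>The test functions. They are Borel, not merely measurable for the completion, so that
  sections are measurable; centred cubes put any two supports into a common one; the bound holds at
  every point, so this is a space of functions rather than of classes.\<close>

definition bdd_supp :: "nat \<Rightarrow> ((nat \<Rightarrow> real) \<Rightarrow> real) set" where
  "bdd_supp n = {g \<in> borel_measurable (Lb {..<n}).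
     \<exists>c r. 0 \<le> c \<and> 0 < r \<and> (\<forall>x. \<bar>g x\<bar> \<le> c * indicator (cube n (\<lambda>_. - r) (2 * r)) x)}"

lemma cube_mono: "r \<le> r' \<Longrightarrow> cube n (\<lambda>_. - r) (2 * r) \<subseteq> cube n (\<lambda>_. - r') (2 * r')"
  unfolding cube_def by (auto intro: order_trans[of "- r'" "- r"] order_trans[of _ r r'])

lemma cube_subset_centered:
  obtains r where "0 < r" "cube n a l \<subseteq> cube n (\<lambda>_. - r) (2 * r)"
proof
  define r where "r = 1 + \<bar>l\<bar> + (\<Sum>i<n. \<bar>a i\<bar>)"
  show "0 < r" unfolding r_def by (intro add_pos_nonneg sum_nonneg) auto
  show "cube n a l \<subseteq> cube n (\<lambda>_. - r) (2 * r)"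
  proof
    fix x assume x: "x \<in> cube n a l"
    have "- r \<le> x i \<and> x i \<le> - r + 2 * r" if "i < n" for i
    proof -
      have "\<bar>a i\<bar> \<le> (\<Sum>i<n. \<bar>a i\<bar>)" using that by (intro member_le_sum) auto
      moreover have "a i \<le> x i" "x i \<le> a i + l" using x that by (auto simp: cube_def)
      ultimately have "- r \<le> x i" "x i \<le> r" unfolding r_def by linarith+
      then show ?thesis by simp
    qed
    then show "x \<in> cube n (\<lambda>_. - r) (2 * r)" using x by (auto simp: cube_def)
  qed
qed

lemma bdd_suppE:
  assumes "g \<in> bdd_supp n"
  obtains c r where "0 \<le> c" "0 < r" "\<And>x. \<bar>g x\<bar> \<le> c * indicator (cube n (\<lambda>_. - r) (2 * r)) x"
  using assms by (auto simp: bdd_supp_def)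

lemma bdd_suppI:
  assumes "g \<in> borel_measurable (Lb {..<n})" "\<And>x. \<bar>g x\<bar> \<le> c * indicator (cube n a l) x" "0 \<le> c"
  shows "g \<in> bdd_supp n"
proof -
  obtain r where r: "0 < r" "cube n a l \<subseteq> cube n (\<lambda>_. - r) (2 * r)" by (rule cube_subset_centered)
  have "\<bar>g x\<bar> \<le> c * indicator (cube n (\<lambda>_. - r) (2 * r)) x" for x
    using assms(2)[of x] r(2) assms(3) by (cases "x \<in> cube n a l") auto
  then show ?thesis using assms r by (auto simp: bdd_supp_def)
qed

lemma measurable_bdd_supp: "g \<in> bdd_supp n \<Longrightarrow> g \<in> borel_measurable (Lb {..<n})"
  by (simp add: bdd_supp_def)

lemma subspace_bdd_supp: "subspace (bdd_supp n)"
  unfolding subspace_def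
proof (intro conjI ballI allI)
  have "(\<lambda>x. 0) \<in> bdd_supp n" by (rule bdd_suppI[where c = 0]) auto
  then show "0 \<in> bdd_supp n" by (simp add: zero_fun_def)
  fix g assume g: "g \<in> bdd_supp n"
  note [measurable] = measurable_bdd_supp[OF g]
  obtain c r where c: "0 \<le> c" "0 < r" "\<And>x. \<bar>g x\<bar> \<le> c * indicator (cube n (\<lambda>_. - r) (2 * r)) x"
    using g by (rule bdd_suppE) blast
  { fix h assume h: "h \<in> bdd_supp n"
    note [measurable] = measurable_bdd_supp[OF h]
    obtain d s where d: "0 \<le> d" "0 < s" "\<And>x. \<bar>h x\<bar> \<le> d * indicator (cube n (\<lambda>_. - s) (2 * s)) x"
      using h by (rule bdd_suppE) blast
    have "\<bar>g x + h x\<bar> \<le> (c + d) * indicator (cube n (\<lambda>_. - (max r s)) (2 * max r s)) x" for x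
    proof -
      have "\<bar>g x + h x\<bar> \<le> c * indicator (cube n (\<lambda>_. - r) (2 * r)) x + d * indicator (cube n (\<lambda>_. - s) (2 * s)) x"
        using c(3)[of x] d(3)[of x] by linarith
      also have "\<dots> \<le> c * indicator (cube n (\<lambda>_. - (max r s)) (2 * max r s)) x + d * indicator (cube n (\<lambda>_. - (max r s)) (2 * max r s)) x"
        using cube_mono[of r "max r s" n] cube_mono[of s "max r s" n] c(1) d(1)
        by (intro add_mono mult_left_mono) (auto simp: indicator_def)
      finally show ?thesis by (simp add: distrib_right)
    qed
    then have "(\<lambda>x. g x + h x) \<in> bdd_supp n"
      using c d by (intro bdd_suppI[where c = "c + d" and a = "\<lambda>_. - (max r s)" and l = "2 * max r s"]) auto
    then show "g + h \<in> bdd_supp n" by (simp add: plus_fun_def) }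
  fix k :: real
  have "(\<lambda>x. k * g x) \<in> bdd_supp n"
  proof (rule bdd_suppI)
    show "\<bar>k * g x\<bar> \<le> (\<bar>k\<bar> * c) * indicator (cube n (\<lambda>_. - r) (2 * r)) x" for x
      using c(3)[of x] by (simp add: abs_mult mult_left_mono mult.assoc)
  qed (use c in auto)
  then show "k *\<^sub>R g \<in> bdd_supp n" by (simp add: scaleR_fun_def)
qed

lemma bdd_supp_dominated:
  assumes "g \<in> bdd_supp n" "h \<in> borel_measurable (Lb {..<n})" "\<And>x. \<bar>h x\<bar> \<le> \<bar>g x\<bar>"
  shows "h \<in> bdd_supp n"
proof -
  obtain c r where c: "0 \<le> c" "0 < r" "\<And>x. \<bar>g x\<bar> \<le> c * indicator (cube n (\<lambda>_. - r) (2 * r)) x"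
    using assms(1) by (rule bdd_suppE) blast
  show ?thesis by (rule bdd_suppI[OF assms(2) order_trans[OF assms(3) c(3)] c(1)])
qed

lemma pos_part_bdd_supp: "g \<in> bdd_supp n \<Longrightarrow> pos_part g \<in> bdd_supp n"
  using measurable_bdd_supp[of g n]
  by (intro bdd_supp_dominated[of g n "pos_part g"]) (auto simp: pos_part_def)

lemma indicator_bdd_supp:
  assumes "A \<in> sets (Lb {..<n})" "A \<subseteq> cube n a l"
  shows "indicator A \<in> bdd_supp n"
  using assms by (intro bdd_suppI[where c = 1 and a = a and l = l]) (auto simp: indicator_def)

section \<open>Weighted norms on cubes and their decay\<close>

locale morrey =
  fixes n :: nat and p0 :: real and P :: "nat \<Rightarrow> real"
  assumes n_pos: "1 \<le> n" and p0_gt: "1 < p0" and P_gt: "\<And>i. i < n \<Longrightarrow> 1 < P i"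
    and gap: "real n / p0 < (\<Sum>i<n. 1 / P i)"
begin

abbreviation u :: "nat \<Rightarrow> real" where "u \<equiv> (\<lambda>_. undefined)"
abbreviation M :: "(nat \<Rightarrow> real) measure" where "M \<equiv> Lb {..<n}"

text \<open>The weight of a cube of side \<open>l\<close> is \<open>l powr (- \<delta>)\<close>, and
  the strict inequality between the exponents says that \<open>\<delta>\<close> is positive.\<close>

definition \<delta> :: real where "\<delta> = (\<Sum>i<n. 1 / P i) - real n / p0"

lemma \<delta>_pos: "0 < \<delta>" using gap by (simp add: \<delta>_def)

lemma P_pos: "i < n \<Longrightarrow> 0 < P i" using P_gt[of i] by simp

abbreviation P' :: "nat \<Rightarrow> real" where "P' \<equiv> (\<lambda>i. conj_exp (P i))"

lemma PP': "\<And>i. i < n \<Longrightarrow> 1 < P i" "\<And>i. i < n \<Longrightarrow> 1 < P' i" "\<And>i. i < n \<Longrightarrow> 1 / P i + 1 / P' i = 1"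
  "\<And>i. i < n \<Longrightarrow> 1 / P' i + 1 / P i = 1"
  using P_gt conj_exp_props by (auto simp: add.commute)

lemma morrey_factor_eq:
  assumes "0 < l"
  shows "morrey_factor n p0 P l = l powr (- \<delta>)"
proof -
  have "real n * (1 / p0 - 1 / real n * (\<Sum>j<n. 1 / P j)) = - \<delta>"
    using n_pos by (simp add: \<delta>_def right_diff_distrib)
  then show ?thesis
    using assms by (simp add: morrey_factor_def powr_powr flip: powr_realpow)
qed

text \<open>The norm \<open>N\<^sub>i\<close> for the cube with corner \<open>a\<close> and side
  \<open>l\<close>. As \<open>ennreal\<close> sends negative reals to 0, only the positive part of
  \<open>g\<close> counts; the value is real because the splitting works with real
  functionals.\<close>

definition N :: "(nat \<Rightarrow> real) \<Rightarrow> real \<Rightarrow> ((nat \<Rightarrow> real) \<Rightarrow> real) \<Rightarrow> real" where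
  "N a l g = morrey_factor n p0 P l * enn2real (mixE P n (\<lambda>x. ennreal (g x) * indicator (cube n a l) x) u)"

lemma cut_bound:
  assumes "g \<in> bdd_supp n"
  obtains c where "0 \<le> c" "\<And>x. ennreal (g x) * indicator (cube n a l) x \<le> ennreal c * indicator (cube n a l) x"
proof -
  obtain c r where c: "0 \<le> c" "0 < r" "\<And>x. \<bar>g x\<bar> \<le> c * indicator (cube n (\<lambda>_. - r) (2 * r)) x"
    using assms by (rule bdd_suppE) blast
  have "g x \<le> c" for x
    using c(3)[of x] c(1) by (cases "x \<in> cube n (\<lambda>_. - r) (2 * r)") auto
  then show ?thesis using c(1) by (intro that[of c]) (auto simp: indicator_def ennreal_leI)
qed

lemma measurable_cut: "g \<in> bdd_supp n \<Longrightarrow> (\<lambda>x. ennreal (g x) * indicator (cube n a l) x) \<in> borel_measurable M"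
  using measurable_bdd_supp[of g n] by simp

lemma mixE_cut_finite:
  assumes "g \<in> bdd_supp n" "0 < l"
  shows "mixE P n (\<lambda>x. ennreal (g x) * indicator (cube n a l) x) u < top"
proof -
  obtain c where c: "\<And>x. ennreal (g x) * indicator (cube n a l) x \<le> ennreal c * indicator (cube n a l) x"
    using assms(1) by (rule cut_bound[of g a l]) blast
  show ?thesis by (rule mixE_bounded_finite[OF c _ P_pos order.refl _ cube_sets]) (use assms in auto)
qed

lemma ennreal_N:
  assumes "g \<in> bdd_supp n" "0 < l"
  shows "ennreal (N a l g) = ennreal (morrey_factor n p0 P l) * mixE P n (\<lambda>x. ennreal (g x) * indicator (cube n a l) x) u"
  using mixE_cut_finite[OF assms] by (simp add: N_def ennreal_mult morrey_factor_def)

lemma morrey_factor_nonneg [simp]: "0 \<le> morrey_factor n p0 P l" by (simp add: morrey_factor_def)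

lemma N_nonneg: "0 \<le> N a l g"
  by (simp add: N_def)

lemma N_add:
  assumes "g \<in> bdd_supp n" "h \<in> bdd_supp n" "0 \<le> g" "0 \<le> h" "0 < l"
  shows "N a l (g + h) \<le> N a l g + N a l h"
proof -
  obtain c where c: "0 \<le> c" "\<And>x. ennreal (g x) * indicator (cube n a l) x \<le> ennreal c * indicator (cube n a l) x"
    using assms(1) by (rule cut_bound[of g a l]) blast
  obtain d where d: "0 \<le> d" "\<And>x. ennreal (h x) * indicator (cube n a l) x \<le> ennreal d * indicator (cube n a l) x"
    using assms(2) by (rule cut_bound[of h a l]) blast
  have "mixE P n (\<lambda>x. ennreal ((g + h) x) * indicator (cube n a l) x) u
      = mixE P n (\<lambda>x. ennreal (g x) * indicator (cube n a l) x + ennreal (h x) * indicator (cube n a l) x) u"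
    using assms(3,4) by (simp add: distrib_right le_fun_def)
  also have "\<dots> \<le> mixE P n (\<lambda>x. ennreal (g x) * indicator (cube n a l) x) u + mixE P n (\<lambda>x. ennreal (h x) * indicator (cube n a l) x) u"
    by (rule mixE_triangle[OF measurable_cut[OF assms(1)] measurable_cut[OF assms(2)] c(2) d(2) _ c(1) d(1) PP'(2,1,4)])
       (use assms(5) in auto)
  finally have "enn2real (mixE P n (\<lambda>x. ennreal ((g + h) x) * indicator (cube n a l) x) u)
      \<le> enn2real (mixE P n (\<lambda>x. ennreal (g x) * indicator (cube n a l) x) u + mixE P n (\<lambda>x. ennreal (h x) * indicator (cube n a l) x) u)"
    using mixE_cut_finite[OF assms(1,5)] mixE_cut_finite[OF assms(2,5)] by (intro enn2real_mono) auto
  also have "\<dots> = enn2real (mixE P n (\<lambda>x. ennreal (g x) * indicator (cube n a l) x) u) + enn2real (mixE P n (\<lambda>x. ennreal (h x) * indicator (cube n a l) x) u)"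
    using mixE_cut_finite[OF assms(1,5)] mixE_cut_finite[OF assms(2,5)] by (intro enn2real_plus) auto
  finally show ?thesis
    unfolding N_def distrib_left[symmetric] by (intro mult_left_mono) auto
qed

lemma N_scale:
  assumes "g \<in> bdd_supp n" "0 \<le> g" "0 \<le> c"
  shows "N a l (c *\<^sub>R g) = c * N a l g"
proof -
  have "mixE P n (\<lambda>x. ennreal ((c *\<^sub>R g) x) * indicator (cube n a l) x) u
      = mixE P n (\<lambda>x. ennreal c * (ennreal (g x) * indicator (cube n a l) x)) u"
    using assms(2,3) by (simp add: ennreal_mult le_fun_def mult.assoc)
  also have "\<dots> = ennreal c * mixE P n (\<lambda>x. ennreal (g x) * indicator (cube n a l) x) u"
    by (rule mixE_cmult[OF measurable_cut[OF assms(1)] refl P_pos order.refl]) auto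
  finally show ?thesis using assms(3) by (simp add: N_def enn2real_mult)
qed

lemma N_mono:
  assumes "h \<in> bdd_supp n" "0 < l" "g \<le> h"
  shows "N a l g \<le> N a l h"
proof -
  have "mixE P n (\<lambda>x. ennreal (g x) * indicator (cube n a l) x) u \<le> mixE P n (\<lambda>x. ennreal (h x) * indicator (cube n a l) x) u"
    by (rule mixE_mono[OF _ P_pos order.refl]) (use assms(3) in \<open>auto simp: le_fun_def intro!: mult_right_mono ennreal_leI\<close>)
  then show ?thesis
    unfolding N_def using mixE_cut_finite[OF assms(1,2)]
    by (intro mult_left_mono enn2real_mono) auto
qed

lemma N_eq_0:
  assumes "\<And>x. x \<in> cube n a l \<Longrightarrow> g x \<le> 0"
  shows "N a l g = 0"
proof -
  have "mixE P n (\<lambda>x. ennreal (g x) * indicator (cube n a l) x) u = mixE P n (\<lambda>x. 0) u"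
  proof (rule mixE_cong_AE, rule AE_I2)
    fix x show "ennreal (g x) * indicator (cube n a l) x = 0"
      using assms[of x] by (cases "x \<in> cube n a l") (auto simp: ennreal_neg)
  qed
  also have "\<dots> = 0 * mixE P n (\<lambda>x. 0) u"
    using mixE_cmult[of "\<lambda>_. 0" n n "\<lambda>_. 0" P u] P_pos by simp
  finally show ?thesis by (simp add: N_def)
qed

text \<open>Both come from comparison with \<open>c\<close> times the indicator of a cube. The cube
  itself gives the first bound, good for small \<open>l\<close>, where its norm and the weight
  combine to \<open>l powr (n / p0)\<close>. The cube containing the support of \<open>g\<close>
  gives the second, good for large \<open>l\<close>.\<close>

lemma N_bounds:
  assumes g: "g \<in> bdd_supp n" and l: "0 < l"
    and c: "0 \<le> c" "0 < r" "\<And>x. \<bar>g x\<bar> \<le> c * indicator (cube n (\<lambda>_. - r) (2 * r)) x"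
  shows "N a l g \<le> c * l powr (real n / p0)"
    and "N a l g \<le> c * ((2 * r) powr (\<Sum>i<n. 1 / P i) * l powr (- \<delta>))"
proof -
  have *: "N a l g \<le> c * (s powr (\<Sum>i<n. 1 / P i) * l powr (- \<delta>))"
    if s: "0 < s" and le: "\<And>x. ennreal (g x) * indicator (cube n a l) x \<le> ennreal c * indicator (cube n b s) x" for s b
  proof -
    have "mixE P n (\<lambda>x. ennreal (g x) * indicator (cube n a l) x) u
        \<le> mixE P n (\<lambda>x. ennreal c * indicator (cube n b s) x) u"
      by (rule mixE_mono[OF le P_pos order.refl]) auto
    also have "\<dots> = ennreal c * mixE P n (indicator (cube n b s)) u"
      by (rule mixE_cmult[OF _ refl P_pos order.refl]) auto
    also have "\<dots> \<le> ennreal c * ennreal (s powr (\<Sum>j<n. 1 / P j))"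
      using P_pos s by (intro mult_left_mono mixE_indicator_cube_le) auto
    also have "\<dots> = ennreal (c * s powr (\<Sum>j<n. 1 / P j))" using c(1) by (simp add: ennreal_mult)
    finally have "enn2real (mixE P n (\<lambda>x. ennreal (g x) * indicator (cube n a l) x) u) \<le> c * s powr (\<Sum>j<n. 1 / P j)"
      using c(1) by (intro enn2real_leI) auto
    then have "N a l g \<le> l powr (- \<delta>) * (c * s powr (\<Sum>j<n. 1 / P j))"
      unfolding N_def morrey_factor_eq[OF l] by (intro mult_left_mono) auto
    then show ?thesis by (simp add: mult_ac)
  qed
  have gc: "g x \<le> c" for x using c(3)[of x] c(1) by (cases "x \<in> cube n (\<lambda>_. - r) (2 * r)") auto
  have "N a l g \<le> c * (l powr (\<Sum>i<n. 1 / P i) * l powr (- \<delta>))"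
    by (rule *[OF l, of a]) (use gc in \<open>auto simp: indicator_def ennreal_leI\<close>)
  also have "l powr (\<Sum>i<n. 1 / P i) * l powr (- \<delta>) = l powr (real n / p0)"
    by (simp add: \<delta>_def flip: powr_add)
  finally show "N a l g \<le> c * l powr (real n / p0)" .
  show "N a l g \<le> c * ((2 * r) powr (\<Sum>i<n. 1 / P i) * l powr (- \<delta>))"
  proof (rule *)
    fix x
    show "ennreal (g x) * indicator (cube n a l) x \<le> ennreal c * indicator (cube n (\<lambda>_. - r) (2 * r)) x"
      using c(3)[of x] by (cases "x \<in> cube n (\<lambda>_. - r) (2 * r)") (auto simp: indicator_def ennreal_leI)
  qed (use c in auto)
qed

lemma N_bounded:
  assumes g: "g \<in> bdd_supp n"
  obtains K where "0 \<le> K" "\<And>a l. 0 < l \<Longrightarrow> N a l g \<le> K"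
proof -
  obtain c r where c: "0 \<le> c" "0 < r" "\<And>x. \<bar>g x\<bar> \<le> c * indicator (cube n (\<lambda>_. - r) (2 * r)) x"
    using g by (rule bdd_suppE) blast
  define S where "S = (\<Sum>i<n. 1 / P i)"
  have "N a l g \<le> c + c * (2 * r) powr S" if l: "0 < l" for a l
  proof (cases "l \<le> 1")
    case True
    have "l powr (real n / p0) \<le> 1 powr (real n / p0)" using True l p0_gt by (intro powr_mono2) auto
    then have "N a l g \<le> c * 1"
      using N_bounds(1)[OF g l c, of a] c(1) mult_left_mono[of "l powr (real n / p0)" 1 c] by simp
    then show ?thesis using c(1) by (simp add: add_increasing2)
  next
    case False
    have "l powr (- \<delta>) \<le> l powr 0" using False \<delta>_pos by (intro powr_mono) auto
    then have "(2 * r) powr S * l powr (- \<delta>) \<le> (2 * r) powr S * 1"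
      using False by (intro mult_left_mono) auto
    then have "N a l g \<le> c * ((2 * r) powr S * 1)"
      using N_bounds(2)[OF g l c, of a] c(1) unfolding S_def by (meson mult_left_mono order_trans)
    then show ?thesis using c(1) by (simp add: add_increasing)
  qed
  then show ?thesis using c(1) by (intro that[of "c + c * (2 * r) powr S"]) auto
qed

text \<open>Sides below \<open>l1\<close> are excluded by the first bound, sides above
  \<open>l2\<close> by the second, and cubes that miss the support have norm 0. Local finiteness of
  the grid then leaves finitely many cubes.\<close>

lemma N_c0:
  assumes g: "g \<in> bdd_supp n" and e: "0 < e"
  obtains r d where "0 < d" "\<And>a l. 0 < l \<Longrightarrow> e < N a l g
     \<Longrightarrow> d \<le> l \<and> l \<le> 1 / d \<and> cube n a l \<inter> cube n (\<lambda>_. - r) (2 * r) \<noteq> {}"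
proof -
  obtain c r where c: "0 \<le> c" "0 < r" "\<And>x. \<bar>g x\<bar> \<le> c * indicator (cube n (\<lambda>_. - r) (2 * r)) x"
    using g by (rule bdd_suppE) blast
  define \<alpha> where "\<alpha> = real n / p0"
  \<comment> \<open>With \<open>c + 1\<close> in place of \<open>c\<close> the thresholds
    \<open>l1\<close> and \<open>l2\<close> make sense also for \<open>c = 0\<close>.\<close>
  define D where "D = (c + 1) * (2 * r) powr (\<Sum>i<n. 1 / P i)"
  have \<alpha>: "0 < \<alpha>" using n_pos p0_gt by (simp add: \<alpha>_def)
  have D: "0 < D" using c by (simp add: D_def)
  define l1 where "l1 = (e / (c + 1)) powr (1 / \<alpha>)"
  define l2 where "l2 = (D / e) powr (1 / \<delta>)"
  have l12: "0 < l1" "0 < l2" using e c D by (auto simp: l1_def l2_def)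
  show thesis
  \<comment> \<open>Both thresholds are merged into the one parameter that the finiteness statement
    of the grid has.\<close>
  proof (rule that[of "min l1 (1 / l2)" r])
    show "0 < min l1 (1 / l2)" using l12 by simp
    fix a l assume l: "0 < l" and big: "e < N a l g"
    have "e < c * l powr \<alpha>" using N_bounds(1)[OF g l c, of a] big by (simp add: \<alpha>_def)
    also have "\<dots> \<le> (c + 1) * l powr \<alpha>" by (intro mult_right_mono) auto
    finally have "e < (c + 1) * l powr \<alpha>" .
    then have "e / (c + 1) < l powr \<alpha>" using c(1) by (simp add: field_simps)
    then have "(e / (c + 1)) powr (1 / \<alpha>) < (l powr \<alpha>) powr (1 / \<alpha>)"
      using e c(1) \<alpha> by (intro powr_less_mono2) auto
    then have 1: "l1 < l" using \<alpha> l by (simp add: l1_def powr_powr)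
    have "e < c * ((2 * r) powr (\<Sum>i<n. 1 / P i) * l powr (- \<delta>))"
      using N_bounds(2)[OF g l c, of a] big by linarith
    also have "\<dots> \<le> (c + 1) * ((2 * r) powr (\<Sum>i<n. 1 / P i) * l powr (- \<delta>))" by (intro mult_right_mono) auto
    finally have "e < D * l powr (- \<delta>)" by (simp add: D_def mult.assoc)
    then have "l powr \<delta> < D / e" using e l by (simp add: powr_minus field_simps)
    then have "(l powr \<delta>) powr (1 / \<delta>) < (D / e) powr (1 / \<delta>)"
      using \<delta>_pos by (intro powr_less_mono2) auto
    then have 2: "l < l2" using \<delta>_pos l by (simp add: l2_def powr_powr)
    have "l2 \<le> 1 / min l1 (1 / l2)" using l12 by (auto simp: min_def field_simps)
    moreover have "cube n a l \<inter> cube n (\<lambda>_. - r) (2 * r) \<noteq> {}"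
    proof
      assume disj: "cube n a l \<inter> cube n (\<lambda>_. - r) (2 * r) = {}"
      have "N a l g = 0"
      proof (rule N_eq_0)
        fix x assume "x \<in> cube n a l"
        then have "x \<notin> cube n (\<lambda>_. - r) (2 * r)" using disj by auto
        then show "g x \<le> 0" using c(3)[of x] by simp
      qed
      with big e show False by simp
    qed
    ultimately show "min l1 (1 / l2) \<le> l \<and> l \<le> 1 / min l1 (1 / l2) \<and> cube n a l \<inter> cube n (\<lambda>_. - r) (2 * r) \<noteq> {}"
      using 1 2 by auto
  qed
qed

end

section \<open>Densities and block decompositions\<close>

lemma indicator_cube_bdd_supp: "A \<in> sets (Lb {..<n}) \<Longrightarrow> indicator (A \<inter> cube n a l) \<in> bdd_supp n"
  by (rule indicator_bdd_supp[where a = a and l = l]) auto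

lemma indicator_nonneg_fun: "0 \<le> (indicator A :: 'a \<Rightarrow> real)"
  by (simp add: le_fun_def)

text \<open>Comparison with the finite measure \<open>D\<close> of density
  \<open>\<bar>f\<bar>\<close> on the cube gives both continuity at the empty set, hence countable
  additivity, and absolute continuity; Radon-Nikodym then applies.\<close>

lemma positive_functional_density:
  fixes S :: "((nat \<Rightarrow> real) \<Rightarrow> real) \<Rightarrow> real" and f :: "(nat \<Rightarrow> real) \<Rightarrow> real"
  assumes f [measurable]: "f \<in> borel_measurable (Lb {..<n})"
    and loc: "\<And>g. g \<in> bdd_supp n \<Longrightarrow> (\<integral>\<^sup>+x. ennreal \<bar>f x\<bar> * ennreal (g x) \<partial>Lb {..<n}) < top"
    and S_add: "\<And>g h. g \<in> bdd_supp n \<Longrightarrow> h \<in> bdd_supp n \<Longrightarrow> S (g + h) = S g + S h"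
    and S_nonneg: "\<And>g. g \<in> bdd_supp n \<Longrightarrow> 0 \<le> g \<Longrightarrow> 0 \<le> S g"
    and S_le: "\<And>g. g \<in> bdd_supp n \<Longrightarrow> 0 \<le> g \<Longrightarrow> ennreal (S g) \<le> (\<integral>\<^sup>+x. ennreal \<bar>f x\<bar> * ennreal (g x) \<partial>Lb {..<n})"
  obtains \<phi> :: "(nat \<Rightarrow> real) \<Rightarrow> real"
  where "\<phi> \<in> borel_measurable (Lb {..<n})" "\<And>x. 0 \<le> \<phi> x" "\<And>x. x \<notin> cube n a l \<Longrightarrow> \<phi> x = 0"
    "\<And>A. A \<in> sets (Lb {..<n}) \<Longrightarrow>
      (\<integral>\<^sup>+x. ennreal (\<phi> x) * indicator A x \<partial>Lb {..<n}) = ennreal (S (indicator (A \<inter> cube n a l)))"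
proof -
  let ?M = "Lb {..<n}" and ?Q = "cube n a l"
  interpret M: sigma_finite_measure ?M by (rule Lb.sigma_finite) simp
  define \<mu> where "\<mu> = (\<lambda>A. ennreal (S (indicator (A \<inter> ?Q))))"
  define D where "D = density ?M (\<lambda>x. ennreal \<bar>f x\<bar> * indicator ?Q x)"
  have \<mu>_le: "\<mu> A \<le> emeasure D A" if A: "A \<in> sets ?M" for A
  proof -
    have "\<mu> A \<le> (\<integral>\<^sup>+x. ennreal \<bar>f x\<bar> * ennreal (indicator (A \<inter> ?Q) x) \<partial>?M)"
      unfolding \<mu>_def by (intro S_le indicator_cube_bdd_supp A indicator_nonneg_fun)
    also have "\<dots> = emeasure D A"
      unfolding D_def using A by (subst emeasure_density) (auto intro!: nn_integral_cong simp: indicator_def)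
    finally show ?thesis .
  qed
  have S0: "S 0 = 0" using S_add[of 0 0] subspace_0[OF subspace_bdd_supp] by simp
  have ind0: "indicator {} = (0 :: (nat \<Rightarrow> real) \<Rightarrow> real)" by (simp add: fun_eq_iff)
  have \<mu>0: "\<mu> {} = 0" by (simp add: \<mu>_def ind0 S0)
  have ca: "countably_additive (sets ?M) \<mu>"
  proof (rule sets.empty_continuous_imp_countably_additive)
    show "positive (sets ?M) \<mu>" by (simp add: positive_def \<mu>0)
    show "additive (sets ?M) \<mu>"
      unfolding additive_def
    proof (intro ballI impI)
      fix A B assume AB: "A \<in> sets ?M" "B \<in> sets ?M" "A \<inter> B = {}"
      have "indicator ((A \<union> B) \<inter> ?Q) = (indicator (A \<inter> ?Q) + indicator (B \<inter> ?Q) :: (nat \<Rightarrow> real) \<Rightarrow> real)"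
        using AB(3) by (auto simp: fun_eq_iff indicator_def)
      then have "S (indicator ((A \<union> B) \<inter> ?Q)) = S (indicator (A \<inter> ?Q)) + S (indicator (B \<inter> ?Q))"
        using AB by (simp add: S_add indicator_cube_bdd_supp)
      then show "\<mu> (A \<union> B) = \<mu> A + \<mu> B"
        using AB by (simp add: \<mu>_def S_nonneg indicator_cube_bdd_supp indicator_nonneg_fun)
    qed
    show "\<forall>A\<in>sets ?M. \<mu> A \<noteq> \<infinity>" by (simp add: \<mu>_def)
    fix A :: "nat \<Rightarrow> (nat \<Rightarrow> real) set"
    assume A: "range A \<subseteq> sets ?M" "decseq A" "(\<Inter>i. A i) = {}"
    have "emeasure D (A i) < top" for i
    proof -
      have "emeasure D (A i) \<le> emeasure D (space D)"
        by (rule emeasure_space)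
      also have "\<dots> = (\<integral>\<^sup>+x. ennreal \<bar>f x\<bar> * ennreal (indicator (space ?M \<inter> ?Q) x) \<partial>?M)"
        unfolding D_def by (subst emeasure_density) (auto intro!: nn_integral_cong simp: indicator_def)
      also have "\<dots> < top" by (intro loc indicator_cube_bdd_supp) simp
      finally show ?thesis .
    qed
    then have "emeasure D (A i) \<noteq> \<infinity>" for i by (metis infinity_ennreal_def less_irrefl)
    then have "(\<lambda>i. emeasure D (A i)) \<longlonglongrightarrow> emeasure D (\<Inter>i. A i)"
      using A by (intro Lim_emeasure_decseq) (auto simp: D_def)
    then have "(\<lambda>i. emeasure D (A i)) \<longlonglongrightarrow> 0" by (simp add: A(3))
    from tendsto_sandwich[OF _ _ tendsto_const this] show "(\<lambda>i. \<mu> (A i)) \<longlonglongrightarrow> 0"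
      using A(1) \<mu>_le by auto
  qed
  define N where "N = measure_of (space ?M) (sets ?M) \<mu>"
  have setsN [simp]: "sets N = sets ?M" by (simp add: N_def)
  have N: "emeasure N A = \<mu> A" if "A \<in> sets ?M" for A
    unfolding N_def using that ca
    by (intro emeasure_measure_of_sigma) (auto simp: positive_def \<mu>0 intro: sets.sigma_algebra_axioms)
  have "absolutely_continuous ?M N"
    unfolding absolutely_continuous_def
  proof
    fix A assume A: "A \<in> null_sets ?M"
    then have "emeasure D A = 0"
      unfolding D_def by (subst emeasure_density) (auto simp: nn_integral_null_set)
    then have "emeasure N A = 0" using N[of A] \<mu>_le[of A] A by auto
    then show "A \<in> null_sets N" using A by (intro null_setsI) auto
  qed
  then have RN: "density ?M (RN_deriv ?M N) = N" by (rule M.density_RN_deriv) simp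
  have RN_int: "(\<integral>\<^sup>+x. RN_deriv ?M N x * indicator A x \<partial>?M) = \<mu> A" if "A \<in> sets ?M" for A
  proof -
    have "emeasure (density ?M (RN_deriv ?M N)) A = \<mu> A" unfolding RN by (rule N[OF that])
    then show ?thesis using that by (simp add: emeasure_density)
  qed
  have "(\<integral>\<^sup>+x. RN_deriv ?M N x \<partial>?M) = (\<integral>\<^sup>+x. RN_deriv ?M N x * indicator (space ?M) x \<partial>?M)"
    by (intro nn_integral_cong) simp
  also have "\<dots> = \<mu> (space ?M)" by (intro RN_int) simp
  finally have "AE x in ?M. RN_deriv ?M N x \<noteq> \<infinity>"
    by (intro nn_integral_PInf_AE) (auto simp: \<mu>_def)
  then have fin: "AE x in ?M. RN_deriv ?M N x < top" by (simp add: less_top)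
  \<comment> \<open>Infinite values of the derivative fill only a null set, where
    \<open>enn2real\<close> puts 0. The cut makes \<open>\<phi>\<close> vanish off the cube at every
    point.\<close>
  define \<phi> where "\<phi> = (\<lambda>x. enn2real (RN_deriv ?M N x) * indicator ?Q x)"
  show thesis
  proof
    show "\<phi> \<in> borel_measurable ?M" unfolding \<phi>_def by measurable
    fix A assume A: "A \<in> sets ?M"
    have "(\<integral>\<^sup>+x. ennreal (\<phi> x) * indicator A x \<partial>?M) = (\<integral>\<^sup>+x. RN_deriv ?M N x * indicator (A \<inter> ?Q) x \<partial>?M)"
    proof (rule nn_integral_cong_AE, use fin in eventually_elim)
      fix x assume "RN_deriv ?M N x < top"
      then show "ennreal (\<phi> x) * indicator A x = RN_deriv ?M N x * indicator (A \<inter> ?Q) x"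
        by (auto simp: \<phi>_def indicator_def ennreal_enn2real)
    qed
    also have "\<dots> = \<mu> (A \<inter> ?Q)" using A by (intro RN_int) auto
    finally show "(\<integral>\<^sup>+x. ennreal (\<phi> x) * indicator A x \<partial>?M) = ennreal (S (indicator (A \<inter> ?Q)))"
      by (simp add: \<mu>_def Int_assoc)
  qed (auto simp: \<phi>_def)
qed

lemma linear_sum_on_subspace:
  fixes S :: "'v::real_vector \<Rightarrow> real"
  assumes V: "subspace V" and add: "\<And>g h. g \<in> V \<Longrightarrow> h \<in> V \<Longrightarrow> S (g + h) = S g + S h"
    and scale: "\<And>g c. g \<in> V \<Longrightarrow> S (c *\<^sub>R g) = c * S g"
    and g: "\<And>y. y \<in> Y \<Longrightarrow> g y \<in> V" and Y: "finite Y"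
  shows "S (\<Sum>y\<in>Y. c y *\<^sub>R g y) = (\<Sum>y\<in>Y. c y * S (g y))"
  using Y g
proof (induction Y rule: finite_induct)
  case empty
  then show ?case using scale[of 0 0] subspace_0[OF V] by simp
next
  case (insert y Y)
  then have "(\<Sum>y\<in>Y. c y *\<^sub>R g y) \<in> V"
    by (intro subspace_sum[OF V] subspace_scale[OF V]) auto
  then show ?case using insert by (simp add: add scale subspace_scale[OF V])
qed

lemma sum_fun_apply: "(\<Sum>y\<in>Y. g y) x = (\<Sum>y\<in>Y. g y x)"
  for g :: "'a \<Rightarrow> 'b \<Rightarrow> 'c::comm_monoid_add"
  by (induction Y rule: infinite_finite_induct) auto

text \<open>Linearity carries the representation from indicators to simple functions; as
  \<open>s\<close> vanishes off the cube, cutting its level sets to the cube changes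
  nothing.\<close>

lemma density_simple_function:
  fixes S :: "((nat \<Rightarrow> real) \<Rightarrow> real) \<Rightarrow> real"
  assumes S_add: "\<And>g h. g \<in> bdd_supp n \<Longrightarrow> h \<in> bdd_supp n \<Longrightarrow> S (g + h) = S g + S h"
    and S_scale: "\<And>g c. g \<in> bdd_supp n \<Longrightarrow> S (c *\<^sub>R g) = c * S g"
    and S_nonneg: "\<And>g. g \<in> bdd_supp n \<Longrightarrow> 0 \<le> g \<Longrightarrow> 0 \<le> S g"
    and \<phi> [measurable]: "\<phi> \<in> borel_measurable (Lb {..<n})"
    and rep: "\<And>A. A \<in> sets (Lb {..<n}) \<Longrightarrow>
      (\<integral>\<^sup>+x. ennreal (\<phi> x) * indicator A x \<partial>Lb {..<n}) = ennreal (S (indicator (A \<inter> cube n a l)))"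
    and s: "simple_function (Lb {..<n}) s" "\<And>x. s x < top" "\<And>x. x \<notin> cube n a l \<Longrightarrow> s x = 0"
  shows "(\<lambda>x. enn2real (s x)) \<in> bdd_supp n"
    and "(\<integral>\<^sup>+x. ennreal (\<phi> x) * s x \<partial>Lb {..<n}) = ennreal (S (\<lambda>x. enn2real (s x)))"
proof -
  let ?M = "Lb {..<n}" and ?Q = "cube n a l"
  define Y where "Y = s ` space ?M"
  define A where "A = (\<lambda>y. s -` {y} \<inter> space ?M)"
  have Y: "finite Y" using s(1) by (simp add: Y_def simple_function_def)
  have A [measurable]: "A y \<in> sets ?M" for y
    unfolding A_def by (rule simple_functionD(2)[OF s(1)])
  have s_eq: "s x = (\<Sum>y\<in>Y. y * indicator (A y) x)" if "x \<in> space ?M" for x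
    unfolding Y_def A_def by (rule simple_function_indicator_representation[OF s(1) that])
  have Ytop: "y < top" if "y \<in> Y" for y using that s(2) by (auto simp: Y_def)
  have ind: "indicator (A y \<inter> ?Q) \<in> bdd_supp n" for y by (intro indicator_cube_bdd_supp A)
  have g_eq: "(\<lambda>x. enn2real (s x)) = (\<Sum>y\<in>Y. enn2real y *\<^sub>R indicator (A y \<inter> ?Q))"
  proof (rule ext)
    fix x
    have "enn2real (s x) = (\<Sum>y\<in>Y. enn2real y * indicator (A y \<inter> ?Q) x)"
    proof (cases "x \<in> ?Q")
      case True
      then have x: "x \<in> space ?M" by (simp add: cube_def space_Lb)
      have "s x = (\<Sum>y\<in>Y. ennreal (enn2real y * indicator (A y) x))"
        unfolding s_eq[OF x] using Ytop by (intro sum.cong) (auto simp: indicator_def ennreal_enn2real)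
      also have "\<dots> = ennreal (\<Sum>y\<in>Y. enn2real y * indicator (A y) x)"
        by (intro sum_ennreal) auto
      finally have "enn2real (s x) = (\<Sum>y\<in>Y. enn2real y * indicator (A y) x)"
        by (simp add: sum_nonneg)
      then show ?thesis using True by (simp add: indicator_def)
    qed (simp add: s(3))
    then show "enn2real (s x) = (\<Sum>y\<in>Y. enn2real y *\<^sub>R indicator (A y \<inter> ?Q)) x"
      using Y by (simp add: sum_fun_apply)
  qed
  show "(\<lambda>x. enn2real (s x)) \<in> bdd_supp n"
    unfolding g_eq by (intro subspace_sum subspace_scale subspace_bdd_supp ind)
  have "(\<integral>\<^sup>+x. ennreal (\<phi> x) * s x \<partial>?M) = (\<integral>\<^sup>+x. (\<Sum>y\<in>Y. y * (ennreal (\<phi> x) * indicator (A y) x)) \<partial>?M)"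
    by (intro nn_integral_cong) (simp add: s_eq sum_distrib_left mult_ac)
  also have "\<dots> = (\<Sum>y\<in>Y. y * ennreal (S (indicator (A y \<inter> ?Q))))"
    by (simp add: nn_integral_sum nn_integral_cmult rep)
  also have "\<dots> = (\<Sum>y\<in>Y. ennreal (enn2real y * S (indicator (A y \<inter> ?Q))))"
    using Ytop S_nonneg[OF ind indicator_nonneg_fun]
    by (intro sum.cong) (auto simp: ennreal_mult ennreal_enn2real)
  also have "\<dots> = ennreal (\<Sum>y\<in>Y. enn2real y * S (indicator (A y \<inter> ?Q)))"
    using S_nonneg[OF ind indicator_nonneg_fun] by (intro sum_ennreal) auto
  also have "(\<Sum>y\<in>Y. enn2real y * S (indicator (A y \<inter> ?Q))) = S (\<lambda>x. enn2real (s x))"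
    unfolding g_eq
    by (rule linear_sum_on_subspace[OF subspace_bdd_supp S_add S_scale ind Y, symmetric])
  finally show "(\<integral>\<^sup>+x. ennreal (\<phi> x) * s x \<partial>?M) = ennreal (S (\<lambda>x. enn2real (s x)))" .
qed

section \<open>The pairing estimate over the grid, and the positive decomposition\<close>

context morrey
begin

lemma mixed_norm_cut: "mixed_norm n P (\<lambda>x. g x * indicator C x) = mixE P n (\<lambda>x. ennreal \<bar>g x\<bar> * indicator C x) u"
proof -
  have "ennreal \<bar>g x * indicator C x\<bar> = ennreal \<bar>g x\<bar> * indicator C x" for x
    by (auto simp: indicator_def)
  then show ?thesis by (simp only: mixed_norm_eq_mixE)
qed

text \<open>A cube of side \<open>l\<close> lies in a grid cube of side at most
  \<open>q\<^sup>2 * l\<close>, whose weight is at least \<open>q powr (- (2 * \<delta>))\<close>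
  times that of the given cube.\<close>

lemma morrey_norm_le_grid:
  assumes q: "1 < q" and L: "\<And>i. 0 < L i"
    and cover: "\<And>a l. 0 < l \<Longrightarrow> \<exists>i. cube n a l \<subseteq> cube n (c i) (L i) \<and> L i \<le> q\<^sup>2 * l"
    and g: "g \<in> bdd_supp n" "0 \<le> g" and K: "\<And>i. N (c i) (L i) g \<le> K"
  shows "morrey_norm n p0 P g \<le> ennreal (q powr (2 * \<delta>) * K)"
  unfolding morrey_norm_def
proof (rule SUP_least, clarify)
  fix a :: "nat \<Rightarrow> real" and l :: real assume l: "0 < l"
  obtain i where i: "cube n a l \<subseteq> cube n (c i) (L i)" "L i \<le> q\<^sup>2 * l" using cover[OF l] by blast
  have "(q\<^sup>2 * l) powr (- \<delta>) \<le> L i powr (- \<delta>)"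
    using \<delta>_pos L i(2) by (intro powr_mono2') auto
  also have "(q\<^sup>2 * l) powr (- \<delta>) = q powr (- (2 * \<delta>)) * l powr (- \<delta>)"
  proof -
    have "(q\<^sup>2) powr (- \<delta>) = (q powr 2) powr (- \<delta>)" using q by simp
    also have "\<dots> = q powr (- (2 * \<delta>))" unfolding powr_powr by simp
    finally show ?thesis using q l by (simp add: powr_mult)
  qed
  finally have "q powr (2 * \<delta>) * (q powr (- (2 * \<delta>)) * l powr (- \<delta>)) \<le> q powr (2 * \<delta>) * L i powr (- \<delta>)"
    by (intro mult_left_mono) auto
  moreover have "q powr (2 * \<delta>) * q powr (- (2 * \<delta>)) = 1"
    using q unfolding powr_add[symmetric] by simp
  ultimately have w: "morrey_factor n p0 P l \<le> q powr (2 * \<delta>) * morrey_factor n p0 P (L i)"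
    by (simp only: morrey_factor_eq l L mult.assoc[symmetric] mult_1_left)
  have "ennreal (morrey_factor n p0 P l) * mixed_norm n P (\<lambda>x. g x * indicator (cube n a l) x)
      = ennreal (morrey_factor n p0 P l) * mixE P n (\<lambda>x. ennreal (g x) * indicator (cube n a l) x) u"
    using g(2) by (simp add: mixed_norm_cut le_fun_def)
  also have "\<dots> \<le> ennreal (q powr (2 * \<delta>) * morrey_factor n p0 P (L i)) * mixE P n (\<lambda>x. ennreal (g x) * indicator (cube n (c i) (L i)) x) u"
  proof (rule mult_mono[OF ennreal_leI[OF w] mixE_mono[OF _ P_pos order.refl]])
    show "ennreal (g x) * indicator (cube n a l) x \<le> ennreal (g x) * indicator (cube n (c i) (L i)) x" for x
      using i(1) by (auto simp: indicator_def)
  qed auto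
  also have "\<dots> = ennreal (q powr (2 * \<delta>)) * ennreal (N (c i) (L i) g)"
    by (simp add: ennreal_N[OF g(1) L] ennreal_mult mult.assoc)
  also have "\<dots> \<le> ennreal (q powr (2 * \<delta>)) * ennreal K"
    by (intro mult_left_mono ennreal_leI K) auto
  also have "\<dots> = ennreal (q powr (2 * \<delta>) * K)"
    using order_trans[OF N_nonneg K] by (simp add: ennreal_mult)
  finally show "ennreal (morrey_factor n p0 P l) * mixed_norm n P (\<lambda>x. g x * indicator (cube n a l) x)
      \<le> ennreal (q powr (2 * \<delta>) * K)" .
qed

lemma morrey_norm_cmult_le:
  assumes g [measurable]: "g \<in> borel_measurable M" and c: "0 \<le> c"
  shows "morrey_norm n p0 P (\<lambda>x. c * g x) \<le> ennreal c * morrey_norm n p0 P g"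
  unfolding morrey_norm_def[of _ _ _ "\<lambda>x. c * g x"]
proof (rule SUP_least, clarify)
  fix a :: "nat \<Rightarrow> real" and l :: real assume l: "0 < l"
  have "mixed_norm n P (\<lambda>x. c * g x * indicator (cube n a l) x)
      = mixE P n (\<lambda>x. ennreal c * (ennreal \<bar>g x\<bar> * indicator (cube n a l) x)) u"
    unfolding mixed_norm_cut using c by (simp add: abs_mult ennreal_mult mult.assoc)
  also have "\<dots> = ennreal c * mixE P n (\<lambda>x. ennreal \<bar>g x\<bar> * indicator (cube n a l) x) u"
    by (rule mixE_cmult[OF _ refl P_pos order.refl]) auto
  finally have "ennreal (morrey_factor n p0 P l) * mixed_norm n P (\<lambda>x. c * g x * indicator (cube n a l) x)
      = ennreal c * (ennreal (morrey_factor n p0 P l) * mixed_norm n P (\<lambda>x. g x * indicator (cube n a l) x))"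
    by (simp add: mixed_norm_cut mult.left_commute)
  also have "\<dots> \<le> ennreal c * morrey_norm n p0 P g"
    by (intro mult_left_mono morrey_norm_upper l) auto
  finally show "ennreal (morrey_factor n p0 P l) * mixed_norm n P (\<lambda>x. c * g x * indicator (cube n a l) x)
      \<le> ennreal c * morrey_norm n p0 P g" .
qed

lemma kothe_sup_pairing:
  assumes f [measurable]: "f \<in> borel_measurable M" and C0: "0 \<le> C0" "kothe_sup n p0 P f \<le> ennreal C0"
    and g [measurable]: "g \<in> borel_measurable M" and K: "0 < K" "morrey_norm n p0 P g \<le> ennreal K"
  shows "(\<integral>\<^sup>+x. ennreal \<bar>f x * g x\<bar> \<partial>M) \<le> ennreal (C0 * K)"
proof -
  define h where "h = (\<lambda>x. (1 / K) * g x)"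
  have [measurable]: "h \<in> borel_measurable M" unfolding h_def by measurable
  have "morrey_norm n p0 P h \<le> ennreal (1 / K) * morrey_norm n p0 P g"
    unfolding h_def using K by (intro morrey_norm_cmult_le g) auto
  also have "\<dots> \<le> ennreal (1 / K) * ennreal K" by (intro mult_left_mono K) auto
  also have "\<dots> = 1" using K by (simp flip: ennreal_mult)
  finally have h1: "morrey_norm n p0 P h \<le> 1" .
  then have "h \<in> {g \<in> morrey_space n p0 P. morrey_norm n p0 P g \<le> 1}"
    by (auto simp: morrey_space_def borel_measurable_Rn intro: le_less_trans)
  then have "(\<integral>\<^sup>+x. ennreal \<bar>f x * h x\<bar> \<partial>Rn n) \<le> kothe_sup n p0 P f"
    unfolding kothe_sup_def by (rule SUP_upper)
  then have le: "(\<integral>\<^sup>+x. ennreal \<bar>f x * h x\<bar> \<partial>M) \<le> ennreal C0"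
    using C0(2) by (simp add: nn_integral_Rn)
  have "(\<integral>\<^sup>+x. ennreal \<bar>f x * g x\<bar> \<partial>M) = (\<integral>\<^sup>+x. ennreal K * ennreal \<bar>f x * h x\<bar> \<partial>M)"
    using K(1) by (intro nn_integral_cong) (simp add: h_def abs_mult flip: ennreal_mult)
  also have "\<dots> = ennreal K * (\<integral>\<^sup>+x. ennreal \<bar>f x * h x\<bar> \<partial>M)"
    by (rule nn_integral_cmult) measurable
  also have "\<dots> \<le> ennreal K * ennreal C0" by (intro mult_left_mono le) auto
  finally show ?thesis using K C0 by (simp add: ennreal_mult mult.commute)
qed

text \<open>Scaling \<open>g\<close> into the unit ball requires a positive bound, while
  \<open>K\<close> may be 0; hence \<open>K + d\<close> with \<open>d\<close> arbitrarily
  small.\<close>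

lemma nn_integral_pairing_le:
  assumes f [measurable]: "f \<in> borel_measurable M" and C0: "0 \<le> C0" "kothe_sup n p0 P f \<le> ennreal C0"
    and q: "1 < q" and L: "\<And>i. 0 < L i"
    and cover: "\<And>a l. 0 < l \<Longrightarrow> \<exists>i. cube n a l \<subseteq> cube n (c i) (L i) \<and> L i \<le> q\<^sup>2 * l"
    and g: "g \<in> bdd_supp n" "0 \<le> g" and K: "\<And>i. N (c i) (L i) g \<le> K"
  shows "(\<integral>\<^sup>+x. ennreal \<bar>f x\<bar> * ennreal (g x) \<partial>M) \<le> ennreal (q powr (2 * \<delta>) * C0 * K)"
proof -
  define C where "C = q powr (2 * \<delta>) * C0"
  have C: "0 \<le> C" using C0 by (simp add: C_def)
  have K0: "0 \<le> K" using order_trans[OF N_nonneg K] .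
  have "(\<integral>\<^sup>+x. ennreal \<bar>f x\<bar> * ennreal (g x) \<partial>M) \<le> ennreal (C * K)"
  proof (rule ennreal_le_epsilon)
    fix e :: real assume e: "0 < e"
    define d where "d = e / (C + 1)"
    have d: "0 < d" using e C by (simp add: d_def)
    have "C * d \<le> (C + 1) * d" using d by (intro mult_right_mono) auto
    also have "\<dots> = e" using C by (simp add: d_def)
    finally have Cd: "C * d \<le> e" .
    have "N (c i) (L i) g \<le> K + d" for i using K[of i] d by simp
    then have mn: "morrey_norm n p0 P g \<le> ennreal (q powr (2 * \<delta>) * (K + d))"
      by (intro morrey_norm_le_grid[OF q L cover g])
    have "(\<integral>\<^sup>+x. ennreal \<bar>f x\<bar> * ennreal (g x) \<partial>M) = (\<integral>\<^sup>+x. ennreal \<bar>f x * g x\<bar> \<partial>M)"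
      using g(2) by (intro nn_integral_cong) (simp add: abs_mult le_fun_def flip: ennreal_mult)
    also have "\<dots> \<le> ennreal (C0 * (q powr (2 * \<delta>) * (K + d)))"
      using q K0 d by (intro kothe_sup_pairing[OF f C0 measurable_bdd_supp[OF g(1)] _ mn]) simp
    also have "C0 * (q powr (2 * \<delta>) * (K + d)) = C * K + C * d"
      by (simp add: C_def algebra_simps)
    also have "ennreal (C * K + C * d) \<le> ennreal (C * K + e)" using Cd by (intro ennreal_leI) simp
    also have "\<dots> = ennreal (C * K) + ennreal e" using C K0 e by (intro ennreal_plus) auto
    finally show "(\<integral>\<^sup>+x. ennreal \<bar>f x\<bar> * ennreal (g x) \<partial>M) \<le> ennreal (C * K) + ennreal e" .
  qed
  then show ?thesis by (simp add: C_def)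
qed

lemma positive_decomposition:
  assumes f [measurable]: "f \<in> borel_measurable M" and C0: "0 \<le> C0" "kothe_sup n p0 P f \<le> ennreal C0"
    and q: "1 < q"
  obtains a :: "nat \<Rightarrow> nat \<Rightarrow> real" and L w :: "nat \<Rightarrow> real" and \<phi> :: "nat \<Rightarrow> (nat \<Rightarrow> real) \<Rightarrow> real"
  where "\<And>i. 0 < L i" "\<And>i. 0 \<le> w i" "summable w" "suminf w \<le> q powr (2 * \<delta>) * C0"
    "\<And>i. \<phi> i \<in> borel_measurable M" "\<And>i x. 0 \<le> \<phi> i x" "\<And>i x. x \<notin> cube n (a i) (L i) \<Longrightarrow> \<phi> i x = 0"
    "\<And>i. mixE P' n (\<lambda>x. ennreal (\<phi> i x)) u \<le> ennreal (w i * morrey_factor n p0 P (L i))"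
    "AE x in M. (\<Sum>i. ennreal (\<phi> i x)) = ennreal \<bar>f x\<bar>"
    "\<And>g. g \<in> bdd_supp n \<Longrightarrow> (\<integral>\<^sup>+x. ennreal \<bar>f x\<bar> * ennreal (g x) \<partial>M) < top"
proof -
  obtain c :: "nat \<Rightarrow> nat \<Rightarrow> real" and L :: "nat \<Rightarrow> real" where L: "\<And>i. 0 < L i"
    and cover: "\<And>a l. 0 < l \<Longrightarrow> \<exists>i. cube n a l \<subseteq> cube n (c i) (L i) \<and> L i \<le> q\<^sup>2 * l"
    and fin: "\<And>r e. 0 < e \<Longrightarrow> finite {i. e \<le> L i \<and> L i \<le> 1 / e \<and> cube n (c i) (L i) \<inter> cube n (\<lambda>_. - r) (2 * r) \<noteq> {}}"
    apply (rule cube_grid[OF q, where n = n])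
    subgoal premises prems for c L by (rule that[of L c]) (fact prems)+
    done
  let ?V = "bdd_supp n"
  define C where "C = q powr (2 * \<delta>) * C0"
  have C: "0 \<le> C" using C0 by (simp add: C_def)
  define Q where "Q = (\<lambda>i. cube n (c i) (L i))"
  define Ni where "Ni = (\<lambda>i. N (c i) (L i))"
  have pair_le: "(\<integral>\<^sup>+x. ennreal \<bar>f x\<bar> * ennreal (g x) \<partial>M) \<le> ennreal (C * K)"
    if "g \<in> ?V" "0 \<le> g" "\<And>i. N (c i) (L i) g \<le> K" for g K
    unfolding C_def by (rule nn_integral_pairing_le[OF f C0 q L _ that]) (rule cover)
  \<comment> \<open>Finiteness of the supremum makes \<open>f\<close> locally integrable, since the
    norms of a test function are bounded over all cubes.\<close>
  have loc: "(\<integral>\<^sup>+x. ennreal \<bar>f x\<bar> * ennreal (g x) \<partial>M) < top" if g: "g \<in> ?V" for g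
  proof -
    have p: "pos_part g \<in> ?V" using g by (rule pos_part_bdd_supp)
    obtain K where K: "\<And>a l. 0 < l \<Longrightarrow> N a l (pos_part g) \<le> K" using p by (rule N_bounded) blast
    have "(\<integral>\<^sup>+x. ennreal \<bar>f x\<bar> * ennreal (pos_part g x) \<partial>M) \<le> ennreal (C * K)"
      by (rule pair_le[OF p]) (use K L in \<open>auto simp: pos_part_def le_fun_def\<close>)
    moreover have "ennreal (pos_part g x) = ennreal (g x)" for x
      by (simp add: pos_part_def max_def ennreal_neg)
    ultimately show ?thesis using ennreal_less_top by (auto intro: le_less_trans)
  qed
  define T where "T = (\<lambda>g. \<integral>x. \<bar>f x\<bar> * g x \<partial>M)"
  have int: "integrable M (\<lambda>x. \<bar>f x\<bar> * g x)" if g: "g \<in> ?V" for g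
  proof (rule integrableI_bounded)
    note [measurable] = measurable_bdd_supp[OF g]
    show "(\<lambda>x. \<bar>f x\<bar> * g x) \<in> borel_measurable M" by measurable
    have "(\<lambda>x. \<bar>g x\<bar>) \<in> ?V" by (rule bdd_supp_dominated[OF g]) auto
    from loc[OF this] show "(\<integral>\<^sup>+x. ennreal (norm (\<bar>f x\<bar> * g x)) \<partial>M) < \<infinity>"
      by (simp add: abs_mult ennreal_mult)
  qed
  have ennT: "ennreal (T g) = (\<integral>\<^sup>+x. ennreal \<bar>f x\<bar> * ennreal (g x) \<partial>M)" if "g \<in> ?V" "0 \<le> g" for g
  proof -
    have "(\<integral>\<^sup>+x. ennreal (\<bar>f x\<bar> * g x) \<partial>M) = ennreal (T g)"
      unfolding T_def using that by (intro nn_integral_eq_integral int) (auto simp: le_fun_def)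
    then show ?thesis using that by (simp add: ennreal_mult le_fun_def)
  qed
  have T_pos: "0 \<le> T g" if "g \<in> ?V" "0 \<le> g" for g
    unfolding T_def using that by (intro integral_nonneg_AE) (auto simp: le_fun_def)
  have T_add: "T (g + h) = T g + T h" if "g \<in> ?V" "h \<in> ?V" for g h
    unfolding T_def using Bochner_Integration.integral_add[OF int[OF that(1)] int[OF that(2)]]
    by (simp add: distrib_left)
  have T_scale: "T (k *\<^sub>R g) = k * T g" if "g \<in> ?V" for g k
  proof -
    have "(\<integral>x. \<bar>f x\<bar> * (k *\<^sub>R g) x \<partial>M) = (\<integral>x. k * (\<bar>f x\<bar> * g x) \<partial>M)"
      by (intro Bochner_Integration.integral_cong) auto
    then show ?thesis unfolding T_def by simp
  qed
  have T_le: "T g \<le> C * K" if "g \<in> ?V" "0 \<le> g" "\<And>i. Ni i g \<le> K" for g K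
  proof -
    have "0 \<le> K" using order_trans[OF N_nonneg that(3)[unfolded Ni_def]] .
    moreover have "ennreal (T g) \<le> ennreal (C * K)"
      unfolding ennT[OF that(1,2)] by (rule pair_le[OF that(1,2)]) (use that(3) in \<open>simp add: Ni_def\<close>)
    ultimately show ?thesis using C by (simp add: ennreal_le_iff)
  qed
  have N_c0': "finite {i. e < Ni i g}" if g: "g \<in> ?V" and e: "0 < e" for g e
  proof -
    obtain r d where d: "0 < d" "\<And>a l. 0 < l \<Longrightarrow> e < N a l g
     \<Longrightarrow> d \<le> l \<and> l \<le> 1 / d \<and> cube n a l \<inter> cube n (\<lambda>_. - r) (2 * r) \<noteq> {}"
      apply (rule N_c0[OF g e])
      subgoal premises prems for r d by (rule that[of d r]) (fact prems)+
      done
    show ?thesis by (rule finite_subset[OF _ fin[OF d(1), of r]]) (use d(2) L in \<open>auto simp: Ni_def\<close>)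
  qed
  obtain S w where S_add: "\<And>i g h. g \<in> ?V \<Longrightarrow> h \<in> ?V \<Longrightarrow> S i (g + h) = S i g + S i h"
    and S_scale: "\<And>i g c. g \<in> ?V \<Longrightarrow> S i (c *\<^sub>R g) = c * S i g"
    and S_pos: "\<And>i g. g \<in> ?V \<Longrightarrow> 0 \<le> g \<Longrightarrow> 0 \<le> S i g"
    and S_N: "\<And>i g. g \<in> ?V \<Longrightarrow> 0 \<le> g \<Longrightarrow> S i g \<le> w i * Ni i g"
    and w: "\<And>i::nat. 0 \<le> w i" "summable w" "suminf w \<le> C"
    and S_sums: "\<And>g. g \<in> ?V \<Longrightarrow> 0 \<le> g \<Longrightarrow> (\<lambda>i. S i g) sums T g"
    apply (rule c0_sum_dual[where V = ?V and N = Ni and T = T and C = C])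
    subgoal by (rule subspace_bdd_supp)
    subgoal by (rule pos_part_bdd_supp)
    subgoal unfolding Ni_def by (rule N_nonneg)
    subgoal unfolding Ni_def by (rule N_add[OF _ _ _ _ L])
    subgoal unfolding Ni_def by (rule N_scale)
    subgoal unfolding Ni_def by (rule N_mono[OF _ L])
    subgoal by (rule N_c0')
    subgoal by (rule T_add)
    subgoal by (rule T_scale)
    subgoal by (rule T_pos)
    subgoal by (rule T_le)
    subgoal by (rule C)
    subgoal premises prems for S w by (rule that[of S w]) (fact prems)+
    done
  \<comment> \<open>Each \<open>S i g\<close> is one term of a nonnegative series with sum
    \<open>T g\<close>.\<close>
  have S_le: "ennreal (S i g) \<le> (\<integral>\<^sup>+x. ennreal \<bar>f x\<bar> * ennreal (g x) \<partial>M)" if g: "g \<in> ?V" "0 \<le> g" for i g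
  proof -
    have "sum (\<lambda>i. S i g) {i} \<le> (\<Sum>i. S i g)"
      using S_sums[OF g] S_pos[OF g] by (intro sum_le_suminf) (auto simp: sums_iff)
    then have "S i g \<le> T g" using S_sums[OF g] by (simp add: sums_iff)
    then show ?thesis unfolding ennT[OF g, symmetric] by (rule ennreal_leI)
  qed
  define ok where "ok = (\<lambda>i \<phi>. \<phi> \<in> borel_measurable M \<and> (\<forall>x. 0 \<le> \<phi> x) \<and> (\<forall>x. x \<notin> Q i \<longrightarrow> \<phi> x = 0) \<and>
    (\<forall>A\<in>sets M. (\<integral>\<^sup>+x. ennreal (\<phi> x) * indicator A x \<partial>M) = ennreal (S i (indicator (A \<inter> Q i)))))"
  have "\<exists>\<phi>. ok i \<phi>" for i
    apply (rule positive_functional_density[where S = "S i" and f = f and n = n and a = "c i" and l = "L i"])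
    subgoal by (rule f)
    subgoal by (rule loc)
    subgoal by (rule S_add)
    subgoal by (rule S_pos)
    subgoal by (rule S_le)
    subgoal premises prems for \<phi>
      unfolding ok_def Q_def using prems by (intro exI[of _ \<phi>] conjI allI impI ballI) simp_all
    done
  then have ok: "ok i (SOME \<phi>. ok i \<phi>)" for i by (rule someI_ex)
  define \<phi> where "\<phi> = (\<lambda>i. SOME \<phi>. ok i \<phi>)"
  have ok': "ok i (\<phi> i)" for i unfolding \<phi>_def by (rule ok)
  have \<phi>: "\<phi> i \<in> borel_measurable M" "0 \<le> \<phi> i x" "x \<notin> Q i \<Longrightarrow> \<phi> i x = 0" for i x
    using ok'[of i] unfolding ok_def by blast+
  have rep: "(\<integral>\<^sup>+x. ennreal (\<phi> i x) * indicator A x \<partial>M) = ennreal (S i (indicator (A \<inter> Q i)))"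
    if "A \<in> sets M" for i A
    using ok'[of i] that unfolding ok_def by blast
  note [measurable] = \<phi>(1)
  \<comment> \<open>The simple test functions give elements of the domain of \<open>S i\<close>,
    where \<open>S i \<le> w i * Ni i\<close>; the weight inside \<open>Ni i\<close> becomes the
    size allowed to a block on this cube.\<close>
  have norm_\<phi>: "mixE P' n (\<lambda>x. ennreal (\<phi> i x)) u \<le> ennreal (w i * morrey_factor n p0 P (L i))" for i
  proof (rule mixE_converse_Holder[OF _ _ _ PP'(1-3)])
    show "(\<lambda>x. ennreal (\<phi> i x)) \<in> borel_measurable M" by measurable
    show "ennreal (\<phi> i x) = 0" if "x \<notin> cube n (c i) (L i)" for x
      using \<phi>(3)[of x i] that by (simp add: Q_def)
    fix s :: "(nat \<Rightarrow> real) \<Rightarrow> ennreal"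
    assume s: "simple_function M s" "\<And>x. s x < top" "\<And>x. x \<notin> cube n (c i) (L i) \<Longrightarrow> s x = 0"
    define g where "g = (\<lambda>x. enn2real (s x))"
    have ds: "g \<in> ?V" "(\<integral>\<^sup>+x. ennreal (\<phi> i x) * s x \<partial>M) = ennreal (S i g)"
      unfolding g_def
      by (rule density_simple_function[where S = "S i" and \<phi> = "\<phi> i" and a = "c i" and l = "L i",
          OF S_add S_scale S_pos \<phi>(1) rep[unfolded Q_def] s]; assumption)+
    have g0: "0 \<le> g" by (simp add: g_def le_fun_def)
    have gs: "ennreal (g x) * indicator (cube n (c i) (L i)) x = s x" for x
      using s(2,3)[of x] by (cases "x \<in> cube n (c i) (L i)") (auto simp: g_def)
    have "(\<integral>\<^sup>+x. ennreal (\<phi> i x) * s x \<partial>M) \<le> ennreal (w i * Ni i g)"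
      unfolding ds(2) by (intro ennreal_leI S_N ds(1) g0)
    also have "\<dots> = ennreal (w i * morrey_factor n p0 P (L i)) * mixE P n s u"
      using ennreal_N[OF ds(1) L, of "c i" i] w(1)[of i]
      by (simp add: Ni_def ennreal_mult N_nonneg gs mult.assoc)
    finally show "(\<integral>\<^sup>+x. ennreal (\<phi> i x) * s x \<partial>M) \<le> ennreal (w i * morrey_factor n p0 P (L i)) * mixE P n s u" .
  qed (use L[of i] in auto)
  \<comment> \<open>\<open>S i\<close> does not see values off \<open>Q i\<close>, as
    \<open>Ni i\<close> vanishes on them. So the density of the functional cut to \<open>Q i\<close>
    represents \<open>S i\<close> itself on bounded sets.\<close>
  have S_cut: "S i (indicator A) = S i (indicator (A \<inter> Q i))" if A: "A \<in> sets M" "A \<subseteq> cube n a l" for A a l i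
  proof -
    have V1: "indicator (A \<inter> Q i) \<in> ?V" "indicator (A - Q i) \<in> ?V"
      using A by (auto intro!: indicator_bdd_supp[where a = a and l = l] simp: Q_def)
    have "indicator A = (indicator (A \<inter> Q i) + indicator (A - Q i) :: (nat \<Rightarrow> real) \<Rightarrow> real)"
      by (auto simp: fun_eq_iff indicator_def)
    then have "S i (indicator A) = S i (indicator (A \<inter> Q i)) + S i (indicator (A - Q i))"
      by (simp only: S_add V1)
    moreover have "Ni i (indicator (A - Q i)) = 0"
      unfolding Ni_def by (rule N_eq_0) (simp add: Q_def)
    then have "S i (indicator (A - Q i)) = 0"
      using S_N[OF V1(2) indicator_nonneg_fun, of i] S_pos[OF V1(2) indicator_nonneg_fun, of i] by simp
    ultimately show ?thesis by simp
  qed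
  have eq_int: "(\<integral>\<^sup>+x. (\<Sum>i. ennreal (\<phi> i x)) * indicator A x \<partial>M) = (\<integral>\<^sup>+x. ennreal \<bar>f x\<bar> * indicator A x \<partial>M)"
    if A: "A \<in> sets M" "A \<subseteq> cube n a l" for A a l
  proof -
    have V1: "indicator A \<in> ?V" using A by (rule indicator_bdd_supp)
    note [measurable] = A(1)
    have "(\<integral>\<^sup>+x. (\<Sum>i. ennreal (\<phi> i x)) * indicator A x \<partial>M) = (\<integral>\<^sup>+x. (\<Sum>i. ennreal (\<phi> i x) * indicator A x) \<partial>M)"
      by (simp add: ennreal_suminf_multc)
    also have "\<dots> = (\<Sum>i. \<integral>\<^sup>+x. ennreal (\<phi> i x) * indicator A x \<partial>M)"
      by (intro nn_integral_suminf) measurable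
    also have "\<dots> = (\<Sum>i. ennreal (S i (indicator A)))"
      by (simp add: rep[OF A(1)] S_cut[OF A])
    also have "\<dots> = ennreal (T (indicator A))"
      by (rule suminf_ennreal_eq[OF S_pos[OF V1 indicator_nonneg_fun] S_sums[OF V1 indicator_nonneg_fun]])
    also have "\<dots> = (\<integral>\<^sup>+x. ennreal \<bar>f x\<bar> * indicator A x \<partial>M)"
      unfolding ennT[OF V1 indicator_nonneg_fun] by (intro nn_integral_cong) (auto simp: indicator_def)
    finally show ?thesis .
  qed
  \<comment> \<open>Uniqueness of densities requires a finite integral, so it is applied on centred
    cubes of integer half-side; these exhaust the space and leave countably many null sets.\<close>
  have "AE x in M. (\<Sum>i. ennreal (\<phi> i x)) * indicator (cube n (\<lambda>_. - real r) (2 * real r)) x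
      = ennreal \<bar>f x\<bar> * indicator (cube n (\<lambda>_. - real r) (2 * real r)) x" for r
  proof -
    let ?R = "cube n (\<lambda>_. - real r) (2 * real r)"
    let ?g = "\<lambda>x. (\<Sum>i. ennreal (\<phi> i x)) * indicator ?R x" and ?h = "\<lambda>x. ennreal \<bar>f x\<bar> * indicator ?R x"
    have "integral\<^sup>N M ?g = integral\<^sup>N M ?h" by (rule eq_int) auto
    also have "\<dots> = (\<integral>\<^sup>+x. ennreal \<bar>f x\<bar> * ennreal (indicator ?R x) \<partial>M)"
      by (intro nn_integral_cong) (auto simp: indicator_def)
    also have "\<dots> < top" by (intro loc indicator_bdd_supp[OF _ order.refl]) simp
    finally have "integral\<^sup>N M ?g \<noteq> \<infinity>" by simp
    moreover have "density M ?g = density M ?h"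
    proof (rule measure_eqI)
      fix A assume "A \<in> sets (density M ?g)"
      then have A: "A \<in> sets M" by simp
      have "(\<integral>\<^sup>+x. ?g x * indicator A x \<partial>M) = (\<integral>\<^sup>+x. (\<Sum>i. ennreal (\<phi> i x)) * indicator (?R \<inter> A) x \<partial>M)"
        by (intro nn_integral_cong) (auto simp: indicator_def)
      also have "\<dots> = (\<integral>\<^sup>+x. ennreal \<bar>f x\<bar> * indicator (?R \<inter> A) x \<partial>M)"
        using A by (intro eq_int[of _ "\<lambda>_. - real r" "2 * real r"]) auto
      also have "\<dots> = (\<integral>\<^sup>+x. ?h x * indicator A x \<partial>M)"
        by (intro nn_integral_cong) (auto simp: indicator_def)
      finally show "emeasure (density M ?g) A = emeasure (density M ?h) A"
        using A by (simp add: emeasure_density)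
    qed simp
    ultimately show ?thesis by (subst (asm) finite_density_unique) auto
  qed
  then have "AE x in M. \<forall>r::nat. (\<Sum>i. ennreal (\<phi> i x)) * indicator (cube n (\<lambda>_. - real r) (2 * real r)) x
      = ennreal \<bar>f x\<bar> * indicator (cube n (\<lambda>_. - real r) (2 * real r)) x"
    by (simp add: AE_all_countable)
  then have ae: "AE x in M. (\<Sum>i. ennreal (\<phi> i x)) = ennreal \<bar>f x\<bar>"
    using AE_space
  proof eventually_elim
    case (elim x)
    \<comment> \<open>\<open>cube n x 0\<close> is the single point \<open>x\<close>, so this yields
      a centred cube around it.\<close>
    obtain r where r: "cube n x 0 \<subseteq> cube n (\<lambda>_. - r) (2 * r)" by (rule cube_subset_centered)
    obtain m :: nat where "r \<le> real m" using real_arch_simple by blast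
    with r have "cube n x 0 \<subseteq> cube n (\<lambda>_. - real m) (2 * real m)" using cube_mono by blast
    moreover have "x \<in> cube n x 0" using elim(2) by (simp add: cube_def space_Lb)
    ultimately show ?case using elim(1)[rule_format, of m] by (auto simp: indicator_def split: if_splits)
  qed
  show thesis
  proof (rule that[of L w \<phi> c])
    show "suminf w \<le> q powr (2 * \<delta>) * C0" using w(3) by (simp only: C_def)
    show "\<phi> i x = 0" if "x \<notin> cube n (c i) (L i)" for i x using \<phi>(3)[of x i] that unfolding Q_def by blast
  qed (fact L w \<phi> norm_\<phi> ae loc)+
qed

text \<open>The signs of \<open>f\<close> are put back: the partial sums are
  \<open>sgn (f x)\<close> times those of the \<open>\<phi> i x\<close>, which increase to
  \<open>\<bar>f x\<bar>\<close> almost everywhere. The remainder is therefore at most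
  \<open>\<bar>f x\<bar>\<close> in modulus, and dominated convergence on each cube gives
  convergence in the local L^1 sense.\<close>

lemma block_decomp_exists:
  assumes f [measurable]: "f \<in> borel_measurable M" and C0: "0 \<le> C0" "kothe_sup n p0 P f \<le> ennreal C0"
    and q: "1 < q" and e: "0 < e"
  obtains lam b where "block_decomp n p0 P f lam b" "(\<Sum>i. \<bar>lam i\<bar>) \<le> q powr (2 * \<delta>) * C0 + e"
proof -
  obtain a :: "nat \<Rightarrow> nat \<Rightarrow> real" and L w :: "nat \<Rightarrow> real" and \<phi> :: "nat \<Rightarrow> (nat \<Rightarrow> real) \<Rightarrow> real"
  where L: "\<And>i. 0 < L i" and w: "\<And>i. 0 \<le> w i" "summable w" "suminf w \<le> q powr (2 * \<delta>) * C0"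
    and \<phi> [measurable]: "\<And>i. \<phi> i \<in> borel_measurable M"
    and \<phi>': "\<And>i x. 0 \<le> \<phi> i x" "\<And>i x. x \<notin> cube n (a i) (L i) \<Longrightarrow> \<phi> i x = 0"
    and norm_\<phi>: "\<And>i. mixE P' n (\<lambda>x. ennreal (\<phi> i x)) u \<le> ennreal (w i * morrey_factor n p0 P (L i))"
    and ae: "AE x in M. (\<Sum>i. ennreal (\<phi> i x)) = ennreal \<bar>f x\<bar>"
    and loc: "\<And>g. g \<in> bdd_supp n \<Longrightarrow> (\<integral>\<^sup>+x. ennreal \<bar>f x\<bar> * ennreal (g x) \<partial>M) < top"
    apply (rule positive_decomposition[OF f C0 q])
    subgoal premises prems for a L w \<phi> by (rule that[of L w \<phi> a]) (fact prems)+
    done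
  \<comment> \<open>Adding a summable positive sequence avoids division by a vanishing coefficient.\<close>
  define lam where "lam = (\<lambda>i. w i + e * (1 / 2) ^ Suc i)"
  define b where "b = (\<lambda>i x. sgn (f x) * \<phi> i x / lam i)"
  have lam_pos: "0 < lam i" for i using w(1)[of i] e by (simp add: lam_def add_nonneg_pos)
  have w_lam: "w i \<le> lam i" for i using e by (simp add: lam_def)
  \<comment> \<open>The geometric series sums to 1, so the added coefficients cost \<open>e\<close>
    in total.\<close>
  have lam_sums: "lam sums (suminf w + e * 1)"
    unfolding lam_def using power_half_series
    by (intro sums_add sums_mult summable_sums w) auto
  have lam_abs: "(\<lambda>i. \<bar>lam i\<bar>) = lam" using lam_pos by (auto simp: fun_eq_iff abs_of_pos)
  have [measurable]: "b i \<in> borel_measurable M" for i unfolding b_def by measurable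
  have lb: "lam i * b i x = sgn (f x) * \<phi> i x" for i x using lam_pos[of i] by (simp add: b_def)
  have block: "is_block n p0 P (b i)" for i
    unfolding is_block_def
  proof (intro conjI exI)
    show "b i \<in> borel_measurable (Rn n)" by (rule borel_measurable_Rn) measurable
    show "0 < L i" by (rule L)
    show "\<forall>x\<in>space (Rn n). b i x \<noteq> 0 \<longrightarrow> x \<in> cube n (a i) (L i)"
      using \<phi>'(2)[of _ i] by (auto simp: b_def)
    have "mixed_norm n P' (b i) \<le> mixE P' n (\<lambda>x. ennreal (1 / lam i) * ennreal (\<phi> i x)) u"
      unfolding mixed_norm_eq_mixE
    proof (rule mixE_mono[OF _ _ order.refl])
      fix x
      have "\<bar>b i x\<bar> \<le> 1 / lam i * \<phi> i x"
        using lam_pos[of i] \<phi>'(1)[of i x] by (auto simp: b_def abs_mult abs_sgn_eq)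
      then show "ennreal \<bar>b i x\<bar> \<le> ennreal (1 / lam i) * ennreal (\<phi> i x)"
        using lam_pos[of i] \<phi>'(1)[of i x] by (simp add: ennreal_leI flip: ennreal_mult)
    next
      show "0 < P' j" if "j < n" for j using PP'(2)[OF that] by simp
    qed auto
    also have "\<dots> = ennreal (1 / lam i) * mixE P' n (\<lambda>x. ennreal (\<phi> i x)) u"
    proof (rule mixE_cmult[OF _ refl _ order.refl])
      show "0 < P' j" if "j < n" for j using PP'(2)[OF that] by simp
    qed auto
    also have "\<dots> \<le> ennreal (1 / lam i) * ennreal (w i * morrey_factor n p0 P (L i))"
      by (intro mult_left_mono norm_\<phi>) auto
    also have "\<dots> = ennreal (w i / lam i * morrey_factor n p0 P (L i))"
      using lam_pos[of i] w(1)[of i] by (simp flip: ennreal_mult)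
    also have "\<dots> \<le> ennreal (1 * morrey_factor n p0 P (L i))"
      using lam_pos[of i] w_lam[of i] by (intro ennreal_leI mult_right_mono) auto
    finally show "mixed_norm n P' (b i) \<le> ennreal (morrey_factor n p0 P (L i))" by simp
  qed
  have conv: "AE x in M. (\<lambda>k. \<Sum>i<k. \<phi> i x) \<longlonglongrightarrow> \<bar>f x\<bar> \<and> (\<forall>k. (\<Sum>i<k. \<phi> i x) \<le> \<bar>f x\<bar>)"
    using ae
  proof eventually_elim
    case (elim x)
    have sum_eq: "(\<Sum>i<k. ennreal (\<phi> i x)) = ennreal (\<Sum>i<k. \<phi> i x)" for k
      using \<phi>'(1) by (intro sum_ennreal) auto
    have "(\<lambda>k. \<Sum>i<k. ennreal (\<phi> i x)) \<longlonglongrightarrow> ennreal \<bar>f x\<bar>"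
      unfolding elim[symmetric] by (rule summable_LIMSEQ) simp
    then have "(\<lambda>k. \<Sum>i<k. \<phi> i x) \<longlonglongrightarrow> \<bar>f x\<bar>"
      unfolding sum_eq using \<phi>'(1) by (subst (asm) tendsto_ennreal_iff) (auto simp: sum_nonneg)
    moreover have "(\<Sum>i<k. \<phi> i x) \<le> \<bar>f x\<bar>" for k
    proof -
      have "ennreal (\<Sum>i<k. \<phi> i x) \<le> ennreal \<bar>f x\<bar>"
        unfolding elim[symmetric] sum_eq[symmetric] by (rule sum_le_suminf) auto
      then show ?thesis by simp
    qed
    ultimately show ?case by blast
  qed
  have partial: "(\<Sum>i<k. lam i * b i x) = sgn (f x) * (\<Sum>i<k. \<phi> i x)" for k x
    by (simp add: lb sum_distrib_left)
  have lim: "(\<lambda>k. \<Sum>i<k. lam i * b i x) \<longlonglongrightarrow> f x"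
    if "(\<lambda>k. \<Sum>i<k. \<phi> i x) \<longlonglongrightarrow> \<bar>f x\<bar>" for x
    using tendsto_mult_left[OF that, of "sgn (f x)"] unfolding partial by (simp add: sgn_mult_abs)
  have L1: "(\<lambda>k. \<integral>\<^sup>+ x \<in> C. ennreal \<bar>(\<Sum>i<k. lam i * b i x) - f x\<bar> \<partial>Rn n) \<longlonglongrightarrow> 0"
    if CQ: "C \<in> cubes n" for C
  proof -
    obtain a' l' where C: "C = cube n a' l'" using CQ by (auto simp: cubes_def)
    have "(\<lambda>k. \<integral>\<^sup>+ x. ennreal \<bar>(\<Sum>i<k. lam i * b i x) - f x\<bar> * indicator C x \<partial>M) \<longlonglongrightarrow> (\<integral>\<^sup>+x. 0 \<partial>M)"
    proof (rule nn_integral_dominated_convergence[where w = "\<lambda>x. ennreal \<bar>f x\<bar> * ennreal (indicator C x)"])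
      show "(\<integral>\<^sup>+x. ennreal \<bar>f x\<bar> * ennreal (indicator C x) \<partial>M) < \<infinity>"
        using loc[OF indicator_bdd_supp[OF cube_sets order.refl]] by (simp add: C)
      show "AE x in M. ennreal \<bar>(\<Sum>i<k. lam i * b i x) - f x\<bar> * indicator C x \<le> ennreal \<bar>f x\<bar> * ennreal (indicator C x)" for k
        using conv
      proof eventually_elim
        case (elim x)
        have s: "0 \<le> (\<Sum>i<k. \<phi> i x)" "(\<Sum>i<k. \<phi> i x) \<le> \<bar>f x\<bar>" using elim \<phi>'(1) by (auto intro: sum_nonneg)
        have "\<bar>(\<Sum>i<k. lam i * b i x) - f x\<bar> \<le> \<bar>f x\<bar>"
          unfolding partial using s by (auto simp: sgn_if split: if_splits)
        then show ?case by (auto simp: indicator_def ennreal_leI)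
      qed
      show "AE x in M. (\<lambda>k. ennreal \<bar>(\<Sum>i<k. lam i * b i x) - f x\<bar> * indicator C x) \<longlonglongrightarrow> 0"
        using conv
      proof eventually_elim
        case (elim x)
        have "(\<lambda>k. (\<Sum>i<k. lam i * b i x) - f x) \<longlonglongrightarrow> f x - f x"
          using elim by (intro tendsto_diff lim tendsto_const) auto
        then have "(\<lambda>k. ennreal \<bar>(\<Sum>i<k. lam i * b i x) - f x\<bar>) \<longlonglongrightarrow> ennreal \<bar>f x - f x\<bar>"
          by (intro tendsto_ennrealI tendsto_rabs)
        then show ?case by (cases "x \<in> C") auto
      qed
    qed (auto simp: C)
    then show ?thesis by (simp add: nn_integral_Rn)
  qed
  have "block_decomp n p0 P f lam b"
    unfolding block_decomp_def lam_abs
  proof (intro conjI allI ballI block L1)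
    show "summable lam" using lam_sums by (rule sums_summable)
    show "AE x in Rn n. (\<lambda>k. \<Sum>i<k. lam i * b i x) \<longlonglongrightarrow> f x"
      unfolding AE_Rn using conv by eventually_elim (use lim in blast)
  qed
  moreover have "(\<Sum>i. \<bar>lam i\<bar>) \<le> q powr (2 * \<delta>) * C0 + e"
    unfolding lam_abs using lam_sums w(3) by (simp add: sums_iff)
  ultimately show thesis by (rule that)
qed

section \<open>Passage to the limit, and equality of the norms\<close>

lemma kothe_sup_cong_AE:
  assumes "AE x in M. f x = g x"
  shows "kothe_sup n p0 P f = kothe_sup n p0 P g"
proof -
  have "(\<integral>\<^sup>+x. ennreal \<bar>f x * h x\<bar> \<partial>Rn n) = (\<integral>\<^sup>+x. ennreal \<bar>g x * h x\<bar> \<partial>Rn n)" for h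
    unfolding nn_integral_Rn by (rule nn_integral_cong_AE) (use assms in auto)
  then show ?thesis by (simp add: kothe_sup_def)
qed

lemma block_decomp_cong_AE:
  assumes "AE x in M. f x = g x" and d: "block_decomp n p0 P f lam b"
  shows "block_decomp n p0 P g lam b"
  unfolding block_decomp_def
proof (intro conjI ballI)
  show "AE x in Rn n. (\<lambda>N. \<Sum>i<N. lam i * b i x) \<longlonglongrightarrow> g x"
  proof -
    have "AE x in M. (\<lambda>N. \<Sum>i<N. lam i * b i x) \<longlonglongrightarrow> f x"
      using d by (simp add: block_decomp_def AE_Rn)
    then show ?thesis unfolding AE_Rn using assms(1) by eventually_elim simp
  qed
  fix Q assume "Q \<in> cubes n"
  have "(\<integral>\<^sup>+x\<in>Q. ennreal \<bar>(\<Sum>i<N. lam i * b i x) - f x\<bar> \<partial>Rn n)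
      = (\<integral>\<^sup>+x\<in>Q. ennreal \<bar>(\<Sum>i<N. lam i * b i x) - g x\<bar> \<partial>Rn n)" for N
    unfolding nn_integral_Rn by (rule nn_integral_cong_AE) (use assms in auto)
  moreover have "(\<lambda>N. \<integral>\<^sup>+x\<in>Q. ennreal \<bar>(\<Sum>i<N. lam i * b i x) - f x\<bar> \<partial>Rn n) \<longlonglongrightarrow> 0"
    using d \<open>Q \<in> cubes n\<close> unfolding block_decomp_def by blast
  ultimately show "(\<lambda>N. \<integral>\<^sup>+x\<in>Q. ennreal \<bar>(\<Sum>i<N. lam i * b i x) - g x\<bar> \<partial>Rn n) \<longlonglongrightarrow> 0"
    by presburger
qed (use d in \<open>auto simp: block_decomp_def\<close>)

text \<open>Decompositions are built for a Borel representative \<open>f0\<close> and carried over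
  to \<open>f\<close>. Each pair \<open>q > 1\<close>, \<open>e > 0\<close> bounds the block norm by
  \<open>q powr (2 * \<delta>) * C0 + e\<close>, which tends to \<open>C0\<close>.\<close>

lemma kothe_dual:
  assumes f: "f \<in> borel_measurable (Rn n)" and fin: "kothe_sup n p0 P f < top"
  shows "f \<in> block_space n p0 P" and "block_norm n p0 P f \<le> kothe_sup n p0 P f"
proof -
  obtain f0 where f0: "f0 \<in> borel_measurable M" "AE x in M. f x = f0 x"
    using Rn_ex_borel[OF f] by blast
  obtain C0 where C0: "0 \<le> C0" "kothe_sup n p0 P f = ennreal C0"
    using fin by (cases "kothe_sup n p0 P f") auto
  have C0': "kothe_sup n p0 P f0 \<le> ennreal C0"
    using kothe_sup_cong_AE[OF f0(2)] C0(2) by simp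
  have f0': "AE x in M. f0 x = f x" using f0(2) by eventually_elim simp
  have ex: "\<exists>lam b. block_decomp n p0 P f lam b \<and> (\<Sum>i. \<bar>lam i\<bar>) \<le> q powr (2 * \<delta>) * C0 + e"
    if "1 < q" "0 < e" for q e
    by (rule block_decomp_exists[OF f0(1) C0(1) C0' that]) (blast intro: block_decomp_cong_AE[OF f0'])
  show "f \<in> block_space n p0 P"
    using ex[of 2 1] f by (auto simp: block_space_def)
  have le: "block_norm n p0 P f \<le> ennreal (q powr (2 * \<delta>) * C0 + e)" if qe: "1 < q" "0 < e" for q e
  proof -
    obtain lam b where lb: "block_decomp n p0 P f lam b" "(\<Sum>i. \<bar>lam i\<bar>) \<le> q powr (2 * \<delta>) * C0 + e"
      using ex[OF qe] by blast
    have "block_norm n p0 P f \<le> ennreal (\<Sum>i. \<bar>lam i\<bar>)"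
      unfolding block_norm_def using lb(1) by (intro INF_lower2[of "(lam, b)"]) auto
    also have "\<dots> \<le> ennreal (q powr (2 * \<delta>) * C0 + e)" by (rule ennreal_leI[OF lb(2)])
    finally show ?thesis .
  qed
  \<comment> \<open>One null sequence serves twice: \<open>q = 1 + ?t k\<close> and
    \<open>e = ?t k\<close>.\<close>
  let ?t = "\<lambda>k. inverse (real (Suc k))"
  have "(\<lambda>k. (1 + ?t k) powr (2 * \<delta>) * C0 + ?t k) \<longlonglongrightarrow> (1 + 0) powr (2 * \<delta>) * C0 + 0"
    by (intro tendsto_intros LIMSEQ_inverse_real_of_nat) auto
  then have "(\<lambda>k. ennreal ((1 + ?t k) powr (2 * \<delta>) * C0 + ?t k)) \<longlonglongrightarrow> ennreal C0"
    by (intro tendsto_ennrealI) simp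
  then have "block_norm n p0 P f \<le> ennreal C0"
    by (rule LIMSEQ_le_const) (intro exI[of _ 0] allI impI le; simp)
  then show "block_norm n p0 P f \<le> kothe_sup n p0 P f" by (simp add: C0)
qed

lemma kothe_sup_le_block_norm: "kothe_sup n p0 P f \<le> block_norm n p0 P f"
  unfolding block_norm_def by (rule INF_greatest) (auto intro: kothe_sup_le_decomp P_gt)

end

theorem theorem4p2:
  fixes n :: nat and p0 :: real and P :: "nat \<Rightarrow> real"
    and f :: "(nat \<Rightarrow> real) \<Rightarrow> real"
  assumes "n \<ge> 1"
    and "1 < p0"
    and "\<And>i. i < n \<Longrightarrow> 1 < P i"
    and "real n / p0 < (\<Sum>i<n. 1 / P i)"
    and "f \<in> borel_measurable (Rn n)"
  shows "(kothe_sup n p0 P f < (\<infinity>::ennreal) \<longleftrightarrow> f \<in> block_space n p0 P)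
    \<and> (f \<in> block_space n p0 P \<longrightarrow> kothe_sup n p0 P f = block_norm n p0 P f)"
proof -
  interpret morrey n p0 P using assms by unfold_locales
  \<comment> \<open>Any single decomposition has a finite l^1 norm, and this bounds the
    supremum.\<close>
  have fin: "kothe_sup n p0 P f < top" if B: "f \<in> block_space n p0 P"
  proof -
    obtain lam b where "block_decomp n p0 P f lam b" using B by (auto simp: block_space_def)
    then have "kothe_sup n p0 P f \<le> ennreal (\<Sum>i. \<bar>lam i\<bar>)" by (rule kothe_sup_le_decomp) (rule P_gt)
    then show ?thesis by (rule le_less_trans) simp
  qed
  show ?thesis
    using fin kothe_dual[OF assms(5)] kothe_sup_le_block_norm[of f]
    by (auto intro: antisym simp: less_top)
qed

end
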